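(* For every $\alpha\in[g,G]$, the (Kolmogorov–Sinai) entropies of $(\varphi_\alpha,\nu_\alpha)$ and of $(\Phi_\alpha,\tilde\mu_\alpha)$ are $$h_{\tilde\mu_\alpha}(\Phi_\alpha)=h_{\nu_\alpha}(\varphi_\alpha)=\frac{\pi^2}{9\log G}.$$
   Context: $g=\frac12(\sqrt5-1)$, $G=\frac12(\sqrt5+1)$, $[\cdot]$ in the formula for $d_\alpha$ is the integer part (floor). $I_\alpha=[\alpha-2,\alpha)$. For $x\ne0$, $d_\alpha(x)=2\left[\frac1{2|x|}+\frac{1-\alpha}2\right]+1$ and $\varphi_\alpha(x)=\frac1{|x|}-d_\alpha(x)$, with $\varphi_\alpha(0)=0$; the same formulas at $x=\alpha$ define $\varphi_\alpha(\alpha)=\frac1\alpha-d_\alpha(\alpha)$. With $e(x)=\operatorname{sign}(x)$, define for $x\neq0$ $$\Phi_\alpha(x,y)=\left(\varphi_\alpha(x),\frac1{d_\alpha(x)+e(x)y}\right).$$ For $g<\alpha<G$, $$\Omega_\alpha=\big(I_\alpha\times[0,2-G)\big)\cup\big((\varphi_\alpha(\alpha),\alpha)\times(2-G,1]\big)\cup\big([\varphi_\alpha(\alpha-2),\alpha)\times[1,G)\big),$$ while $\Omega_g=\big([g-2,g)\times[0,1-g)\big)\cup\big([\frac{g-1}{2-g},g)\times[1,G)\big)$ and $\Omega_G=[G-2,G)\times[0,1)$. $\Phi_\alpha$ is a bijection of $\Omega_\alpha$ up to null-sets, preserving $d\mu_\alpha=(1+xy)^{-2}dx\,dy$, which has total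 mass $3\log G$; $\tilde\mu_\alpha=(3\log G)^{-1}\mu_\alpha$ is the normalized invariant probability measure. The $\varphi_\alpha$-invariant probability measure $\nu_\alpha$ on $I_\alpha$ is $\nu_\alpha(E)=\tilde\mu_\alpha(\{(x,y)\in\Omega_\alpha:x\in E\})$ for Borel $E\subseteq I_\alpha$. *)

theory Defs
  imports "HOL-Probability.Probability"
begin

section \<open>Kolmogorov--Sinai entropy\<close>

text \<open>
  Entropies use the natural logarithm. The value of \<open>ln\<close> at 0 is immaterial, as it is
  multiplied by 0.
\<close>

definition partition_entropy :: "'a measure \<Rightarrow> 'a set set \<Rightarrow> real" where
  "partition_entropy M P = - (\<Sum>A\<in>P. measure M A * ln (measure M A))"

definition finite_measurable_partition :: "'a measure \<Rightarrow> 'a set set \<Rightarrow> bool" where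
  "finite_measurable_partition M P \<longleftrightarrow>
     finite P \<and> P \<subseteq> sets M \<and> partition_on (space M) P"

text \<open>
  The join of the partitions \<open>T\<^sup>-\<^sup>i P\<close> for \<open>i < n\<close>. It may contain the empty set, which does not
  contribute to the entropy. The map \<open>T\<close> is only expected to map \<open>space M\<close> into itself up
  to a null set; points whose orbit leaves \<open>space M\<close> before time \<open>n\<close> lie in no cell.
\<close>

definition iterated_join :: "'a measure \<Rightarrow> ('a \<Rightarrow> 'a) \<Rightarrow> 'a set set \<Rightarrow> nat \<Rightarrow> 'a set set" where
  "iterated_join M T P n =
     (\<lambda>f. {x \<in> space M. \<forall>i<n. (T ^^ i) x \<in> f i}) ` ({..<n} \<rightarrow>\<^sub>E P)"

definition ks_entropy_partition :: "'a measure \<Rightarrow> ('a \<Rightarrow> 'a) \<Rightarrow> 'a set set \<Rightarrow> real" where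
  "ks_entropy_partition M T P =
     lim (\<lambda>n. partition_entropy M (iterated_join M T P n) / real n)"

definition ks_entropy :: "'a measure \<Rightarrow> ('a \<Rightarrow> 'a) \<Rightarrow> ereal" where
  "ks_entropy M T =
     (SUP P \<in> {P. finite_measurable_partition M P}. ereal (ks_entropy_partition M T P))"

section \<open>The \<open>\<alpha>\<close>-continued fraction maps with odd partial quotients\<close>

definition gold_g :: real where
  "gold_g = (sqrt 5 - 1) / 2"

definition gold_G :: real where
  "gold_G = (sqrt 5 + 1) / 2"

definition ocf_I :: "real \<Rightarrow> real set" where
  "ocf_I \<alpha> = {\<alpha> - 2 ..< \<alpha>}"

definition ocf_d :: "real \<Rightarrow> real \<Rightarrow> int" where
  "ocf_d \<alpha> x = 2 * \<lfloor>1 / (2 * \<bar>x\<bar>) + (1 - \<alpha>) / 2\<rfloor> + 1"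

definition ocf_phi :: "real \<Rightarrow> real \<Rightarrow> real" where
  "ocf_phi \<alpha> x = (if x = 0 then 0 else 1 / \<bar>x\<bar> - of_int (ocf_d \<alpha> x))"

text \<open>
  On the null set \<open>x = 0\<close>, where the map below is not specified by its formula, it is given the
  value \<open>(0, 0)\<close>, in accordance with \<open>d\<^sub>\<alpha>(0) = \<infinity>\<close>.
\<close>

definition ocf_Phi :: "real \<Rightarrow> real \<times> real \<Rightarrow> real \<times> real" where
  "ocf_Phi \<alpha> = (\<lambda>(x, y).
     if x = 0 then (0, 0)
     else (ocf_phi \<alpha> x, 1 / (of_int (ocf_d \<alpha> x) + sgn x * y)))"

definition ocf_Omega :: "real \<Rightarrow> (real \<times> real) set" where
  "ocf_Omega \<alpha> =
     (if \<alpha> = gold_g then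
        {gold_g - 2 ..< gold_g} \<times> {0 ..< 1 - gold_g} \<union>
        {(gold_g - 1) / (2 - gold_g) ..< gold_g} \<times> {1 ..< gold_G}
      else if \<alpha> = gold_G then
        {gold_G - 2 ..< gold_G} \<times> {0 ..< 1}
      else
        ocf_I \<alpha> \<times> {0 ..< 2 - gold_G} \<union>
        {ocf_phi \<alpha> \<alpha> <..< \<alpha>} \<times> {2 - gold_G <.. 1} \<union>
        {ocf_phi \<alpha> (\<alpha> - 2) ..< \<alpha>} \<times> {1 ..< gold_G})"

definition ocf_mu :: "real \<Rightarrow> (real \<times> real) measure" where
  "ocf_mu \<alpha> = density (restrict_space lborel (ocf_Omega \<alpha>)) (\<lambda>(x, y). ennreal (1 / (1 + x * y)\<^sup>2))"

definition ocf_mu_normalized :: "real \<Rightarrow> (real \<times> real) measure" where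
  "ocf_mu_normalized \<alpha> = scale_measure (ennreal (1 / (3 * ln gold_G))) (ocf_mu \<alpha>)"

definition ocf_nu :: "real \<Rightarrow> real measure" where
  "ocf_nu \<alpha> = distr (ocf_mu_normalized \<alpha>) (restrict_space borel (ocf_I \<alpha>)) fst"

end

theory Submission
  imports Defs "HOL-Real_Asymp.Real_Asymp"
begin

text \<open>
  The only tool from entropy theory is Gibbs' inequality: a family \<open>q\<close> of weights with total mass at
  most 1 on the values of a label satisfies \<open>\<integral> ln q \<le> \<integral> ln p\<close> for the cell probabilities \<open>p\<close>.

  Since \<open>\<Phi>\<close> is injective on the domain, the push-forward of the measure is at most the measure; both
  have the same finite total mass, so they agree. Two points of the same cylinder of rank \<open>n\<close> satisfy
  \<open>\<bar>x - x'\<bar> \<asymp> (x\<^sub>0 \<cdots> x\<^sub>n\<^sub>-\<^sub>1)\<^sup>2 \<bar>\<phi>\<^sup>n x - \<phi>\<^sup>n x'\<bar>\<close>, where \<open>x\<^sub>i = \<bar>\<phi>\<^sup>i x\<bar>\<close>, because the bounded second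
  coordinates of \<open>\<Phi>\<close> control the Jacobian. The images of the cylinders of rank \<open>n\<close> are intervals with
  end points in a set of at most \<open>4 n + 2\<close> points, so that weights proportional to \<open>(x\<^sub>0 \<cdots> x\<^sub>n\<^sub>-\<^sub>1)\<^sup>2\<close> are
  within a polynomial factor of having total mass 1. Hence the entropy of the first \<open>n\<close> digits is
  \<open>- 2 n \<integral> ln \<bar>x\<bar> d\<nu>\<^sub>\<alpha> + O(ln n)\<close>. An arbitrary finite partition of the plane is approximated by digits of
  a forward image, by inner regularity, and the infinitely many digits are replaced by finitely many at
  a small cost, since \<open>ln \<bar>x\<bar>\<close> is integrable.

  Finally \<open>\<integral> ln \<bar>x\<bar> d\<nu>\<^sub>\<alpha>\<close> does not depend on \<open>\<alpha>\<close>: its derivative consists of boundary terms that cancel.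
  At \<open>\<alpha> = G\<close> it is evaluated by a dilogarithm identity.
\<close>

section \<open>Entropy of countable labels\<close>

text \<open>Two features of the setting shape the proof. Entropy is a supremum over finite
  partitions, while the digits take infinitely many values; so every estimate concerns a finite
  label, compared with words of digits through a dominating function or a code. And the digits
  determine only the first coordinate, while the second one records the past. Of 2 m digits, the
  first m control the second coordinate at time m and the last m control the first coordinate at
  that time; hence the passage to a forward image, which by invariance leaves entropies unchanged.

  The upper bound is proved once, on the plane, and reaches the interval because a label of the
  interval is a label of the plane through \<open>fst\<close>. The lower bound is proved once, on
  the interval, and reaches the plane in the same way.

  The value is 2 times pi^2 / 6, the integral of - ln |x| for the unnormalized measure, divided by
  the mass 3 ln G. The factor 2 is there because |x|^2 is the reciprocal of the absolute derivative
  of \<open>\<phi>\<close>.\<close>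

lemma nn_integral_countable_label:
  fixes W :: "'a \<Rightarrow> 'c::countable" and f :: "'c \<Rightarrow> ennreal"
  assumes W[measurable]: "W \<in> M \<rightarrow>\<^sub>M count_space UNIV"
  shows "(\<integral>\<^sup>+x. f (W x) \<partial>M) = (\<integral>\<^sup>+c. f c * emeasure M (W -` {c} \<inter> space M) \<partial>count_space UNIV)"
proof -
  have "distr M (count_space UNIV) W = density (count_space UNIV) (\<lambda>c. emeasure M (W -` {c} \<inter> space M))"
    by (rule measure_eqI_countable[of _ UNIV])
       (auto simp: emeasure_distr emeasure_density nn_integral_count_space_indicator[symmetric]
             nn_integral_count_space_finite)
  then have "(\<integral>\<^sup>+x. f (W x) \<partial>M) = (\<integral>\<^sup>+c. f c \<partial>density (count_space UNIV) (\<lambda>c. emeasure M (W -` {c} \<inter> space M)))"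
    using nn_integral_distr[OF W, of f] by simp
  also have "\<dots> = (\<integral>\<^sup>+c. f c * emeasure M (W -` {c} \<inter> space M) \<partial>count_space UNIV)"
    by (subst nn_integral_density) (auto simp: mult.commute)
  finally show ?thesis .
qed

text \<open>The information function in exponential form: entropy becomes an expectation, and
  comparing two labels becomes an almost everywhere inequality.\<close>

definition (in prob_space) cell_prob :: "('a \<Rightarrow> 'c) \<Rightarrow> 'a \<Rightarrow> real" where
  "cell_prob W x = prob {y \<in> space M. W y = W x}"

context prob_space
begin

lemma cell_prob_measurable[measurable]:
  fixes W :: "'a \<Rightarrow> 'c::countable"
  assumes [measurable]: "W \<in> M \<rightarrow>\<^sub>M count_space UNIV"
  shows "cell_prob W \<in> borel_measurable M"
proof -
  have "cell_prob W = (\<lambda>x. (\<lambda>c. prob {y \<in> space M. W y = c}) (W x))"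
    by (auto simp: cell_prob_def)
  also have "\<dots> \<in> borel_measurable M"
    by measurable
  finally show ?thesis .
qed

lemma cell_prob_le_1: "cell_prob W x \<le> 1"
  by (simp add: cell_prob_def)

lemma cell_prob_nonneg: "0 \<le> cell_prob W x"
  by (simp add: cell_prob_def)

lemma AE_cell_prob_pos:
  fixes W :: "'a \<Rightarrow> 'c::countable"
  assumes [measurable]: "W \<in> M \<rightarrow>\<^sub>M count_space UNIV"
  shows "AE x in M. 0 < cell_prob W x"
proof -
  have "AE x in M. \<forall>c. prob {y \<in> space M. W y = c} = 0 \<longrightarrow> W x \<noteq> c"
    unfolding AE_all_countable
  proof
    fix c
    show "AE x in M. prob {y \<in> space M. W y = c} = 0 \<longrightarrow> W x \<noteq> c"
    proof (cases "prob {y \<in> space M. W y = c} = 0")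
      case True
      then have "AE x in M. x \<notin> {y \<in> space M. W y = c}"
        by (subst prob_eq_0[symmetric]) auto
      then show ?thesis by auto
    qed auto
  qed
  then show ?thesis
    by eventually_elim (use cell_prob_nonneg[of W] in \<open>auto simp: cell_prob_def less_le\<close>)
qed

text \<open>A cell of probability p contributes p (q / p), which is q if p > 0 and 0 if p = 0;
  adding up gives at most the total weight.\<close>

lemma expectation_ratio_le_1:
  fixes W :: "'a \<Rightarrow> 'c::countable" and q :: "'c \<Rightarrow> real"
  assumes W[measurable]: "W \<in> M \<rightarrow>\<^sub>M count_space UNIV"
    and "\<And>c. 0 \<le> q c" and q1: "(\<integral>\<^sup>+c. q c \<partial>count_space UNIV) \<le> 1"
  shows "(\<integral>\<^sup>+x. ennreal (q (W x) / cell_prob W x) \<partial>M) \<le> 1"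
proof -
  let ?p = "\<lambda>c. prob {y \<in> space M. W y = c}"
  have "(\<integral>\<^sup>+x. ennreal (q (W x) / cell_prob W x) \<partial>M) = (\<integral>\<^sup>+x. ennreal (q (W x) / ?p (W x)) \<partial>M)"
    by (simp add: cell_prob_def)
  also have "\<dots> = (\<integral>\<^sup>+c. ennreal (q c / ?p c) * emeasure M (W -` {c} \<inter> space M) \<partial>count_space UNIV)"
    by (rule nn_integral_countable_label[OF W])
  also have "\<dots> \<le> (\<integral>\<^sup>+c. q c \<partial>count_space UNIV)"
  proof (rule nn_integral_mono)
    fix c
    have "W -` {c} \<inter> space M = {y \<in> space M. W y = c}" by auto
    then have "ennreal (q c / ?p c) * emeasure M (W -` {c} \<inter> space M) = ennreal (q c / ?p c * ?p c)"
      using assms(2) by (simp only: emeasure_eq_measure ennreal_mult[OF divide_nonneg_nonneg measure_nonneg] measure_nonneg)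
    also have "\<dots> \<le> q c"
      by (rule ennreal_leI) (use assms(2) in auto)
    finally show "ennreal (q c / ?p c) * emeasure M (W -` {c} \<inter> space M) \<le> q c" .
  qed
  finally show ?thesis using q1 by simp
qed

text \<open>Integrate ln t <= t - 1 for t = q / s and use q / s <= q / p. A dominating
  \<open>s\<close> in place of the cell probability itself admits geometric upper bounds, and also
  the cell probability of any coarser label.\<close>

lemma gibbs:
  fixes W :: "'a \<Rightarrow> 'c::countable" and q :: "'c \<Rightarrow> real"
  assumes W[measurable]: "W \<in> M \<rightarrow>\<^sub>M count_space UNIV"
    and q0: "\<And>c. 0 \<le> q c" and q1: "(\<integral>\<^sup>+c. q c \<partial>count_space UNIV) \<le> 1"
    and qpos: "AE x in M. 0 < q (W x)"
    and s: "AE x in M. cell_prob W x \<le> s x"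
    and iq: "integrable M (\<lambda>x. ln (q (W x)))" and ism: "integrable M (\<lambda>x. ln (s x))"
  shows "expectation (\<lambda>x. ln (q (W x))) \<le> expectation (\<lambda>x. ln (s x))"
proof -
  define r where "r = (\<lambda>x. q (W x) / cell_prob W x)"
  have [measurable]: "(\<lambda>x. q (W x)) \<in> borel_measurable M"
    by measurable
  have rm[measurable]: "r \<in> borel_measurable M"
    unfolding r_def by measurable
  have r0: "0 \<le> r x" for x
    using q0 by (auto simp: r_def cell_prob_nonneg)
  have le: "(\<integral>\<^sup>+x. ennreal (r x) \<partial>M) \<le> 1"
    using expectation_ratio_le_1[OF W q0 q1] by (simp add: r_def)
  have ir: "integrable M r"
    by (rule integrableI_nonneg) (use r0 le in \<open>auto simp: less_top[symmetric] top_unique\<close>)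
  have Er: "expectation r \<le> 1"
    using le r0 ir by (simp add: nn_integral_eq_integral)
  have "expectation (\<lambda>x. ln (q (W x)) - ln (s x)) \<le> expectation (\<lambda>x. r x - 1)"
  proof (rule integral_mono_AE)
    show "AE x in M. ln (q (W x)) - ln (s x) \<le> r x - 1"
      using qpos s AE_cell_prob_pos[OF W]
    proof eventually_elim
      case (elim x)
      then have "ln (q (W x)) - ln (s x) = ln (q (W x) / s x)"
        by (simp add: ln_div)
      also have "\<dots> \<le> q (W x) / s x - 1"
        by (rule ln_le_minus_one) (use elim in auto)
      also have "q (W x) / s x \<le> r x"
        unfolding r_def by (rule divide_left_mono) (use elim in auto)
      finally show ?case by simp
    qed
  qed (use iq ism ir in auto)
  also have "\<dots> \<le> 0"
    using Er ir by (simp add: prob_space)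
  finally show ?thesis using iq ism by simp
qed

text \<open>A Bochner integral, hence 0 when the information function is not integrable;
  subadditivity and the later estimates are therefore proved for labels of finite range.\<close>

definition label_entropy :: "('a \<Rightarrow> 'c) \<Rightarrow> real" where
  "label_entropy W = expectation (\<lambda>x. - ln (cell_prob W x))"

lemma integrable_finite_label:
  fixes W :: "'a \<Rightarrow> 'c::countable" and f :: "'c \<Rightarrow> real"
  assumes [measurable]: "W \<in> M \<rightarrow>\<^sub>M count_space UNIV" and fin: "finite (W ` space M)"
  shows "integrable M (\<lambda>x. f (W x))"
proof (rule integrable_const_bound)
  show "AE x in M. norm (f (W x)) \<le> Max ((\<lambda>c. \<bar>f c\<bar>) ` W ` space M)"
    using fin by (intro AE_I2) auto
qed auto

lemma expectation_finite_label:
  fixes W :: "'a \<Rightarrow> 'c::countable" and f :: "'c \<Rightarrow> real"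
  assumes [measurable]: "W \<in> M \<rightarrow>\<^sub>M count_space UNIV" and fin: "finite (W ` space M)"
  shows "expectation (\<lambda>x. f (W x)) = (\<Sum>c\<in>W ` space M. prob {x \<in> space M. W x = c} * f c)"
proof -
  have "expectation (\<lambda>x. f (W x)) = expectation (\<lambda>x. \<Sum>c\<in>W ` space M. indicator {x \<in> space M. W x = c} x * f c)"
  proof (rule Bochner_Integration.integral_cong)
    fix x assume "x \<in> space M"
    then have "(\<Sum>c\<in>W ` space M. indicator {x \<in> space M. W x = c} x * f c) = (\<Sum>c\<in>W ` space M. if W x = c then f c else 0)"
      by (intro sum.cong) (auto simp: indicator_def)
    also have "\<dots> = f (W x)"
      using \<open>x \<in> space M\<close> fin by (simp add: sum.delta')
    finally show "f (W x) = (\<Sum>c\<in>W ` space M. indicator {x \<in> space M. W x = c} x * f c)" by simp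
  qed simp
  also have "\<dots> = (\<Sum>c\<in>W ` space M. prob {x \<in> space M. W x = c} * f c)"
    by (subst Bochner_Integration.integral_sum) (auto intro!: integrable_mult_left simp: emeasure_eq_measure)
  finally show ?thesis .
qed

lemma integrable_ln_cell_prob:
  fixes W :: "'a \<Rightarrow> 'c::countable"
  assumes "W \<in> M \<rightarrow>\<^sub>M count_space UNIV" and "finite (W ` space M)"
  shows "integrable M (\<lambda>x. ln (cell_prob W x))"
  using integrable_finite_label[OF assms, of "\<lambda>c. ln (prob {y \<in> space M. W y = c})"]
  by (simp add: cell_prob_def)

lemma label_entropy_eq_sum:
  fixes W :: "'a \<Rightarrow> 'c::countable"
  assumes "W \<in> M \<rightarrow>\<^sub>M count_space UNIV" and "finite (W ` space M)"
  shows "label_entropy W = - (\<Sum>c\<in>W ` space M. prob {x \<in> space M. W x = c} * ln (prob {x \<in> space M. W x = c}))"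
  using expectation_finite_label[OF assms, of "\<lambda>c. ln (prob {y \<in> space M. W y = c})"]
  by (simp add: label_entropy_def cell_prob_def)

lemma label_entropy_nonneg: "0 \<le> label_entropy W"
  unfolding label_entropy_def
proof (rule Bochner_Integration.integral_nonneg)
  fix x show "0 \<le> - ln (cell_prob W x)"
    using cell_prob_le_1[of W x] cell_prob_nonneg[of W x] by (cases "cell_prob W x = 0") auto
qed

lemma sum_cell_prob:
  fixes W :: "'a \<Rightarrow> 'c::countable"
  assumes W[measurable]: "W \<in> M \<rightarrow>\<^sub>M count_space UNIV"
  shows "(\<integral>\<^sup>+c. prob {y \<in> space M. W y = c} \<partial>count_space UNIV) = 1"
proof -
  have "W -` {c} \<inter> space M = {y \<in> space M. W y = c}" for c by auto
  then show ?thesis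
    using nn_integral_countable_label[OF W, of "\<lambda>_. 1"]
    by (simp add: emeasure_eq_measure prob_space)
qed

text \<open>Entropy sees only the partition into fibres, so letters may be renamed and words
  regrouped.\<close>

lemma label_entropy_cong:
  assumes "\<And>x y. x \<in> space M \<Longrightarrow> y \<in> space M \<Longrightarrow> U x = U y \<longleftrightarrow> V x = V y"
  shows "label_entropy U = label_entropy V"
  unfolding label_entropy_def
proof (rule Bochner_Integration.integral_cong)
  fix x assume "x \<in> space M"
  then have "{y \<in> space M. U y = U x} = {y \<in> space M. V y = V x}"
    using assms by auto
  then show "- ln (cell_prob U x) = - ln (cell_prob V x)"
    by (simp add: cell_prob_def)
qed simp

text \<open>Subadditivity is Gibbs' inequality for the pair, with the product of the two marginal
  distributions as weights.\<close>

lemma label_entropy_pair_le: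
  fixes U :: "'a \<Rightarrow> 'c::countable" and V :: "'a \<Rightarrow> 'd::countable"
  assumes U[measurable]: "U \<in> M \<rightarrow>\<^sub>M count_space UNIV" and V[measurable]: "V \<in> M \<rightarrow>\<^sub>M count_space UNIV"
    and fin: "finite (U ` space M)" "finite (V ` space M)"
  shows "label_entropy (\<lambda>x. (U x, V x)) \<le> label_entropy U + label_entropy V"
proof -
  let ?p = "\<lambda>c. prob {y \<in> space M. U y = c}" and ?r = "\<lambda>c. prob {y \<in> space M. V y = c}"
  have m[measurable]: "(\<lambda>x. (U x, V x)) \<in> M \<rightarrow>\<^sub>M count_space UNIV"
    by (rule measurable_compose_countable[of "\<lambda>a x. (a, V x)"]) measurable
  have fin2: "finite ((\<lambda>x. (U x, V x)) ` space M)"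
    by (rule finite_subset[of _ "U ` space M \<times> V ` space M"]) (use fin in auto)
  have ln_eq: "AE x in M. ln (?p (U x) * ?r (V x)) = ln (cell_prob U x) + ln (cell_prob V x)"
    using AE_cell_prob_pos[OF U] AE_cell_prob_pos[OF V]
    by eventually_elim (simp add: cell_prob_def ln_mult)
  have int: "integrable M (\<lambda>x. ln (cell_prob U x) + ln (cell_prob V x))"
    using integrable_ln_cell_prob[OF U fin(1)] integrable_ln_cell_prob[OF V fin(2)] by simp
  have "expectation (\<lambda>x. ln ((\<lambda>(a, b). ?p a * ?r b) (U x, V x))) \<le> expectation (\<lambda>x. ln (cell_prob (\<lambda>x. (U x, V x)) x))"
  proof (rule gibbs[OF m])
    have "(\<integral>\<^sup>+c. ennreal ((\<lambda>(a, b). ?p a * ?r b) c) \<partial>count_space UNIV)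
        = (\<integral>\<^sup>+a. \<integral>\<^sup>+b. ennreal (?p a) * ennreal (?r b) \<partial>count_space UNIV \<partial>count_space UNIV)"
      by (subst nn_integral_fst_count_space[symmetric]) (simp add: ennreal_mult)
    also have "\<dots> \<le> 1"
      by (simp add: nn_integral_cmult sum_cell_prob[OF U] sum_cell_prob[OF V])
    finally show "(\<integral>\<^sup>+c. ennreal ((\<lambda>(a, b). ?p a * ?r b) c) \<partial>count_space UNIV) \<le> 1" .
    show "AE x in M. 0 < (\<lambda>(a, b). ?p a * ?r b) (U x, V x)"
      using AE_cell_prob_pos[OF U] AE_cell_prob_pos[OF V]
      by eventually_elim (simp add: cell_prob_def)
    show "integrable M (\<lambda>x. ln ((\<lambda>(a, b). ?p a * ?r b) (U x, V x)))"
      by (rule integrable_finite_label[OF m fin2])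
    show "integrable M (\<lambda>x. ln (cell_prob (\<lambda>x. (U x, V x)) x))"
      by (rule integrable_ln_cell_prob[OF m fin2])
  qed auto
  also have "expectation (\<lambda>x. ln ((\<lambda>(a, b). ?p a * ?r b) (U x, V x)))
      = expectation (\<lambda>x. ln (cell_prob U x) + ln (cell_prob V x))"
    by (rule integral_cong_AE) (use ln_eq int in auto)
  also have "\<dots> = expectation (\<lambda>x. ln (cell_prob U x)) + expectation (\<lambda>x. ln (cell_prob V x))"
    using integrable_ln_cell_prob[OF U fin(1)] integrable_ln_cell_prob[OF V fin(2)] by simp
  finally show ?thesis
    by (simp add: label_entropy_def)
qed

end

section \<open>Itineraries and their entropy rates\<close>

primrec word :: "('a \<Rightarrow> 'a) \<Rightarrow> ('a \<Rightarrow> 'c) \<Rightarrow> nat \<Rightarrow> 'a \<Rightarrow> 'c list" where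
  "word T X 0 x = []"
| "word T X (Suc n) x = X x # word T X n (T x)"

lemma length_word[simp]: "length (word T X n x) = n"
  by (induction n arbitrary: x) auto

lemma word_add: "word T X (m + n) x = word T X m x @ word T X n ((T ^^ m) x)"
  by (induction m arbitrary: x) (auto simp: funpow_swap1)

lemma nth_word: "i < n \<Longrightarrow> word T X n x ! i = X ((T ^^ i) x)"
  by (induction n arbitrary: x i) (auto simp: nth_Cons funpow_swap1 split: nat.split)

lemma word_eq_iff: "word T X n x = word T X n y \<longleftrightarrow> (\<forall>i<n. X ((T ^^ i) x) = X ((T ^^ i) y))"
  by (auto simp: list_eq_iff_nth_eq nth_word)

lemma map_word: "map f (word T X n x) = word T (\<lambda>x. f (X x)) n x"
  by (induction n arbitrary: x) auto

text \<open>Words of one length form a subset of the countable type of all lists; the indicator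
  keeps every sum on that type.\<close>

lemma nn_sum_lists_Suc:
  fixes F :: "'c::countable list \<Rightarrow> ennreal"
  shows "(\<integral>\<^sup>+w. F w * indicator {w. length w = Suc n} w \<partial>count_space UNIV)
    = (\<integral>\<^sup>+c. \<integral>\<^sup>+w. F (c # w) * indicator {w. length w = n} w \<partial>count_space UNIV \<partial>count_space UNIV)"
proof -
  let ?A = "{w :: 'c list. w \<noteq> []}"
  have "bij_betw (\<lambda>(c, w). c # w) UNIV ?A"
    by (rule bij_betw_byWitness[where f' = "\<lambda>w. (hd w, tl w)"]) auto
  then have "(\<integral>\<^sup>+x. (\<lambda>w. F w * indicator {w. length w = Suc n} w) ((\<lambda>(c, w). c # w) x) \<partial>count_space UNIV)
      = (\<integral>\<^sup>+w. F w * indicator {w. length w = Suc n} w \<partial>count_space ?A)"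
    by (rule nn_integral_bij_count_space)
  also have "\<dots> = (\<integral>\<^sup>+w. F w * indicator {w. length w = Suc n} w \<partial>count_space UNIV)"
    by (subst nn_integral_count_space_indicator) (auto intro!: nn_integral_cong simp: indicator_def)
  finally show ?thesis
    using nn_integral_fst_count_space[of "\<lambda>(c, w). F (c # w) * indicator {w. length w = n} w"]
    by (simp add: case_prod_unfold indicator_def)
qed

text \<open>Once the coarse word is fixed, its letters are refined independently, each with total
  weight at most 1; the weights of all refinements of a word v thus add up to at most
  \<open>P v\<close>.\<close>

lemma nn_sum_words_le:
  fixes P :: "'b::countable list \<Rightarrow> ennreal" and \<kappa> :: "'c::countable \<Rightarrow> ennreal"
  assumes \<kappa>: "\<And>b. (\<integral>\<^sup>+c. \<kappa> c * indicator {c. \<beta> c = b} c \<partial>count_space UNIV) \<le> 1"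
  shows "(\<integral>\<^sup>+w. P (map \<beta> w) * prod_list (map \<kappa> w) * indicator {w. length w = n} w \<partial>count_space UNIV)
    \<le> (\<integral>\<^sup>+v. P v * indicator {v. length v = n} v \<partial>count_space UNIV)"
\<comment> \<open>\<open>P\<close> varies because the first coarse letter is absorbed into
  it.\<close>
proof (induction n arbitrary: P)
  case 0
  have "{w. length w = 0} = {[] :: 'd list}" for w :: "'d list"
    by auto
  then show ?case by (simp add: nn_integral_count_space_finite)
next
  case (Suc n)
  let ?S = "\<lambda>b. \<integral>\<^sup>+v. P (b # v) * indicator {v. length v = n} v \<partial>count_space UNIV"
  have "(\<integral>\<^sup>+w. P (map \<beta> w) * prod_list (map \<kappa> w) * indicator {w. length w = Suc n} w \<partial>count_space UNIV)
     = (\<integral>\<^sup>+c. \<integral>\<^sup>+w. \<kappa> c * (P (\<beta> c # map \<beta> w) * prod_list (map \<kappa> w) * indicator {w. length w = n} w) \<partial>count_space UNIV \<partial>count_space UNIV)"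
    by (subst nn_sum_lists_Suc) (simp add: mult_ac)
  also have "\<dots> = (\<integral>\<^sup>+c. \<kappa> c * (\<integral>\<^sup>+w. (P (\<beta> c # map \<beta> w) * prod_list (map \<kappa> w) * indicator {w. length w = n} w) \<partial>count_space UNIV) \<partial>count_space UNIV)"
    by (simp add: nn_integral_cmult)
  also have "\<dots> \<le> (\<integral>\<^sup>+c. \<kappa> c * ?S (\<beta> c) \<partial>count_space UNIV)"
    by (intro nn_integral_mono mult_left_mono Suc.IH[of "\<lambda>v. P (\<beta> c # v)" for c]) auto
  also have "\<dots> = (\<integral>\<^sup>+c. \<integral>\<^sup>+b. \<kappa> c * indicator {c. \<beta> c = b} c * ?S b \<partial>count_space UNIV \<partial>count_space UNIV)"
  proof (rule nn_integral_cong)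
    fix c
    have "(\<integral>\<^sup>+b. \<kappa> c * indicator {c. \<beta> c = b} c * ?S b \<partial>count_space UNIV)
        = (\<integral>\<^sup>+b. \<kappa> c * ?S b * indicator {\<beta> c} b \<partial>count_space UNIV)"
      by (rule nn_integral_cong) (auto simp: indicator_def)
    then show "\<kappa> c * ?S (\<beta> c) = (\<integral>\<^sup>+b. \<kappa> c * indicator {c. \<beta> c = b} c * ?S b \<partial>count_space UNIV)"
      by (simp add: nn_integral_indicator_singleton)
  qed
  also have "\<dots> = (\<integral>\<^sup>+b. \<integral>\<^sup>+c. \<kappa> c * indicator {c. \<beta> c = b} c * ?S b \<partial>count_space UNIV \<partial>count_space UNIV)"
    using nn_integral_fst_count_space[of "\<lambda>(c, b). \<kappa> c * indicator {c. \<beta> c = b} c * ?S b"]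
      nn_integral_snd_count_space[of "\<lambda>(c, b). \<kappa> c * indicator {c. \<beta> c = b} c * ?S b"] by simp
  also have "\<dots> = (\<integral>\<^sup>+b. (\<integral>\<^sup>+c. \<kappa> c * indicator {c. \<beta> c = b} c \<partial>count_space UNIV) * ?S b \<partial>count_space UNIV)"
    by (simp add: nn_integral_multc)
  also have "\<dots> \<le> (\<integral>\<^sup>+b. 1 * ?S b \<partial>count_space UNIV)"
    by (intro nn_integral_mono mult_right_mono \<kappa>) auto
  also have "\<dots> = (\<integral>\<^sup>+v. P v * indicator {v. length v = Suc n} v \<partial>count_space UNIV)"
    by (subst nn_sum_lists_Suc) simp
  finally show ?case .
qed

text \<open>Convergence matters because \<open>ks_entropy_partition\<close> is a \<open>lim\<close>,
  which carries no information for a divergent sequence. The limit is the infimum: divide with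
  remainder by an m that nearly attains it.\<close>

lemma fekete:
  fixes u :: "nat \<Rightarrow> real"
  assumes sub: "\<And>m n. u (m + n) \<le> u m + u n" and nonneg: "\<And>n. 0 \<le> u n"
  shows "convergent (\<lambda>n. u n / real n)"
proof -
  define L where "L = (INF n\<in>{1..}. u n / real n)"
  have bdd: "bdd_below ((\<lambda>n. u n / real n) ` {1..})"
    by (rule bdd_belowI[of _ 0]) (use nonneg in auto)
  have "(\<lambda>n. u n / real n) \<longlonglongrightarrow> L"
  proof (rule LIMSEQ_I)
    fix e :: real assume "e > 0"
    then have "\<exists>m\<in>{1..}. u m / real m < L + e / 2"
      unfolding L_def by (subst cINF_less_iff[symmetric, OF _ bdd]) auto
    then obtain m where m: "m \<ge> 1" "u m / real m < L + e / 2" by auto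
    define C where "C = Max (u ` {..<m})"
    have C: "u r \<le> C" if "r < m" for r
      unfolding C_def using that by auto
    have mult: "u (k * m + r) \<le> real k * u m + u r" for k r
    proof (induction k)
      case (Suc k)
      have "u (Suc k * m + r) = u (m + (k * m + r))" by (simp add: algebra_simps)
      also have "\<dots> \<le> u m + (real k * u m + u r)" using sub[of m "k * m + r"] Suc by linarith
      finally show ?case by (simp add: algebra_simps)
    qed simp
    have upper: "u n / real n \<le> u m / real m + C / real n" if "n \<ge> 1" for n
    proof -
      have "u n \<le> real (n div m) * u m + C"
        using mult[of "n div m" "n mod m"] C[of "n mod m"] m by simp
      also have "real (n div m) \<le> real n / real m"
        by (rule of_nat_div_le_of_nat)
      then have "real (n div m) * u m \<le> real n / real m * u m"
        using nonneg by (intro mult_right_mono) auto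
      finally show ?thesis using that m by (simp add: field_simps)
    qed
    have "(\<lambda>n. C / real n) \<longlonglongrightarrow> 0"
      by (rule lim_const_over_n)
    from LIMSEQ_D[OF this, of "e / 2"] \<open>e > 0\<close> obtain N where N: "\<And>n. n \<ge> N \<Longrightarrow> norm (C / real n) < e / 2"
      by auto
    show "\<exists>N. \<forall>n\<ge>N. norm (u n / real n - L) < e"
    proof (intro exI allI impI)
      fix n assume n: "n \<ge> max N 1"
      have "L \<le> u n / real n"
        unfolding L_def by (rule cINF_lower[OF bdd]) (use n in auto)
      moreover have "u n / real n < L + e"
        using upper[of n] N[of n] n m(2) unfolding real_norm_def by linarith
      ultimately show "norm (u n / real n - L) < e" by auto
    qed
  qed
  then show ?thesis by (rule convergentI)
qed

text \<open>\<open>T\<close> maps the whole space into itself, so its iterates never have to be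
  restricted; the passage to a subset that carries the measure is left to
  \<open>conull_restriction\<close>.\<close>

locale measure_preserving_system = prob_space M for M :: "'a measure" +
  fixes T :: "'a \<Rightarrow> 'a"
  assumes T_measurable[measurable]: "T \<in> M \<rightarrow>\<^sub>M M"
    and T_invariant: "distr M M T = M"
begin

lemma funpow_measurable[measurable]: "T ^^ n \<in> M \<rightarrow>\<^sub>M M"
  by (rule measurable_compose_n) measurable

lemma T_space: "x \<in> space M \<Longrightarrow> T x \<in> space M"
  by (rule measurable_space[OF T_measurable])

lemma funpow_space: "x \<in> space M \<Longrightarrow> (T ^^ n) x \<in> space M"
  by (induction n) (auto simp: T_space)

lemma funpow_invariant: "distr M M (T ^^ n) = M"
proof (induction n)
  case (Suc n)
  have "distr M M (T ^^ Suc n) = distr (distr M M (T ^^ n)) M T"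
    by (subst distr_distr) (auto simp: comp_def)
  then show ?case by (simp only: Suc T_invariant)
qed (auto simp: distr_id)

lemma integral_funpow:
  fixes f :: "'a \<Rightarrow> real"
  assumes "f \<in> borel_measurable M"
  shows "expectation (\<lambda>x. f ((T ^^ n) x)) = expectation f"
  using integral_distr[OF funpow_measurable assms, of n] by (simp add: funpow_invariant)

lemma integrable_funpow:
  fixes f :: "'a \<Rightarrow> real"
  assumes "integrable M f"
  shows "integrable M (\<lambda>x. f ((T ^^ n) x))"
  using integrable_distr[OF funpow_measurable, of n f] assms by (simp add: funpow_invariant)

lemma AE_funpow:
  assumes "AE x in M. P x"
  shows "AE x in M. P ((T ^^ n) x)"
  using AE_distrD[OF funpow_measurable[of n], of P, unfolded funpow_invariant, OF assms] .

lemma AE_all_funpow: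
  assumes "AE x in M. P x"
  shows "AE x in M. \<forall>n. P ((T ^^ n) x)"
  unfolding AE_all_countable using AE_funpow[OF assms] by simp

lemma birkhoff_sum:
  fixes f :: "'a \<Rightarrow> real"
  assumes "integrable M f"
  shows "integrable M (\<lambda>x. \<Sum>i<n. f ((T ^^ i) x))"
    and "expectation (\<lambda>x. \<Sum>i<n. f ((T ^^ i) x)) = real n * expectation f"
  using integrable_funpow[OF assms] assms by (auto simp: integral_funpow)

lemma word_measurable[measurable]:
  fixes X :: "'a \<Rightarrow> 'c::countable"
  assumes [measurable]: "X \<in> M \<rightarrow>\<^sub>M count_space UNIV"
  shows "word T X n \<in> M \<rightarrow>\<^sub>M count_space UNIV"
proof (induction n)
  case (Suc n)
  have "(\<lambda>x. (\<lambda>c x. c # word T X n (T x)) (X x) x) \<in> M \<rightarrow>\<^sub>M count_space UNIV"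
  proof (rule measurable_compose_countable[where f = "\<lambda>c x. c # word T X n (T x)" and g = X])
    fix c
    have "(\<lambda>x. word T X n (T x)) \<in> M \<rightarrow>\<^sub>M count_space UNIV"
      using measurable_compose[OF T_measurable Suc] .
    then show "(\<lambda>x. c # word T X n (T x)) \<in> M \<rightarrow>\<^sub>M count_space UNIV"
      by (rule measurable_compose) simp
  qed measurable
  then show ?case by simp
qed simp

lemma finite_word:
  assumes "finite (X ` space M)"
  shows "finite (word T X n ` space M)"
proof (rule finite_subset)
  show "word T X n ` space M \<subseteq> {w. set w \<subseteq> X ` space M \<and> length w = n}"
    by (auto simp: in_set_conv_nth nth_word intro!: imageI funpow_space)
  show "finite {w. set w \<subseteq> X ` space M \<and> length w = n}"
    by (rule finite_lists_length_eq[OF assms])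
qed

lemma label_entropy_funpow:
  fixes W :: "'a \<Rightarrow> 'c::countable"
  assumes W[measurable]: "W \<in> M \<rightarrow>\<^sub>M count_space UNIV"
  shows "label_entropy (\<lambda>x. W ((T ^^ n) x)) = label_entropy W"
proof -
  have eq: "prob {y \<in> space M. W ((T ^^ n) y) = c} = prob {y \<in> space M. W y = c}" for c
  proof -
    have "prob {y \<in> space M. W y = c} = measure (distr M M (T ^^ n)) {y \<in> space M. W y = c}"
      by (simp add: funpow_invariant)
    also have "\<dots> = prob ((T ^^ n) -` {y \<in> space M. W y = c} \<inter> space M)"
      by (rule measure_distr) auto
    also have "(T ^^ n) -` {y \<in> space M. W y = c} \<inter> space M = {y \<in> space M. W ((T ^^ n) y) = c}"
      by (auto simp: funpow_space)
    finally show ?thesis by simp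
  qed
  have "label_entropy (\<lambda>x. W ((T ^^ n) x)) = expectation (\<lambda>x. - ln (cell_prob W ((T ^^ n) x)))"
    by (simp add: label_entropy_def cell_prob_def eq)
  also have "\<dots> = label_entropy W"
    unfolding label_entropy_def by (rule integral_funpow) measurable
  finally show ?thesis .
qed

lemma label_entropy_word_add:
  fixes X :: "'a \<Rightarrow> 'c::countable"
  assumes X[measurable]: "X \<in> M \<rightarrow>\<^sub>M count_space UNIV" and fin: "finite (X ` space M)"
  shows "label_entropy (word T X (m + n)) \<le> label_entropy (word T X m) + label_entropy (word T X n)"
proof -
  have "label_entropy (word T X (m + n)) = label_entropy (\<lambda>x. (word T X m x, word T X n ((T ^^ m) x)))"
    by (rule label_entropy_cong) (simp add: word_add)
  also have "\<dots> \<le> label_entropy (word T X m) + label_entropy (\<lambda>x. word T X n ((T ^^ m) x))"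
  proof (rule label_entropy_pair_le)
    show "(\<lambda>x. word T X n ((T ^^ m) x)) \<in> M \<rightarrow>\<^sub>M count_space UNIV"
      using measurable_compose[OF funpow_measurable word_measurable[OF X]] .
    show "finite ((\<lambda>x. word T X n ((T ^^ m) x)) ` space M)"
      by (rule finite_subset[OF _ finite_word[OF fin, of n]]) (auto intro: funpow_space)
  qed (use finite_word[OF fin] in auto)
  finally show ?thesis
    by (simp add: label_entropy_funpow)
qed

lemma word_entropy_rate_convergent:
  fixes X :: "'a \<Rightarrow> 'c::countable"
  assumes "X \<in> M \<rightarrow>\<^sub>M count_space UNIV" and "finite (X ` space M)"
  shows "convergent (\<lambda>n. label_entropy (word T X n) / real n)"
  by (rule fekete) (use label_entropy_word_add[OF assms] label_entropy_nonneg in auto)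

text \<open>
  The letters \<open>Z\<close> refine the letters \<open>\<beta> \<circ> Z\<close>, and \<open>\<kappa>\<close> is a code for guessing the former
  from the latter; \<open>s\<close> dominates the probabilities of the cells of the refined words.
\<close>

lemma label_entropy_word_code:
  fixes Z :: "'a \<Rightarrow> 'c::countable" and \<beta> :: "'c \<Rightarrow> 'b::countable" and \<kappa> :: "'c \<Rightarrow> real"
  assumes Z[measurable]: "Z \<in> M \<rightarrow>\<^sub>M count_space UNIV"
    and fin: "finite ((\<lambda>x. \<beta> (Z x)) ` space M)"
    and \<kappa>0: "\<And>c. 0 \<le> \<kappa> c"
    and \<kappa>1: "\<And>b. (\<integral>\<^sup>+c. ennreal (\<kappa> c) * indicator {c. \<beta> c = b} c \<partial>count_space UNIV) \<le> 1"
    and \<kappa>pos: "AE x in M. 0 < \<kappa> (Z x)"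
    and i\<kappa>: "integrable M (\<lambda>x. ln (\<kappa> (Z x)))"
    and s: "AE x in M. cell_prob (word T Z n) x \<le> s x"
    and ism: "integrable M (\<lambda>x. ln (s x))"
  shows "- expectation (\<lambda>x. ln (s x)) \<le>
    label_entropy (word T (\<lambda>x. \<beta> (Z x)) n) - real n * expectation (\<lambda>x. ln (\<kappa> (Z x)))"
proof -
  let ?B = "word T (\<lambda>x. \<beta> (Z x)) n"
  let ?p = "\<lambda>v. prob {y \<in> space M. ?B y = v}"
  have B[measurable]: "?B \<in> M \<rightarrow>\<^sub>M count_space UNIV"
    by measurable
  have finB: "finite (?B ` space M)"
    by (rule finite_word[OF fin])
  \<comment> \<open>A refined word is weighted by the probability of its coarse word times the
    guessing weights of its letters; fixing the length makes \<open>nn_sum_words_le\<close>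
    applicable.\<close>
  define q where "q = (\<lambda>w. if length w = n then ?p (map \<beta> w) * prod_list (map \<kappa> w) else 0)"
  have prod0: "0 \<le> prod_list (map \<kappa> w)" for w
    by (rule prod_list_nonneg) (use \<kappa>0 in auto)
  have prod_en: "ennreal (prod_list (map \<kappa> w)) = prod_list (map (\<lambda>c. ennreal (\<kappa> c)) w)" for w
    using \<kappa>0 prod0 by (induction w) (auto simp: ennreal_mult)
  have q0: "0 \<le> q w" for w
    using prod0 by (simp add: q_def)
  have "(\<integral>\<^sup>+w. ennreal (q w) \<partial>count_space UNIV) =
     (\<integral>\<^sup>+w. ennreal (?p (map \<beta> w)) * prod_list (map (\<lambda>c. ennreal (\<kappa> c)) w) * indicator {w. length w = n} w \<partial>count_space UNIV)"
    by (rule nn_integral_cong) (auto simp: q_def ennreal_mult prod0 prod_en[symmetric])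
  also have "\<dots> \<le> (\<integral>\<^sup>+v. ennreal (?p v) * indicator {v. length v = n} v \<partial>count_space UNIV)"
    by (rule nn_sum_words_le[OF \<kappa>1])
  also have "\<dots> \<le> (\<integral>\<^sup>+v. ennreal (?p v) \<partial>count_space UNIV)"
    by (rule nn_integral_mono) (auto simp: indicator_def)
  also have "\<dots> = 1"
    by (rule sum_cell_prob[OF B])
  finally have q1: "(\<integral>\<^sup>+w. ennreal (q w) \<partial>count_space UNIV) \<le> 1" .
  have prod_word: "prod_list (map \<kappa> (word T Z n x)) = (\<Prod>i<n. \<kappa> (Z ((T ^^ i) x)))" for x
    by (induction n arbitrary: x) (auto simp: prod.lessThan_Suc_shift funpow_swap1 simp del: prod.lessThan_Suc)
  have AE_eq: "AE x in M. 0 < q (word T Z n x) \<and>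
     ln (q (word T Z n x)) = ln (cell_prob ?B x) + (\<Sum>i<n. ln (\<kappa> (Z ((T ^^ i) x))))"
    using AE_cell_prob_pos[OF B] AE_all_funpow[OF \<kappa>pos]
  proof eventually_elim
    case (elim x)
    have pos: "0 < prod_list (map \<kappa> (word T Z n x))"
      unfolding prod_word using elim by (intro prod_pos) auto
    have q: "q (word T Z n x) = cell_prob ?B x * prod_list (map \<kappa> (word T Z n x))"
      by (simp add: q_def cell_prob_def map_word)
    have "ln (prod_list (map \<kappa> (word T Z n x))) = (\<Sum>i<n. ln (\<kappa> (Z ((T ^^ i) x))))"
      unfolding prod_word using elim by (intro ln_prod) (auto simp: less_le)
    then show ?case
      using pos elim by (simp add: q ln_mult)
  qed
  note bs = birkhoff_sum[OF i\<kappa>, of n]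
  have int: "integrable M (\<lambda>x. ln (cell_prob ?B x) + (\<Sum>i<n. ln (\<kappa> (Z ((T ^^ i) x)))))"
    using integrable_ln_cell_prob[OF B finB] bs(1) by simp
  have W: "word T Z n \<in> M \<rightarrow>\<^sub>M count_space UNIV"
    by measurable
  have "(\<lambda>x. q (word T Z n x)) \<in> borel_measurable M"
    using measurable_compose[OF W, of q borel] by simp
  then have mq[measurable]: "(\<lambda>x. ln (q (word T Z n x))) \<in> borel_measurable M"
    by measurable
  have "integrable M (\<lambda>x. ln (q (word T Z n x)))"
    by (rule iffD2[OF integrable_cong_AE int]) (use AE_eq int in auto)
  then have "expectation (\<lambda>x. ln (q (word T Z n x))) \<le> expectation (\<lambda>x. ln (s x))"
    using AE_eq by (intro gibbs[OF W q0 q1 _ s]) (auto simp: ism)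
  also have "expectation (\<lambda>x. ln (q (word T Z n x))) = expectation (\<lambda>x. ln (cell_prob ?B x) + (\<Sum>i<n. ln (\<kappa> (Z ((T ^^ i) x)))))"
    by (rule integral_cong_AE) (use AE_eq int in auto)
  also have "\<dots> = expectation (\<lambda>x. ln (cell_prob ?B x)) + real n * expectation (\<lambda>x. ln (\<kappa> (Z x)))"
    using integrable_ln_cell_prob[OF B finB] bs by simp
  finally show ?thesis
    by (simp add: label_entropy_def)
qed

end

section \<open>From labels to partitions of a set of full measure\<close>

text \<open>
  Here \<open>space N\<close> stands for \<open>\<Omega>\<^sub>\<alpha>\<close> or \<open>I\<^sub>\<alpha>\<close>. It need not be mapped into itself.
\<close>

locale conull_restriction = measure_preserving_system +
  fixes N :: "'a measure"
  assumes sets_N: "\<And>A. A \<in> sets N \<longleftrightarrow> A \<in> sets M \<and> A \<subseteq> space N"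
    and space_N[measurable]: "space N \<in> sets M"
    and measure_N: "\<And>A. A \<in> sets N \<Longrightarrow> measure N A = prob A"
    and AE_space_N: "AE x in M. x \<in> space N"
begin

definition label_partition :: "('a \<Rightarrow> nat) \<Rightarrow> 'a set set" where
  "label_partition F = (\<lambda>c. F -` {c} \<inter> space N) ` F ` space N"

text \<open>By \<open>sep\<close>, a letter taken on \<open>space N\<close> occurs only there. Hence
  a word of such letters forces the orbit to stay in \<open>space N\<close> up to time n - 1, and
  its cell is a cell of the join; all other words have probability 0.\<close>

lemma partition_entropy_iterated_join:
  fixes F :: "'a \<Rightarrow> nat"
  assumes F[measurable]: "F \<in> M \<rightarrow>\<^sub>M count_space UNIV" and fin: "finite (F ` space M)"
    and sep: "\<And>x y. x \<in> space M - space N \<Longrightarrow> y \<in> space N \<Longrightarrow> F x \<noteq> F y"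
    and n: "0 < n"
  shows "partition_entropy N (iterated_join N T (label_partition F) n) = label_entropy (word T F n)"
proof -
  let ?\<eta> = "\<lambda>p :: real. p * ln p"
  define W0 where "W0 = {w. set w \<subseteq> F ` space N \<and> length w = n}"
  define cell where "cell = (\<lambda>w. {x \<in> space M. word T F n x = w})"
  have sub: "space N \<subseteq> space M"
    using space_N by (rule sets.sets_into_space)
  have finN: "finite (F ` space N)"
    by (rule finite_subset[OF image_mono[OF sub] fin])
  have finW0: "finite W0"
    unfolding W0_def by (rule finite_lists_length_eq[OF finN])
  have W[measurable]: "word T F n \<in> M \<rightarrow>\<^sub>M count_space UNIV"
    by measurable
  have in_N: "(T ^^ i) x \<in> space N" if "x \<in> cell w" "w \<in> W0" "i < n" for x w i
  proof (rule ccontr)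
    assume neg: "(T ^^ i) x \<notin> space N"
    have "F ((T ^^ i) x) = w ! i"
      using that by (auto simp: cell_def nth_word)
    moreover have "w ! i \<in> F ` space N"
      using that by (auto simp: W0_def)
    ultimately show False
      using sep[of "(T ^^ i) x"] neg funpow_space[of x i] that(1) by (auto simp: cell_def)
  qed
  have cell_N: "cell w \<subseteq> space N" if "w \<in> W0" for w
    using in_N[of _ w 0] that n by auto
  have cell_M: "cell w \<in> sets M" for w
    unfolding cell_def by measurable
  have cell_sets: "cell w \<in> sets N" if "w \<in> W0" for w
    using cell_N[OF that] cell_M by (simp add: sets_N)
  have join: "iterated_join N T (label_partition F) n = cell ` W0"
  proof (intro equalityI subsetI)
    fix C assume "C \<in> iterated_join N T (label_partition F) n"
    then obtain f where f: "f \<in> {..<n} \<rightarrow>\<^sub>E label_partition F"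
      and C: "C = {x \<in> space N. \<forall>i<n. (T ^^ i) x \<in> f i}"
      unfolding iterated_join_def by auto
    have "\<forall>i\<in>{..<n}. \<exists>c. c \<in> F ` space N \<and> f i = F -` {c} \<inter> space N"
      using f by (force simp: label_partition_def PiE_def Pi_def)
    from bchoice[OF this] obtain c where c: "\<And>i. i < n \<Longrightarrow> c i \<in> F ` space N \<and> f i = F -` {c i} \<inter> space N"
      by (metis lessThan_iff)
    define w where "w = map c [0..<n]"
    have w: "w \<in> W0"
      using c by (auto simp: W0_def w_def)
    have "C = cell w"
    proof (intro equalityI subsetI)
      fix x assume "x \<in> C"
      then have "x \<in> space N" "\<And>i. i < n \<Longrightarrow> F ((T ^^ i) x) = c i"
        using c by (auto simp: C)
      then show "x \<in> cell w"
        using sub by (auto simp: cell_def w_def list_eq_iff_nth_eq nth_word)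
    next
      fix x assume x: "x \<in> cell w"
      then have "F ((T ^^ i) x) = c i" if "i < n" for i
        using that by (auto simp: cell_def w_def list_eq_iff_nth_eq nth_word)
      then show "x \<in> C"
        using in_N[OF x w] c cell_N[OF w] x by (auto simp: C)
    qed
    then show "C \<in> cell ` W0" using w by auto
  next
    fix C assume "C \<in> cell ` W0"
    then obtain w where w: "w \<in> W0" and C: "C = cell w" by auto
    define f where "f = (\<lambda>i\<in>{..<n}. F -` {w ! i} \<inter> space N)"
    have "f \<in> {..<n} \<rightarrow>\<^sub>E label_partition F"
      using w by (auto simp: f_def label_partition_def W0_def intro!: imageI)
    moreover have "C = {x \<in> space N. \<forall>i<n. (T ^^ i) x \<in> f i}"
    proof (intro equalityI subsetI)
      fix x assume "x \<in> C"
      then show "x \<in> {x \<in> space N. \<forall>i<n. (T ^^ i) x \<in> f i}"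
        using in_N[OF _ w] cell_N[OF w] by (auto simp: C f_def cell_def nth_word)
    next
      fix x assume "x \<in> {x \<in> space N. \<forall>i<n. (T ^^ i) x \<in> f i}"
      then show "x \<in> C"
        using w sub by (auto simp: C f_def cell_def W0_def list_eq_iff_nth_eq nth_word)
    qed
    ultimately show "C \<in> iterated_join N T (label_partition F) n"
      unfolding iterated_join_def by auto
  qed
  have "(\<Sum>A\<in>cell ` W0. ?\<eta> (measure N A)) = (\<Sum>w\<in>W0. ?\<eta> (measure N (cell w)))"
  \<comment> \<open>Different words share a cell only when that cell is empty.\<close>
  proof (subst sum.reindex_nontrivial[OF finW0])
    fix w w' assume "w \<in> W0" "w' \<in> W0" "w \<noteq> w'" "cell w = cell w'"
    then have "cell w = {}" by (auto simp: cell_def)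
    then show "?\<eta> (measure N (cell w)) = 0" by simp
  qed simp
  also have "\<dots> = (\<Sum>w\<in>W0. ?\<eta> (prob (cell w)))"
    by (intro sum.cong) (simp_all add: measure_N cell_sets)
  also have "\<dots> = (\<Sum>w\<in>W0 \<union> word T F n ` space M. ?\<eta> (prob (cell w)))"
  proof (rule sum.mono_neutral_left)
    show "finite (W0 \<union> word T F n ` space M)"
      using finW0 finite_word[OF fin] by simp
    show "\<forall>w\<in>W0 \<union> word T F n ` space M - W0. ?\<eta> (prob (cell w)) = 0"
    proof
      fix w assume "w \<in> W0 \<union> word T F n ` space M - W0"
      then have w: "w \<notin> W0" by auto
      have "AE x in M. x \<notin> cell w"
        using AE_all_funpow[OF AE_space_N]
      proof eventually_elim
        case (elim x)
        then have "word T F n x \<in> W0"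
          by (auto simp: W0_def in_set_conv_nth nth_word)
        then show ?case using w by (auto simp: cell_def)
      qed
      then have "prob (cell w) = 0"
        using cell_M by (subst prob_eq_0) auto
      then show "?\<eta> (prob (cell w)) = 0" by simp
    qed
  qed auto
  also have "\<dots> = (\<Sum>w\<in>word T F n ` space M. ?\<eta> (prob (cell w)))"
  proof (rule sum.mono_neutral_right)
    show "finite (W0 \<union> word T F n ` space M)"
      using finW0 finite_word[OF fin] by simp
    show "\<forall>w\<in>W0 \<union> word T F n ` space M - word T F n ` space M. ?\<eta> (prob (cell w)) = 0"
    proof
      fix w assume "w \<in> W0 \<union> word T F n ` space M - word T F n ` space M"
      then have "cell w = {}" by (auto simp: cell_def)
      then show "?\<eta> (prob (cell w)) = 0" by simp
    qed
  qed auto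
  finally show ?thesis
    unfolding partition_entropy_def join label_entropy_eq_sum[OF W finite_word[OF fin]]
    by (simp add: cell_def)
qed

lemma finite_measurable_label_partition:
  fixes F :: "'a \<Rightarrow> nat"
  assumes F[measurable]: "F \<in> M \<rightarrow>\<^sub>M count_space UNIV" and fin: "finite (F ` space M)"
  shows "finite_measurable_partition N (label_partition F)"
  unfolding finite_measurable_partition_def
proof (intro conjI)
  have sub: "space N \<subseteq> space M"
    using space_N by (rule sets.sets_into_space)
  show "finite (label_partition F)"
    unfolding label_partition_def
    by (intro finite_imageI finite_subset[OF image_mono[OF sub] fin])
  have "F -` {c} \<inter> space N \<in> sets M" for c
  proof -
    have "(F -` {c} \<inter> space M) \<inter> space N \<in> sets M" by measurable
    then show ?thesis using sub by (simp add: Int_assoc Int_absorb1)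
  qed
  then show "label_partition F \<subseteq> sets N"
    by (auto simp: label_partition_def sets_N)
  show "partition_on (space N) (label_partition F)"
    by (rule partition_onI) (auto simp: label_partition_def disjnt_def)
qed

lemma ex_label_partition:
  assumes "finite_measurable_partition N P"
  obtains F :: "'a \<Rightarrow> nat" where "F \<in> M \<rightarrow>\<^sub>M count_space UNIV" "finite (F ` space M)"
    "\<And>x y. x \<in> space M - space N \<Longrightarrow> y \<in> space N \<Longrightarrow> F x \<noteq> F y" "P = label_partition F"
proof -
  have finP: "finite P" and PN: "P \<subseteq> sets N" and part: "partition_on (space N) P"
    using assms by (auto simp: finite_measurable_partition_def)
  obtain e :: "'a set \<Rightarrow> nat" where e: "bij_betw e P {0..<card P}"
    using ex_bij_betw_finite_nat[OF finP] by blast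
  have uniq: "\<exists>!A. A \<in> P \<and> x \<in> A" if "x \<in> space N" for x
    using part that by (auto simp: partition_on_def disjoint_def)
  \<comment> \<open>The free number \<open>card P\<close> marks the points outside
    \<open>space N\<close>; this yields the separation.\<close>
  define F where "F = (\<lambda>x. if x \<in> space N then e (THE A. A \<in> P \<and> x \<in> A) else card P)"
  have FA: "F x = e A" if "A \<in> P" "x \<in> A" for x A
  proof -
    have "x \<in> space N" using that part by (auto simp: partition_on_def)
    moreover from uniq[OF this] have "(THE A. A \<in> P \<and> x \<in> A) = A"
      using that by (intro the1_equality) auto
    ultimately show ?thesis by (simp add: F_def)
  qed
  have Fin: "\<exists>A\<in>P. x \<in> A \<and> F x = e A" if "x \<in> space N" for x
    using uniq[OF that] FA by auto
  have e_lt: "e A < card P" if "A \<in> P" for A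
    using e that by (auto simp: bij_betw_def)
  have e_inj: "A = B" if "e A = e B" "A \<in> P" "B \<in> P" for A B
    using e that by (auto simp: bij_betw_def inj_on_def)
  have vimage: "F -` {e A} \<inter> space N = A" if "A \<in> P" for A
  proof (intro equalityI subsetI)
    fix x assume x: "x \<in> F -` {e A} \<inter> space N"
    then obtain B where "B \<in> P" "x \<in> B" "F x = e B" using Fin[of x] by auto
    then show "x \<in> A" using e_inj[of B A] that x by auto
  next
    fix x assume "x \<in> A"
    then show "x \<in> F -` {e A} \<inter> space N"
      using FA[OF that, of x] part that by (auto simp: partition_on_def)
  qed
  have sub: "space N \<subseteq> space M"
    using space_N by (rule sets.sets_into_space)
  have range: "F ` space M \<subseteq> {..card P}"
  proof
    fix c assume "c \<in> F ` space M"
    then obtain x where "c = F x" by auto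
    then show "c \<in> {..card P}"
      using Fin[of x] e_lt by (cases "x \<in> space N") (auto simp: F_def intro: less_imp_le)
  qed
  show thesis
  proof (rule that[of F])
    show "F \<in> M \<rightarrow>\<^sub>M count_space UNIV"
    proof (rule measurable_count_space_eq2_countable[THEN iffD2], intro conjI ballI)
      fix c
      have "F -` {c} \<inter> space M = (if c = card P then space M - space N else {}) \<union> (\<Union>A\<in>{A\<in>P. e A = c}. A)" (is "_ = ?R")
      proof (intro equalityI subsetI)
        fix x assume x: "x \<in> F -` {c} \<inter> space M"
        show "x \<in> ?R"
        proof (cases "x \<in> space N")
          case True
          from Fin[OF this] x show ?thesis by auto
        next
          case False
          then show ?thesis using x by (auto simp: F_def)
        qed
      next
        fix x assume "x \<in> ?R"
        then consider "c = card P" "x \<in> space M - space N" | A where "A \<in> P" "e A = c" "x \<in> A"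
          by (auto split: if_splits)
        then show "x \<in> F -` {c} \<inter> space M"
        proof cases
          case 2
          then have "x \<in> space N" using part by (auto simp: partition_on_def)
          then show ?thesis using FA[OF 2(1,3)] 2 sub by auto
        qed (auto simp: F_def)
      qed
      moreover have "{A \<in> P. e A = c} \<subseteq> sets M"
        using PN by (auto simp: sets_N)
      then have "(\<Union>A\<in>{A\<in>P. e A = c}. A) \<in> sets M"
        using finP by (intro sets.finite_UN) auto
      then have "(if c = card P then space M - space N else {}) \<union> (\<Union>A\<in>{A\<in>P. e A = c}. A) \<in> sets M"
        by (intro sets.Un) simp_all
      ultimately show "F -` {c} \<inter> space M \<in> sets M" by (simp only:)
    qed auto
    show "finite (F ` space M)"
      by (rule finite_subset[OF range]) simp
    show "F x \<noteq> F y" if x: "x \<in> space M - space N" and y: "y \<in> space N" for x y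
    proof -
      obtain A where "A \<in> P" "F y = e A" using Fin[OF y] by auto
      moreover have "F x = card P" using x by (simp add: F_def)
      ultimately show ?thesis using e_lt[of A] by simp
    qed
    have "P = (\<lambda>c. F -` {c} \<inter> space N) ` e ` P"
      unfolding image_image using vimage by simp
    also have "e ` P = F ` space N"
    proof
      show "F ` space N \<subseteq> e ` P" using Fin by auto
      show "e ` P \<subseteq> F ` space N"
      proof
        fix c assume "c \<in> e ` P"
        then obtain A where A: "A \<in> P" "c = e A" by auto
        then obtain x where "x \<in> A" using partition_onD3[OF part] by (metis ex_in_conv)
        then show "c \<in> F ` space N"
          using FA[OF A(1)] A part by (auto simp: partition_on_def intro!: image_eqI[of _ _ x])
      qed
    qed
    finally show "P = label_partition F" by (simp add: label_partition_def)
  qed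
qed

lemma ks_entropy_partition_eq:
  fixes F :: "'a \<Rightarrow> nat"
  assumes F: "F \<in> M \<rightarrow>\<^sub>M count_space UNIV" and fin: "finite (F ` space M)"
    and sep: "\<And>x y. x \<in> space M - space N \<Longrightarrow> y \<in> space N \<Longrightarrow> F x \<noteq> F y"
  shows "(\<lambda>n. label_entropy (word T F n) / real n) \<longlonglongrightarrow> ks_entropy_partition N T (label_partition F)"
proof -
  let ?u = "\<lambda>n. label_entropy (word T F n) / real n"
  have conv: "?u \<longlonglongrightarrow> lim ?u"
    using word_entropy_rate_convergent[OF F fin] by (simp add: convergent_LIMSEQ_iff)
  have "eventually (\<lambda>n. ?u n = partition_entropy N (iterated_join N T (label_partition F) n) / real n) sequentially"
    using eventually_gt_at_top[of 0]
    by eventually_elim (subst partition_entropy_iterated_join[OF F fin sep], auto)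
  then have "(\<lambda>n. partition_entropy N (iterated_join N T (label_partition F) n) / real n) \<longlonglongrightarrow> lim ?u"
    using conv by (rule Lim_transform_eventually[rotated])
  then have "ks_entropy_partition N T (label_partition F) = lim ?u"
    unfolding ks_entropy_partition_def by (rule limI)
  then show ?thesis using conv by simp
qed

lemma ks_entropy_le:
  assumes "\<And>F :: 'a \<Rightarrow> nat. F \<in> M \<rightarrow>\<^sub>M count_space UNIV \<Longrightarrow> finite (F ` space M) \<Longrightarrow>
    lim (\<lambda>n. label_entropy (word T F n) / real n) \<le> h"
  shows "ks_entropy N T \<le> ereal h"
  unfolding ks_entropy_def
proof (rule SUP_least)
  fix P assume "P \<in> {P. finite_measurable_partition N P}"
  then obtain F :: "'a \<Rightarrow> nat" where F: "F \<in> M \<rightarrow>\<^sub>M count_space UNIV" "finite (F ` space M)"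
    "\<And>x y. x \<in> space M - space N \<Longrightarrow> y \<in> space N \<Longrightarrow> F x \<noteq> F y" "P = label_partition F"
    using ex_label_partition by blast
  have "ks_entropy_partition N T P = lim (\<lambda>n. label_entropy (word T F n) / real n)"
    unfolding F(4) by (rule limI[OF ks_entropy_partition_eq[OF F(1-3)], symmetric])
  then show "ereal (ks_entropy_partition N T P) \<le> ereal h"
    using assms[OF F(1,2)] by simp
qed

lemma ks_entropy_ge:
  fixes F :: "'a \<Rightarrow> nat"
  assumes "F \<in> M \<rightarrow>\<^sub>M count_space UNIV" "finite (F ` space M)"
    and "\<And>x y. x \<in> space M - space N \<Longrightarrow> y \<in> space N \<Longrightarrow> F x \<noteq> F y"
  shows "ereal (lim (\<lambda>n. label_entropy (word T F n) / real n)) \<le> ks_entropy N T"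
proof -
  have "ereal (lim (\<lambda>n. label_entropy (word T F n) / real n)) = ereal (ks_entropy_partition N T (label_partition F))"
    by (simp only: limI[OF ks_entropy_partition_eq[OF assms]])
  also have "\<dots> \<le> ks_entropy N T"
    unfolding ks_entropy_def
    by (rule SUP_upper) (simp add: finite_measurable_label_partition[OF assms(1,2)])
  finally show ?thesis .
qed

end

section \<open>The domain of the natural extension\<close>

lemma gold_G_square: "gold_G * gold_G = gold_G + 1"
  by (simp add: gold_G_def field_simps)

lemma gold_g_eq: "gold_g = gold_G - 1"
  by (simp add: gold_g_def gold_G_def field_simps)

text \<open>Together with \<open>gold_G_square\<close> these turn the numerical estimates below into
  linear arithmetic.\<close>

lemma gold_G_bounds: "1618 / 1000 < gold_G" "gold_G < 1619 / 1000"
proof -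
  have "2236 / 1000 < sqrt 5" by (rule real_less_rsqrt) (simp add: power2_eq_square)
  moreover have "sqrt 5 < 2238 / 1000" by (rule real_less_lsqrt) (auto simp: power2_eq_square)
  ultimately show "1618 / 1000 < gold_G" "gold_G < 1619 / 1000" by (auto simp: gold_G_def)
qed

locale odd_cf =
  fixes \<alpha> :: real
  assumes \<alpha>_ge: "gold_g \<le> \<alpha>" and \<alpha>_le: "\<alpha> \<le> gold_G"
begin

abbreviation "G \<equiv> gold_G"
abbreviation "\<phi> \<equiv> ocf_phi \<alpha>"
abbreviation "\<Phi> \<equiv> ocf_Phi \<alpha>"
abbreviation "I \<equiv> ocf_I \<alpha>"

definition l1 :: real where "l1 = 1 / \<alpha> - 1"
definition l2 :: real where "l2 = 1 / (2 - \<alpha>) - 1"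

text \<open>The signed partial quotient of \<open>x\<close>, which is 0 only for \<open>x = 0\<close>.\<close>

definition digit :: "real \<Rightarrow> int" where
  "digit x = (if x = 0 then 0 else if 0 < x then ocf_d \<alpha> x else - ocf_d \<alpha> x)"

lemma \<alpha>_bounds: "618 / 1000 < \<alpha>" "\<alpha> < 1619 / 1000"
  using \<alpha>_ge \<alpha>_le gold_G_bounds by (auto simp: gold_g_eq)

text \<open>(G - \<alpha>)(\<alpha> + g) = \<alpha> + 1 - \<alpha>^2 and (\<alpha> - g)(\<alpha> +
  G) = \<alpha>^2 + \<alpha> - 1, so for positive \<alpha> the two inequalities express exactly that
  \<alpha> lies between g and G. In this form the parameter range enters the geometry of the
  branches.\<close>

lemma \<alpha>_quad: "\<alpha> * \<alpha> \<le> \<alpha> + 1" "1 \<le> \<alpha> * \<alpha> + \<alpha>"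
proof -
  have "0 \<le> (gold_G - \<alpha>) * (\<alpha> + gold_g)"
    using \<alpha>_le \<alpha>_bounds gold_G_bounds by (intro mult_nonneg_nonneg) (auto simp: gold_g_eq)
  then show "\<alpha> * \<alpha> \<le> \<alpha> + 1"
    using gold_G_square by (simp add: gold_g_eq algebra_simps)
  have "0 \<le> (\<alpha> - gold_g) * (\<alpha> + gold_G)"
    using \<alpha>_ge \<alpha>_bounds gold_G_bounds by (intro mult_nonneg_nonneg) auto
  then show "1 \<le> \<alpha> * \<alpha> + \<alpha>"
    using gold_G_square by (simp add: gold_g_eq algebra_simps)
qed

lemma mem_I: "x \<in> I \<longleftrightarrow> \<alpha> - 2 \<le> x \<and> x < \<alpha>"
  by (simp add: ocf_I_def)

lemma one_plus_l1: "(1 + l1) * \<alpha> = 1" and one_plus_l2: "(1 + l2) * (2 - \<alpha>) = 1"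
  using \<alpha>_bounds by (auto simp: l1_def l2_def)

lemma l_pos: "0 < 1 + l1" "0 < 1 + l2"
  using \<alpha>_bounds by (auto simp: l1_def l2_def)

lemma phi_eq: "x \<noteq> 0 \<Longrightarrow> \<phi> x = 1 / \<bar>x\<bar> - ocf_d \<alpha> x"
  by (simp add: ocf_phi_def)

lemma phi_in_I: "\<phi> x \<in> I"
proof (cases "x = 0")
  case True
  then show ?thesis using \<alpha>_bounds by (simp add: ocf_phi_def mem_I)
next
  case False
  let ?t = "1 / (2 * \<bar>x\<bar>) + (1 - \<alpha>) / 2"
  have "real_of_int \<lfloor>?t\<rfloor> \<le> ?t" "?t < real_of_int \<lfloor>?t\<rfloor> + 1" by linarith+
  moreover have "1 / \<bar>x\<bar> = 2 * (1 / (2 * \<bar>x\<bar>))" by simp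
  moreover have "\<phi> x = 1 / \<bar>x\<bar> - (2 * real_of_int \<lfloor>?t\<rfloor> + 1)"
    using False by (simp add: phi_eq ocf_d_def)
  ultimately show ?thesis
    unfolding mem_I by argo
qed

lemma phi_bounds: "\<alpha> - 2 \<le> \<phi> x" "\<phi> x < \<alpha>"
  using phi_in_I by (auto simp: mem_I)

lemma odd_ocf_d: "odd (ocf_d \<alpha> x)"
  by (simp add: ocf_d_def)

text \<open>The floor is nonnegative once (\<alpha> - 1) |x| <= 1. For positive x this follows from
  \<open>\<alpha>_quad\<close>, for negative x from (\<alpha> - 3/2)^2 >= 0.\<close>

lemma ocf_d_ge_1:
  assumes "x \<in> I" "x \<noteq> 0"
  shows "1 \<le> ocf_d \<alpha> x"
proof -
  have "\<alpha> - 1 \<le> 1 / \<bar>x\<bar>"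
  proof (cases "0 < x")
    case True
    then have "(\<alpha> - 1) * x \<le> 1"
    proof (cases "1 \<le> \<alpha>")
      case True
      then have "(\<alpha> - 1) * x \<le> (\<alpha> - 1) * \<alpha>"
        using assms by (intro mult_left_mono) (auto simp: mem_I)
      then show ?thesis using \<alpha>_quad by (simp add: algebra_simps)
    next
      case False
      then show ?thesis using \<open>0 < x\<close> by (smt (verit) mult_nonpos_nonneg)
    qed
    then show ?thesis using True by (simp add: field_simps)
  next
    case False
    then have x: "0 < - x" "- x \<le> 2 - \<alpha>" using assms by (auto simp: mem_I)
    have "(\<alpha> - 1) * (- x) \<le> 1"
    proof (cases "1 \<le> \<alpha>")
      case True
      then have "(\<alpha> - 1) * (- x) \<le> (\<alpha> - 1) * (2 - \<alpha>)"
        using x by (intro mult_left_mono) auto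
      also have "\<dots> \<le> 1"
        using zero_le_square[of "\<alpha> - 3 / 2"] by (simp add: algebra_simps)
      finally show ?thesis .
    next
      case False
      then show ?thesis using x by (smt (verit) mult_nonpos_nonneg)
    qed
    then show ?thesis using x by (simp add: field_simps)
  qed
  then have "0 \<le> 1 / (2 * \<bar>x\<bar>) + (1 - \<alpha>) / 2"
    by (simp add: field_simps)
  then have "0 \<le> \<lfloor>1 / (2 * \<bar>x\<bar>) + (1 - \<alpha>) / 2\<rfloor>" by simp
  then show ?thesis by (simp add: ocf_d_def)
qed

lemma ocf_d_cases:
  assumes "x \<in> I" "x \<noteq> 0"
  obtains "ocf_d \<alpha> x = 1" | "ocf_d \<alpha> x = 3" | "5 \<le> ocf_d \<alpha> x"
proof -
  have "ocf_d \<alpha> x = 1 \<or> ocf_d \<alpha> x = 3 \<or> 5 \<le> ocf_d \<alpha> x"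
    using ocf_d_ge_1[OF assms] odd_ocf_d[of x] by presburger
  then show thesis using that by blast
qed

lemma denom_pos:
  assumes "x \<noteq> 0"
  shows "0 < ocf_d \<alpha> x + \<phi> x" "\<bar>x\<bar> * (ocf_d \<alpha> x + \<phi> x) = 1" "\<bar>x\<bar> = 1 / (ocf_d \<alpha> x + \<phi> x)"
  using assms by (auto simp: phi_eq)

text \<open>The translates of \<open>I\<close> by odd integers tile the line, so 1 / |x| can be
  written as d + u with d odd and u in \<open>I\<close> in only one way.\<close>

lemma ocf_d_eqI:
  fixes d :: int and u x :: real
  assumes "odd d" "u \<in> I" "0 < d + u" "\<bar>x\<bar> = 1 / (d + u)"
  shows "ocf_d \<alpha> x = d" "\<phi> x = u"
proof -
  have inv: "1 / \<bar>x\<bar> = d + u" using assms by simp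
  obtain m where m: "d = 2 * m + 1" using \<open>odd d\<close> by (auto elim: oddE)
  have "1 / (2 * \<bar>x\<bar>) = (d + u) / 2" using inv by (simp add: field_simps)
  then have "\<lfloor>1 / (2 * \<bar>x\<bar>) + (1 - \<alpha>) / 2\<rfloor> = m"
    using assms(2) m by (intro floor_unique) (auto simp: mem_I field_simps)
  then show "ocf_d \<alpha> x = d" by (simp add: ocf_d_def m)
  moreover have "x \<noteq> 0" using assms by auto
  ultimately show "\<phi> x = u" using inv by (simp add: phi_eq)
qed

lemma first_branch_pos:
  assumes "x \<in> I" "0 < x" "ocf_d \<alpha> x = 1"
  shows "l1 < \<phi> x"
proof -
  have "1 / \<alpha> < 1 / x" using assms by (simp add: mem_I frac_less2)
  then show ?thesis using assms by (simp add: phi_eq l1_def)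
qed

lemma first_branch_neg:
  assumes "x \<in> I" "x < 0" "ocf_d \<alpha> x = 1"
  shows "l2 \<le> \<phi> x"
proof -
  have "1 / (2 - \<alpha>) \<le> 1 / (- x)" using assms by (intro frac_le) (auto simp: mem_I)
  then show ?thesis using assms by (simp add: phi_eq l2_def)
qed

text \<open>
  The closed version of the domain is invariant pointwise, not only up to a null set. Note that
  \<open>l1\<close> is the value at \<open>\<alpha>\<close> of the branch with partial quotient 1 for every \<open>\<alpha>\<close>, also for \<open>\<alpha> = g\<close>,
  and likewise \<open>l2\<close> at \<open>\<alpha> - 2\<close>.
\<close>

definition closed_dom :: "(real \<times> real) set" where
  "closed_dom = {(x, y). x \<in> I \<and> 0 \<le> y \<and>
     (y \<le> 2 - G \<or> (l1 \<le> x \<and> y \<le> 1) \<or> (l2 \<le> x \<and> 1 \<le> y \<and> y \<le> G))}"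

text \<open>Differs from \<open>closed_dom\<close> by a null set. The strict inequality at
  \<open>l1\<close> and the absence of the lines y = 0 and y = 1 are used to show that \<Phi> has no
  collisions here.\<close>

definition open_dom :: "(real \<times> real) set" where
  "open_dom = {(x, y). x \<in> I \<and> 0 < y \<and>
     (y < 2 - G \<or> (l1 < x \<and> 2 - G < y \<and> y < 1) \<or> (l2 \<le> x \<and> 1 < y \<and> y < G))}"

lemma open_subset_closed: "open_dom \<subseteq> closed_dom"
  by (auto simp: open_dom_def closed_dom_def)

lemma closed_dom_y: "(x, y) \<in> closed_dom \<Longrightarrow> 0 \<le> y \<and> y \<le> G"
  using gold_G_bounds by (auto simp: closed_dom_def)

lemma closed_dom_I: "(x, y) \<in> closed_dom \<Longrightarrow> x \<in> I"
  by (simp add: closed_dom_def)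

lemma axis_closed_dom: "x \<in> I \<Longrightarrow> (x, 0) \<in> closed_dom"
  using gold_G_bounds by (auto simp: closed_dom_def)

text \<open>Such an x lies below - 1 / (1 + \<alpha>), to the left of both \<open>l1\<close> and
  \<open>l2\<close>, so only the lowest strip remains above it. This keeps the denominator 1 - y of
  \<Phi> positive.\<close>

lemma neg_first_branch_fiber:
  assumes "(x, y) \<in> closed_dom" "x < 0" "ocf_d \<alpha> x = 1"
  shows "y \<le> 2 - G"
proof -
  have ax: "- x * (1 + \<phi> x) = 1" "0 < 1 + \<phi> x" using denom_pos[of x] assms by auto
  have "- x * (1 + \<phi> x) < - x * (1 + \<alpha>)"
    using assms phi_bounds[of x] by (intro mult_strict_left_mono) auto
  then have x: "1 < - x * (1 + \<alpha>)" using ax by simp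
  have "\<not> l1 \<le> x"
  proof
    assume "l1 \<le> x"
    then have "\<alpha> * (- x) \<le> \<alpha> * (- l1)" using \<alpha>_bounds by simp
    also have "\<dots> = \<alpha> - 1" using one_plus_l1 by (simp add: algebra_simps)
    finally have "\<alpha> * (- x) \<le> \<alpha> - 1" .
    then have "\<alpha> * (- x * (1 + \<alpha>)) \<le> (\<alpha> - 1) * (1 + \<alpha>)"
      using \<alpha>_bounds mult_right_mono[of "\<alpha> * (- x)" "\<alpha> - 1" "1 + \<alpha>"] by (simp add: mult.assoc)
    also have "\<dots> \<le> \<alpha>" using \<alpha>_quad by (simp add: algebra_simps)
    also have "\<alpha> = \<alpha> * 1" by simp
    finally have "- x * (1 + \<alpha>) \<le> 1" by (rule mult_left_le_imp_le) (use \<alpha>_bounds in simp)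
    then show False using x by simp
  qed
  moreover have "\<not> l2 \<le> x"
  proof
    assume "l2 \<le> x"
    then have "(2 - \<alpha>) * (- x) \<le> (2 - \<alpha>) * (- l2)" using \<alpha>_bounds by (intro mult_left_mono) auto
    also have "\<dots> = 1 - \<alpha>" using one_plus_l2 by (simp add: algebra_simps)
    finally have "(2 - \<alpha>) * (- x) \<le> 1 - \<alpha>" .
    then have "(2 - \<alpha>) * (- x * (1 + \<alpha>)) \<le> (1 - \<alpha>) * (1 + \<alpha>)"
      using \<alpha>_bounds mult_right_mono[of "(2 - \<alpha>) * (- x)" "1 - \<alpha>" "1 + \<alpha>"] by (simp add: mult.assoc)
    also have "\<dots> \<le> 2 - \<alpha>"
      using zero_le_square[of "\<alpha> - 1 / 2"] by (simp add: algebra_simps)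
    also have "2 - \<alpha> = (2 - \<alpha>) * 1" by simp
    finally have "- x * (1 + \<alpha>) \<le> 1" by (rule mult_left_le_imp_le) (use \<alpha>_bounds in simp)
    then show False using x by simp
  qed
  ultimately show ?thesis using assms by (auto simp: closed_dom_def)
qed

lemma Phi_pos: "0 < (x :: real) \<Longrightarrow> \<Phi> (x, y) = (\<phi> x, 1 / (ocf_d \<alpha> x + (y :: real)))"
  and Phi_neg: "x < 0 \<Longrightarrow> \<Phi> (x, y) = (\<phi> x, 1 / (ocf_d \<alpha> x - (y :: real)))"
  by (auto simp: ocf_Phi_def)

lemma fst_Phi: "fst (\<Phi> z) = \<phi> (fst z)"
  by (auto simp: ocf_Phi_def ocf_phi_def split: prod.split)

text \<open>Sign and partial quotient decide the strip of the image: quotient 1 leads to the middle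
  strip for x > 0 and to the top strip for x < 0, and larger quotients lead to the lowest strip by
  1/3 <= 2 - G. Only quotient 3 with x < 0 depends on the exact position of \<open>l1\<close> and
  \<open>l2\<close>.\<close>

lemma Phi_closed_dom:
  fixes x y :: real
  assumes "(x, y) \<in> closed_dom" "x \<noteq> 0"
  shows "\<Phi> (x, y) \<in> closed_dom" "0 < ocf_d \<alpha> x + sgn x * y"
proof -
  have xI: "x \<in> I" and y: "0 \<le> y" "y \<le> G"
    using closed_dom_I[OF assms(1)] closed_dom_y[OF assms(1)] by simp_all
  \<comment> \<open>These identities fix the heights of the strips: y = 2 - G is sent to 2 - G by 1
    / (3 - y) and to G by 1 / (1 - y).\<close>
  have GG: "1 / (1 + G) = 2 - G" "1 / (G - 1) = G"
    using gold_G_square gold_G_bounds by (auto simp: field_simps)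
  have "\<Phi> (x, y) \<in> closed_dom \<and> 0 < ocf_d \<alpha> x + sgn x * y"
  proof (cases "0 < x")
    case True
    note [simp] = Phi_pos[OF True]
    have d1: "1 \<le> ocf_d \<alpha> x" by (rule ocf_d_ge_1[OF xI assms(2)])
    show ?thesis
    proof (cases "ocf_d \<alpha> x = 1")
      case d: True
      have "1 / (1 + y) \<le> 1" using y by simp
      then show ?thesis
        using True d y first_branch_pos[OF xI True d] phi_in_I[of x]
        by (auto simp: closed_dom_def)
    next
      case False
      then have d: "3 \<le> ocf_d \<alpha> x" using ocf_d_cases[OF xI assms(2)] by fastforce
      then have "1 / (ocf_d \<alpha> x + y) \<le> 1 / 3"
        using y by (intro frac_le) auto
      also have "\<dots> \<le> 2 - G" using gold_G_bounds by simp
      finally have "1 / (ocf_d \<alpha> x + y) \<le> 2 - G" .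
      moreover have "0 < ocf_d \<alpha> x + y" using d y by linarith
      ultimately show ?thesis
        using True phi_in_I[of x] by (simp add: closed_dom_def)
    qed
  next
    case False
    then have x: "x < 0" using assms by auto
    note [simp] = Phi_neg[OF x]
    have inv: "(- x) * (ocf_d \<alpha> x + \<phi> x) = 1" "0 < ocf_d \<alpha> x + \<phi> x"
      using denom_pos[of x] x by auto
    show ?thesis
    proof (rule ocf_d_cases[OF xI assms(2)])
      assume d: "ocf_d \<alpha> x = 1"
      have y2: "y \<le> 2 - G" by (rule neg_first_branch_fiber[OF assms(1) x d])
      then have "1 / (1 - y) \<le> 1 / (G - 1)"
        using gold_G_bounds by (intro frac_le) auto
      then have "1 / (1 - y) \<le> G" using GG by simp
      moreover have "0 < 1 - y" using y2 gold_G_bounds by simp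
      moreover from this have "1 \<le> 1 / (1 - y)" using y by simp
      ultimately show ?thesis
        using x d first_branch_neg[OF xI x d] phi_in_I[of x] by (simp add: closed_dom_def)
    next
      assume d: "ocf_d \<alpha> x = 3"
      have pos: "0 < 3 - y" using y gold_G_bounds by auto
      have main: "1 / (3 - y) \<le> 2 - G \<or> (l1 \<le> \<phi> x \<and> 1 / (3 - y) \<le> 1)"
      proof -
        consider "y \<le> 2 - G" | "l1 \<le> x" | "l2 \<le> x"
          using assms(1) by (auto simp: closed_dom_def)
        then show ?thesis
        proof cases
          case 1
          then have "1 / (3 - y) \<le> 1 / (1 + G)"
            using gold_G_bounds by (intro frac_le) auto
          then show ?thesis using GG by simp
        next
          case 2
          have *: "\<alpha> * (- x) \<le> \<alpha> - 1"
          proof -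
            have "\<alpha> * (- x) \<le> \<alpha> * (- l1)" using 2 \<alpha>_bounds by simp
            then show ?thesis using one_plus_l1 by (simp add: algebra_simps)
          qed
          moreover have "0 < \<alpha> * (- x)" by (rule mult_pos_pos) (use x \<alpha>_bounds in auto)
          ultimately have "1 < \<alpha>" by linarith
          have "\<alpha> * (- x) * (3 + \<phi> x) \<le> (\<alpha> - 1) * (3 + \<phi> x)"
            using * inv d by (intro mult_right_mono) auto
          moreover have "\<alpha> * (- x) * (3 + \<phi> x) = \<alpha>" using inv d by (simp add: mult.assoc)
          ultimately have "\<alpha> \<le> (\<alpha> - 1) * (3 + \<phi> x)" by simp
          \<comment> \<open>In other words, the value 1 / |l1| - 3 of this branch at
            \<open>l1\<close> is at least \<open>l1\<close>; the branch increases on negative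
            x.\<close>
          moreover have "(\<alpha> - 1) * (3 + l1) \<le> \<alpha>"
          proof -
            have "\<alpha> * ((\<alpha> - 1) * (3 + l1)) = (\<alpha> - 1) * (2 * \<alpha> + (1 + l1) * \<alpha>)"
              by (simp add: algebra_simps)
            also have "\<dots> = (\<alpha> - 1) * (2 * \<alpha> + 1)" by (simp only: one_plus_l1)
            also have "\<dots> \<le> \<alpha> * \<alpha>" using \<alpha>_quad by (simp add: algebra_simps)
            finally show ?thesis by (rule mult_left_le_imp_le) (use \<alpha>_bounds in simp)
          qed
          ultimately have "(\<alpha> - 1) * (3 + l1) \<le> (\<alpha> - 1) * (3 + \<phi> x)" by linarith
          then have "l1 \<le> \<phi> x" using \<open>1 < \<alpha>\<close> by simp
          then show ?thesis using y gold_G_bounds pos by simp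
        next
          case 3
          have *: "(2 - \<alpha>) * (- x) \<le> 1 - \<alpha>"
          proof -
            have "(2 - \<alpha>) * (- x) \<le> (2 - \<alpha>) * (- l2)" using 3 \<alpha>_bounds by (intro mult_left_mono) auto
            then show ?thesis using one_plus_l2 by (simp add: algebra_simps)
          qed
          moreover have "0 < (2 - \<alpha>) * (- x)" by (rule mult_pos_pos) (use x \<alpha>_bounds in auto)
          ultimately have "\<alpha> < 1" by linarith
          have "(2 - \<alpha>) * (- x) * (3 + \<phi> x) \<le> (1 - \<alpha>) * (3 + \<phi> x)"
            using * inv d by (intro mult_right_mono) auto
          moreover have "(2 - \<alpha>) * (- x) * (3 + \<phi> x) = 2 - \<alpha>" using inv d by (simp add: mult.assoc)
          ultimately have "2 - \<alpha> \<le> (1 - \<alpha>) * (3 + \<phi> x)" by simp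
          moreover have "(1 - \<alpha>) * (3 + l1) \<le> 2 - \<alpha>"
          proof -
            have "\<alpha> * ((1 - \<alpha>) * (3 + l1)) = (1 - \<alpha>) * (2 * \<alpha> + (1 + l1) * \<alpha>)"
              by (simp add: algebra_simps)
            also have "\<dots> = (1 - \<alpha>) * (2 * \<alpha> + 1)" by (simp only: one_plus_l1)
            also have "\<dots> \<le> \<alpha> * (2 - \<alpha>)" using \<alpha>_quad by (simp add: algebra_simps)
            finally show ?thesis by (rule mult_left_le_imp_le) (use \<alpha>_bounds in simp)
          qed
          ultimately have "(1 - \<alpha>) * (3 + l1) \<le> (1 - \<alpha>) * (3 + \<phi> x)" by linarith
          then have "l1 \<le> \<phi> x" using \<open>\<alpha> < 1\<close> by simp
          then show ?thesis using y gold_G_bounds pos by simp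
        qed
      qed
      have "0 \<le> 1 / (3 - y)" using pos by simp
      then show ?thesis
        using x d pos main phi_in_I[of x] by (simp add: closed_dom_def) blast
    next
      assume d: "5 \<le> ocf_d \<alpha> x"
      then have "3 \<le> ocf_d \<alpha> x - y" using y gold_G_bounds by linarith
      then have "1 / (ocf_d \<alpha> x - y) \<le> 1 / 3" and pos: "0 < ocf_d \<alpha> x - y"
        by (auto intro!: frac_le)
      moreover have "1 / 3 \<le> 2 - G"
        using gold_G_bounds by simp
      ultimately have "1 / (ocf_d \<alpha> x - y) \<le> 2 - G" by linarith
      moreover have "0 \<le> 1 / (ocf_d \<alpha> x - y)" using pos by simp
      ultimately show ?thesis
        using x pos phi_in_I[of x] by (simp add: closed_dom_def)
    qed
  qed
  then show "\<Phi> (x, y) \<in> closed_dom" "0 < ocf_d \<alpha> x + sgn x * y" by auto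
qed

lemma Phi_closed_dom': "z \<in> closed_dom \<Longrightarrow> \<Phi> z \<in> closed_dom"
proof (cases "fst z = 0")
  case True
  have "(0, 0) \<in> closed_dom" using \<alpha>_bounds by (intro axis_closed_dom) (simp add: mem_I)
  then show ?thesis using True by (cases z) (simp add: ocf_Phi_def)
next
  case False
  assume "z \<in> closed_dom"
  then show ?thesis using Phi_closed_dom(1)[of "fst z" "snd z"] False by simp
qed

lemma funpow_Phi_closed_dom: "z \<in> closed_dom \<Longrightarrow> (\<Phi> ^^ n) z \<in> closed_dom"
  by (induction n) (auto intro: Phi_closed_dom')

text \<open>The source of the later constants: the density of the measure and the ratio of
  \<open>xprod\<close> to \<open>yprod\<close> are controlled by these bounds. For x < 0 the minimum
  over a strip is at its upper left corner, hence one case per strip.\<close>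

lemma closed_dom_denom:
  assumes "(x, y) \<in> closed_dom"
  shows "2 / 5 \<le> 1 + x * y" "1 + x * y \<le> 4"
proof -
  have y: "0 \<le> y" "y \<le> G" and x: "\<alpha> - 2 \<le> x" "x < \<alpha>"
    using closed_dom_I[OF assms] closed_dom_y[OF assms] by (simp_all add: mem_I)
  have "x * y \<le> G * y"
    using y x \<alpha>_le by (intro mult_right_mono) auto
  also have "\<dots> \<le> G * G"
    using y gold_G_bounds by (intro mult_left_mono) auto
  finally have "x * y \<le> G * G" .
  then show "1 + x * y \<le> 4" using gold_G_square gold_G_bounds by linarith
  show "2 / 5 \<le> 1 + x * y"
  proof (cases "0 \<le> x")
    case True
    then show ?thesis using y by simp
  next
    case False
    consider "y \<le> 2 - G" | "l1 \<le> x" "y \<le> 1" | "l2 \<le> x"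
      using assms by (auto simp: closed_dom_def)
    then show ?thesis
    proof cases
      case 1
      have "(- x) * y \<le> (2 - \<alpha>) * (2 - G)"
        using False x y 1 by (intro mult_mono) auto
      also have "\<dots> \<le> 1382 / 1000 * (382 / 1000)"
        using \<alpha>_bounds gold_G_bounds by (intro mult_mono) auto
      finally show ?thesis by simp
    next
      case 2
      have "(- x) * y \<le> (- l1) * 1"
        using False 2 y by (intro mult_mono) auto
      moreover have "1 / 2 \<le> 1 / \<alpha>" using \<alpha>_bounds by (intro frac_le) auto
      ultimately show ?thesis by (simp add: l1_def)
    next
      case 3
      have "(- x) * y \<le> (- l2) * G"
        using False 3 y by (intro mult_mono) auto
      moreover have "- l2 \<le> 277 / 1000"
      proof -
        have "1 / (1382 / 1000) \<le> 1 / (2 - \<alpha>)" using \<alpha>_bounds by (intro frac_le) auto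
        then show ?thesis by (simp add: l2_def)
      qed
      then have "(- l2) * G \<le> 277 / 1000 * (1619 / 1000)"
        using gold_G_bounds by (intro mult_mono) auto
      ultimately show ?thesis by simp
    qed
  qed
qed

text \<open>A single step may fail to contract, as |x| can exceed 1. For partial quotient 1 the
  product |x| \<phi> x equals 1 - |x|; otherwise the ratio |\<phi> x| / (d + \<phi> x) is largest
  for d = 3 and \<phi> x near g - 2.\<close>

lemma two_step_contraction:
  assumes "x \<in> I"
  shows "\<bar>x * \<phi> x\<bar> \<le> 9 / 10"
proof (cases "x = 0")
  case False
  let ?d = "ocf_d \<alpha> x"
  have u: "\<bar>x\<bar> * (?d + \<phi> x) = 1" "0 < ?d + \<phi> x" by (use denom_pos[OF False] in auto)
  show ?thesis
  proof (cases "?d = 1")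
    case True
    have "\<bar>x\<bar> * \<phi> x = 1 - \<bar>x\<bar>" using u True by (simp add: algebra_simps)
    moreover have "\<bar>x\<bar> \<le> 1619 / 1000" "1 / 3 \<le> \<bar>x\<bar>"
    proof -
      show "\<bar>x\<bar> \<le> 1619 / 1000" using assms \<alpha>_bounds by (auto simp: mem_I)
      have "1 / 3 \<le> 1 / (1 + \<phi> x)"
        using u True phi_bounds[of x] \<alpha>_bounds \<alpha>_le by (intro frac_le) auto
      then show "1 / 3 \<le> \<bar>x\<bar>" using denom_pos(3)[OF False] True by simp
    qed
    moreover have "\<bar>x * \<phi> x\<bar> = \<bar>\<bar>x\<bar> * \<phi> x\<bar>" by (simp add: abs_mult)
    ultimately show ?thesis by linarith
  next
    case False
    then have d: "3 \<le> ?d" using ocf_d_cases[OF assms \<open>x \<noteq> 0\<close>] by fastforce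
    have "3 \<le> real_of_int ?d" using d by simp
    then have "\<phi> x \<le> 9 / 10 * ?d + 9 / 10 * \<phi> x" "- \<phi> x \<le> 9 / 10 * ?d + 9 / 10 * \<phi> x"
      using phi_bounds[of x] \<alpha>_bounds by linarith+
    then have "\<bar>\<phi> x\<bar> \<le> 9 / 10 * (?d + \<phi> x)" by (simp add: abs_le_iff distrib_left)
    then have "\<bar>x\<bar> * \<bar>\<phi> x\<bar> \<le> \<bar>x\<bar> * (9 / 10 * (?d + \<phi> x))"
      by (intro mult_left_mono) auto
    also have "\<dots> = 9 / 10 * (\<bar>x\<bar> * (?d + \<phi> x))" by simp
    finally show ?thesis using u(1) by (simp only: abs_mult)
  qed
qed auto

end

section \<open>Invariance of the measure\<close>

lemma nn_integral_inverse_interval: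
  fixes A :: "real set"
  assumes A[measurable]: "A \<in> sets borel" and r: "0 < r" "r \<le> s"
  shows "(\<integral>\<^sup>+x. indicator A x * indicator {r..s} x \<partial>lborel)
       = (\<integral>\<^sup>+t. indicator A (1 / t) * ennreal (1 / t\<^sup>2) * indicator {1 / s..1 / r} t \<partial>lborel)"
proof -
  have rs: "1 / s \<le> 1 / r" using r by (simp add: frac_le)
  have "(\<integral>\<^sup>+x. ennreal (indicator A x * indicator {(\<lambda>t. - (1 / t)) (- (1 / r))..(\<lambda>t. - (1 / t)) (- (1 / s))} x) \<partial>lborel)
      = (\<integral>\<^sup>+t. ennreal (indicator A (- (1 / t)) * (1 / t\<^sup>2) * indicator {- (1 / r)..- (1 / s)} t) \<partial>lborel)"
  \<comment> \<open>Substituting - 1 / t keeps the derivative nonnegative; a reflection afterwards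
    restores the sign.\<close>
  proof (rule nn_integral_substitution[where f = "indicator A" and g = "\<lambda>t. - (1 / t)" and g' = "\<lambda>t. 1 / t\<^sup>2"
      and a = "- (1 / r)" and b = "- (1 / s)"])
    show "set_borel_measurable borel {- (1 / (- (1 / r)))..- (1 / (- (1 / s)))} (indicator A :: real \<Rightarrow> real)"
      unfolding set_borel_measurable_def by measurable
    fix t assume t: "t \<in> {- (1 / r)..- (1 / s)}"
    then have "t < 0" using r by (auto intro: le_less_trans)
    then show "((\<lambda>t. - (1 / t)) has_real_derivative (1 / t\<^sup>2)) (at t)"
      by (auto intro!: derivative_eq_intros simp: power2_eq_square)
    show "0 \<le> 1 / t\<^sup>2" by simp
  next
    have "t \<noteq> 0" if "t \<in> {- (1 / r)..- (1 / s)}" for t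
      using that r by (auto intro: le_less_trans)
    then show "continuous_on {- (1 / r)..- (1 / s)} (\<lambda>t. 1 / t\<^sup>2)"
      by (intro continuous_intros) auto
  qed (use rs in simp)
  also have "\<dots> = (\<integral>\<^sup>+t. ennreal (indicator A (- (1 / (- t))) * (1 / (- t)\<^sup>2) * indicator {- (1 / r)..- (1 / s)} (- t)) \<partial>lborel)"
    by (subst nn_integral_real_affine[where c = "-1" and t = 0]) auto
  also have "\<dots> = (\<integral>\<^sup>+t. indicator A (1 / t) * ennreal (1 / t\<^sup>2) * indicator {1 / s..1 / r} t \<partial>lborel)"
    by (rule nn_integral_cong) (auto simp: indicator_def)
  finally have "(\<integral>\<^sup>+x. ennreal (indicator A x * indicator {r..s} x) \<partial>lborel) = \<dots>" by simp
  moreover have "(\<integral>\<^sup>+x. indicator A x * indicator {r..s} x \<partial>lborel) = (\<integral>\<^sup>+x. ennreal (indicator A x * indicator {r..s} x) \<partial>lborel)"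
    by (rule nn_integral_cong) (auto simp: indicator_def)
  ultimately show ?thesis by (simp only:)
qed

lemma nn_integral_inverse:
  fixes f :: "real \<Rightarrow> ennreal"
  assumes f[measurable]: "f \<in> borel_measurable borel"
  shows "(\<integral>\<^sup>+x. f x * indicator {0<..} x \<partial>lborel)
       = (\<integral>\<^sup>+t. f (1 / t) * ennreal (1 / t\<^sup>2) * indicator {0<..} t \<partial>lborel)"
proof -
  let ?M = "density lborel (indicator {0 :: real<..})" and
    ?N = "distr (density lborel (\<lambda>t. ennreal (1 / t\<^sup>2) * indicator {0<..} t)) borel (\<lambda>t :: real. 1 / t)"
  \<comment> \<open>Each of these intervals is mapped onto itself by inversion, so the same interval
    appears on both sides.\<close>
  define J where "J = (\<lambda>n :: nat. {1 / real (Suc n)..real (Suc n)})"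
  have incJ: "J m \<subseteq> J n" if "m \<le> n" for m n
  proof -
    have "1 / real (Suc n) \<le> 1 / real (Suc m)" using that by (intro frac_le) auto
    then show ?thesis using that by (auto simp: J_def)
  qed
  have [measurable]: "J n \<in> sets borel" for n by (simp add: J_def)
  have UJ: "(\<Union>n. J n) = {0<..}"
  proof (intro equalityI subsetI)
    fix x :: real assume "x \<in> {0<..}"
    then have x: "0 < x" by simp
    obtain n :: nat where n: "max x (1 / x) \<le> real n" using real_arch_simple by blast
    then have "1 / x \<le> real (Suc n)" "x \<le> real (Suc n)" by auto
    then have "x \<in> J n" using x by (auto simp: J_def field_simps)
    then show "x \<in> (\<Union>n. J n)" by auto
  qed (auto simp: J_def intro: less_le_trans[rotated])
  have indJ: "(SUP n. indicator (J n) x) = (indicator {0<..} x :: ennreal)" for x :: real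
  proof -
    have "(\<lambda>n. indicator (J n) x :: ennreal) \<longlonglongrightarrow> indicator (\<Union>n. J n) x"
      by (rule LIMSEQ_indicator_incseq) (use incJ in \<open>auto simp: incseq_def\<close>)
    moreover have "incseq (\<lambda>n. indicator (J n) x :: ennreal)"
      using incJ by (auto simp: incseq_def indicator_def)
    ultimately show ?thesis
      using LIMSEQ_SUP LIMSEQ_unique UJ by metis
  qed
  have "?M = ?N"
  proof (rule measure_eqI)
    fix A assume "A \<in> sets ?M"
    then have A[measurable]: "A \<in> sets borel" by simp
    have "emeasure ?M A = (\<integral>\<^sup>+x. (SUP n. indicator A x * indicator (J n) x) \<partial>lborel)"
      by (simp add: emeasure_density SUP_mult_left_ennreal[symmetric] indJ mult.commute)
    also have "\<dots> = (SUP n. \<integral>\<^sup>+x. indicator A x * indicator (J n) x \<partial>lborel)"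
      by (intro nn_integral_monotone_convergence_SUP)
        (auto simp: incseq_def le_fun_def indicator_def dest: incJ[THEN subsetD])
    also have "\<dots> = (SUP n. \<integral>\<^sup>+t. indicator A (1 / t) * ennreal (1 / t\<^sup>2) * indicator (J n) t \<partial>lborel)"
    proof (rule SUP_cong)
      fix n :: nat
      have "1 / real (Suc n) \<le> 1" by simp
      also have "1 \<le> real (Suc n)" by simp
      finally show "(\<integral>\<^sup>+x. indicator A x * indicator (J n) x \<partial>lborel) = (\<integral>\<^sup>+t. indicator A (1 / t) * ennreal (1 / t\<^sup>2) * indicator (J n) t \<partial>lborel)"
        unfolding J_def by (subst nn_integral_inverse_interval) simp_all
    qed simp
    also have "\<dots> = (\<integral>\<^sup>+t. (SUP n. indicator A (1 / t) * ennreal (1 / t\<^sup>2) * indicator (J n) t) \<partial>lborel)"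
      by (intro nn_integral_monotone_convergence_SUP[symmetric])
        (auto simp: incseq_def le_fun_def indicator_def dest: incJ[THEN subsetD])
    also have "\<dots> = (\<integral>\<^sup>+t. indicator A (1 / t) * ennreal (1 / t\<^sup>2) * indicator {0<..} t \<partial>lborel)"
      by (simp add: SUP_mult_left_ennreal[symmetric] indJ)
    also have "\<dots> = emeasure ?N A"
    proof -
      have "emeasure ?N A = (\<integral>\<^sup>+x. indicator A x \<partial>?N)" by simp
      also have "\<dots> = (\<integral>\<^sup>+t. ennreal (1 / t\<^sup>2) * indicator {0<..} t * indicator A (1 / t) \<partial>lborel)"
        by (subst nn_integral_distr) (auto simp: nn_integral_density)
      finally show ?thesis by (simp add: mult_ac)
    qed
    finally show "emeasure ?M A = emeasure ?N A" .
  qed simp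
  then have "(\<integral>\<^sup>+x. f x \<partial>?M) = (\<integral>\<^sup>+x. f x \<partial>?N)" by simp
  then show ?thesis
    by (simp add: nn_integral_density nn_integral_distr mult_ac)
qed

text \<open>The two coordinates of the inverse branch with sign \<epsilon> and partial quotient d: x
  = \<epsilon> / (d + u) and y = \<epsilon> (1 / v - d).\<close>

lemma nn_integral_inverse_shift:
  fixes f :: "real \<Rightarrow> ennreal" and \<epsilon> d :: real
  assumes f[measurable]: "f \<in> borel_measurable borel" and \<epsilon>: "\<epsilon> = 1 \<or> \<epsilon> = -1"
  shows "(\<integral>\<^sup>+x. f x * indicator {0<..} (\<epsilon> * x) \<partial>lborel)
       = (\<integral>\<^sup>+u. f (\<epsilon> / (d + u)) * ennreal (1 / (d + u)\<^sup>2) * indicator {0<..} (d + u) \<partial>lborel)"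
    and "(\<integral>\<^sup>+y. f y * indicator {0<..} (d + \<epsilon> * y) \<partial>lborel)
       = (\<integral>\<^sup>+v. f (\<epsilon> * (1 / v - d)) * ennreal (1 / v\<^sup>2) * indicator {0<..} v \<partial>lborel)"
proof -
  have e2: "\<epsilon> * (\<epsilon> * x) = x" "\<epsilon> * \<epsilon> = 1" "\<bar>\<epsilon>\<bar> = 1" "\<epsilon> \<noteq> 0" for x using \<epsilon> by auto
  have "(\<integral>\<^sup>+x. f x * indicator {0<..} (\<epsilon> * x) \<partial>lborel) = (\<integral>\<^sup>+x. f (\<epsilon> * x) * indicator {0<..} x \<partial>lborel)"
    by (subst nn_integral_real_affine[where c = \<epsilon> and t = 0]) (auto simp: e2)
  also have "\<dots> = (\<integral>\<^sup>+t. f (\<epsilon> * (1 / t)) * ennreal (1 / t\<^sup>2) * indicator {0<..} t \<partial>lborel)"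
    by (rule nn_integral_inverse) simp
  also have "\<dots> = (\<integral>\<^sup>+u. f (\<epsilon> * (1 / (d + u))) * ennreal (1 / (d + u)\<^sup>2) * indicator {0<..} (d + u) \<partial>lborel)"
    by (subst nn_integral_real_affine[where c = 1 and t = d]) auto
  finally show "(\<integral>\<^sup>+x. f x * indicator {0<..} (\<epsilon> * x) \<partial>lborel)
       = (\<integral>\<^sup>+u. f (\<epsilon> / (d + u)) * ennreal (1 / (d + u)\<^sup>2) * indicator {0<..} (d + u) \<partial>lborel)"
    by simp
  have "(\<integral>\<^sup>+y. f y * indicator {0<..} (d + \<epsilon> * y) \<partial>lborel)
     = (\<integral>\<^sup>+s. f (\<epsilon> * (s - d)) * indicator {0<..} s \<partial>lborel)"
    by (subst nn_integral_real_affine[where c = \<epsilon> and t = "- \<epsilon> * d"])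
       (auto simp: e2 algebra_simps)
  also have "\<dots> = (\<integral>\<^sup>+v. f (\<epsilon> * (1 / v - d)) * ennreal (1 / v\<^sup>2) * indicator {0<..} v \<partial>lborel)"
    by (rule nn_integral_inverse) simp
  finally show "(\<integral>\<^sup>+y. f y * indicator {0<..} (d + \<epsilon> * y) \<partial>lborel)
       = (\<integral>\<^sup>+v. f (\<epsilon> * (1 / v - d)) * ennreal (1 / v\<^sup>2) * indicator {0<..} v \<partial>lborel)" .
qed

lemma nn_integral_int_swap:
  fixes f :: "int \<Rightarrow> 'a \<Rightarrow> ennreal"
  assumes [measurable]: "\<And>k. f k \<in> borel_measurable M"
  shows "(\<integral>\<^sup>+x. \<integral>\<^sup>+k. f k x \<partial>count_space UNIV \<partial>M) = (\<integral>\<^sup>+k. \<integral>\<^sup>+x. f k x \<partial>M \<partial>count_space UNIV)"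
proof -
  have *: "(\<integral>\<^sup>+k. g k \<partial>count_space UNIV) = (\<Sum>n. g (int_decode n))" for g :: "int \<Rightarrow> ennreal"
    by (subst nn_integral_bij_count_space[OF bij_int_decode, symmetric]) (simp add: nn_integral_count_space_nat)
  show ?thesis unfolding * by (rule nn_integral_suminf) simp
qed

lemma fst_borel_measurable[measurable]: "fst \<in> (borel :: (real \<times> real) measure) \<rightarrow>\<^sub>M borel"
  and snd_borel_measurable[measurable]: "snd \<in> (borel :: (real \<times> real) measure) \<rightarrow>\<^sub>M borel"
  by (intro borel_measurable_continuous_onI continuous_intros)+

lemma null_vertical_line: "{z :: real \<times> real. fst z = c} \<in> null_sets lborel"
  and null_horizontal_line: "{z :: real \<times> real. snd z = c} \<in> null_sets lborel"
proof -
  have "{z :: real \<times> real. fst z = c} = {c} \<times> UNIV" "{z :: real \<times> real. snd z = c} = UNIV \<times> {c}" by auto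
  moreover have "emeasure (lborel \<Otimes>\<^sub>M lborel) ({c :: real} \<times> (UNIV :: real set)) = 0"
    "emeasure (lborel \<Otimes>\<^sub>M lborel) ((UNIV :: real set) \<times> {c :: real}) = 0"
    by (subst lborel.emeasure_pair_measure_Times; simp)+
  moreover have "{z :: real \<times> real. fst z = c} \<in> sets borel" "{z :: real \<times> real. snd z = c} \<in> sets borel"
    by (intro borel_closed closed_Collect_eq continuous_intros)+
  ultimately show "{z :: real \<times> real. fst z = c} \<in> null_sets lborel"
    "{z :: real \<times> real. snd z = c} \<in> null_sets lborel"
    by (simp_all add: null_sets_def lborel_prod)
qed

context odd_cf
begin

lemma open_dom_y: "(x, y) \<in> open_dom \<Longrightarrow> 0 < y \<and> y < G \<and> y \<noteq> 1"
  using gold_G_bounds by (auto simp: open_dom_def)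

lemma even_small: "even (k :: int) \<Longrightarrow> \<bar>real_of_int k\<bar> < 2 \<Longrightarrow> k = 0"
  by (auto elim!: evenE)

text \<open>
  The only possible collision is between \<open>x > 0\<close> with partial quotient \<open>d\<close> and \<open>x' < 0\<close> with partial
  quotient \<open>d + 2\<close>; it is ruled out because \<open>l1\<close> and \<open>l2\<close> have the same image.
\<close>

lemma Phi_opposite_signs:
  fixes x y x' y' :: real
  assumes z: "(x, y) \<in> open_dom" "(x', y') \<in> open_dom" and x: "0 < x" "x' < 0"
    and eq: "\<phi> x = \<phi> x'" "ocf_d \<alpha> x + y = ocf_d \<alpha> x' - y'"
  shows False
proof -
  have y: "0 < y" "y < G" "y \<noteq> 1" "0 < y'" "y' < G" "y' \<noteq> 1"
    using open_dom_y[OF z(1)] open_dom_y[OF z(2)] by auto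
  have "even (ocf_d \<alpha> x' - ocf_d \<alpha> x - 2)" using odd_ocf_d[of x] odd_ocf_d[of x'] by simp
  moreover have "\<bar>real_of_int (ocf_d \<alpha> x' - ocf_d \<alpha> x - 2)\<bar> < 2"
    using y eq(2) gold_G_bounds by simp
  ultimately have "ocf_d \<alpha> x' - ocf_d \<alpha> x - 2 = 0" by (rule even_small)
  then have d: "ocf_d \<alpha> x' = ocf_d \<alpha> x + 2" by simp
  \<comment> \<open>So 1 / x = e and - 1 / x' = e + 2. Membership in the strips becomes a pair of
    inequalities for e that contradict each other.\<close>
  define e where "e = ocf_d \<alpha> x + \<phi> x"
  have e: "0 < e" "x * e = 1" "(- x') * (e + 2) = 1"
    using denom_pos[of x] denom_pos[of x'] x eq d by (auto simp: e_def algebra_simps)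
  have sum: "y + y' = 2" using eq(2) d by simp
  have I: "x < \<alpha>" "\<alpha> - 2 \<le> x'" using z by (auto simp: open_dom_def mem_I)
  show False
  proof (cases "y < 1")
    case True
    then have "l1 < x" "l2 \<le> x'"
      using z sum y gold_G_bounds by (auto simp: open_dom_def)
    then have "\<alpha> * l1 < \<alpha> * x" "(2 - \<alpha>) * l2 \<le> (2 - \<alpha>) * x'"
      using \<alpha>_bounds by (auto intro!: mult_strict_left_mono mult_left_mono)
    then have "1 - \<alpha> < \<alpha> * x" "(2 - \<alpha>) * (- x') \<le> 1 - \<alpha>"
      using one_plus_l1 one_plus_l2 by (auto simp: algebra_simps)
    then have "(1 - \<alpha>) * e < \<alpha> * x * e" "(2 - \<alpha>) * (- x') * (e + 2) \<le> (1 - \<alpha>) * (e + 2)"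
      using e(1) by (intro mult_strict_right_mono mult_right_mono; simp)+
    then have "(1 - \<alpha>) * e < \<alpha>" "2 - \<alpha> \<le> (1 - \<alpha>) * (e + 2)"
      using e by (simp_all add: mult.assoc)
    then show False by (simp add: algebra_simps)
  next
    case False
    then have "l2 \<le> x" "l1 < x'"
      using z sum y gold_G_bounds by (auto simp: open_dom_def)
    then have "\<alpha> * l1 < \<alpha> * x'" "(2 - \<alpha>) * l2 \<le> (2 - \<alpha>) * x"
      using \<alpha>_bounds by (auto intro!: mult_strict_left_mono mult_left_mono)
    then have "\<alpha> - 1 \<le> (2 - \<alpha>) * x" "\<alpha> * (- x') < \<alpha> - 1"
      using one_plus_l1 one_plus_l2 by (auto simp: algebra_simps)
    then have "(\<alpha> - 1) * e \<le> (2 - \<alpha>) * x * e" "\<alpha> * (- x') * (e + 2) < (\<alpha> - 1) * (e + 2)"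
      using e(1) by (intro mult_strict_right_mono mult_right_mono; simp)+
    then have "(\<alpha> - 1) * e \<le> 2 - \<alpha>" "\<alpha> < (\<alpha> - 1) * (e + 2)"
      using e by (simp_all add: mult.assoc)
    then show False by (simp add: algebra_simps)
  qed
qed

text \<open>Equal images give equal d + sgn x * y. For equal signs the partial quotients then differ
  by less than G < 2, and being odd they coincide; opposite signs are excluded by
  \<open>Phi_opposite_signs\<close>.\<close>

lemma Phi_inj_digit:
  fixes x y x' y' :: real
  assumes z: "(x, y) \<in> open_dom" "(x', y') \<in> open_dom" and x: "x \<noteq> 0" "x' \<noteq> 0"
    and eq: "\<Phi> (x, y) = \<Phi> (x', y')"
  shows "digit x = digit x'"
proof -
  have zc: "(x, y) \<in> closed_dom" "(x', y') \<in> closed_dom"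
    using z open_subset_closed by auto
  note pos = Phi_closed_dom(2)[OF zc(1) x(1)] Phi_closed_dom(2)[OF zc(2) x(2)]
  have eq1: "\<phi> x = \<phi> x'" and eq2: "ocf_d \<alpha> x + sgn x * y = ocf_d \<alpha> x' + sgn x' * y'"
    using eq x pos by (auto simp: ocf_Phi_def)
  have y: "0 < y" "y < G" "0 < y'" "y' < G"
    using open_dom_y[OF z(1)] open_dom_y[OF z(2)] by auto
  have ev: "even (ocf_d \<alpha> x - ocf_d \<alpha> x')" using odd_ocf_d by simp
  consider "0 < x" "0 < x'" | "x < 0" "x' < 0" | "0 < x" "x' < 0" | "x < 0" "0 < x'"
    using x by linarith
  then show ?thesis
  proof cases
    case 1
    then have "real_of_int (ocf_d \<alpha> x - ocf_d \<alpha> x') = y' - y" using eq2 by simp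
    then have "ocf_d \<alpha> x - ocf_d \<alpha> x' = 0" using y gold_G_bounds by (intro even_small[OF ev]) linarith
    then show ?thesis using 1 by (simp add: digit_def)
  next
    case 2
    then have "real_of_int (ocf_d \<alpha> x - ocf_d \<alpha> x') = y - y'" using eq2 by simp
    then have "ocf_d \<alpha> x - ocf_d \<alpha> x' = 0" using y gold_G_bounds by (intro even_small[OF ev]) linarith
    then show ?thesis using 2 by (simp add: digit_def)
  next
    case 3
    then show ?thesis using Phi_opposite_signs[OF z 3 eq1] eq2 by simp
  next
    case 4
    then show ?thesis using Phi_opposite_signs[OF z(2,1) 4(2,1) eq1[symmetric]] eq2 by simp
  qed
qed

lemma ocf_d_measurable[measurable]: "ocf_d \<alpha> \<in> borel \<rightarrow>\<^sub>M count_space UNIV"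
  unfolding ocf_d_def by measurable

lemma phi_measurable[measurable]: "\<phi> \<in> borel_measurable borel"
  unfolding ocf_phi_def by measurable

lemma digit_measurable[measurable]: "digit \<in> borel \<rightarrow>\<^sub>M count_space UNIV"
  unfolding digit_def by measurable

lemma Phi_measurable[measurable]: "\<Phi> \<in> borel \<rightarrow>\<^sub>M borel"
  unfolding borel_prod[symmetric] ocf_Phi_def by measurable

lemma open_dom_borel[measurable]: "open_dom \<in> sets borel"
proof -
  have "{z \<in> space borel. z \<in> open_dom} \<in> sets borel"
    unfolding open_dom_def mem_I case_prod_unfold mem_Collect_eq by measurable
  then show ?thesis by simp
qed

lemma closed_dom_borel[measurable]: "closed_dom \<in> sets borel"
proof -
  have "{z \<in> space borel. z \<in> closed_dom} \<in> sets borel"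
    unfolding closed_dom_def mem_I case_prod_unfold mem_Collect_eq by measurable
  then show ?thesis by simp
qed

definition mass :: real where "mass = 3 * ln G"

lemma mass_pos: "0 < mass"
  using gold_G_bounds by (simp add: mass_def)

definition dens :: "real \<times> real \<Rightarrow> real" where
  "dens z = 1 / (1 + fst z * snd z)\<^sup>2 / mass"

lemma dens_measurable[measurable]: "dens \<in> borel_measurable borel"
  unfolding borel_prod[symmetric] dens_def by measurable

lemma dens_nonneg: "0 \<le> dens z"
  using mass_pos by (simp add: dens_def)

text \<open>A measure on the whole plane, so that \<open>\<Phi>\<close> need not be restricted.\<close>

definition \<mu> :: "(real \<times> real) measure" where
  "\<mu> = density lborel (\<lambda>z. ennreal (dens z) * indicator open_dom z)"

lemma sets_\<mu>[measurable_cong, simp]: "sets \<mu> = sets borel"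
  and space_\<mu>[simp]: "space \<mu> = UNIV"
  by (auto simp: \<mu>_def)

lemma AE_generic: "AE z in lborel. z \<in> closed_dom \<longrightarrow> z \<in> open_dom"
proof -
  have "AE z in lborel. (z :: real \<times> real) \<notin> {z. fst z = l1}"
       "AE z in lborel. (z :: real \<times> real) \<notin> {z. snd z = 2 - G}"
       "AE z in lborel. (z :: real \<times> real) \<notin> {z. snd z = 1}"
       "AE z in lborel. (z :: real \<times> real) \<notin> {z. snd z = G}"
       "AE z in lborel. (z :: real \<times> real) \<notin> {z. snd z = 0}"
    by (rule AE_not_in, rule null_vertical_line, (rule AE_not_in, rule null_horizontal_line)+)
  then show ?thesis
    by eventually_elim (auto simp: closed_dom_def open_dom_def)
qed

text \<open>With (u, v) the image of (x, y), one has (1 + x y) (d + u) v = 1 + u v. After squaring,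
  the Jacobian 1 / ((d + u)^2 v^2) of the inverse branch carries the density (1 + x y)^-2 to (1 + u
  v)^-2. The two coordinates are substituted one after the other, with Tonelli in between.\<close>

lemma Phi_branch_integral:
  fixes A :: "(real \<times> real) set" and k :: int
  assumes A[measurable]: "A \<in> sets borel" and k: "k \<noteq> 0"
  defines "\<epsilon> \<equiv> real_of_int (sgn k)" and "d \<equiv> real_of_int \<bar>k\<bar>"
  shows "(\<integral>\<^sup>+z. ennreal (dens z) * indicator open_dom z * indicator A (\<Phi> z) * indicator {z. digit (fst z) = k} z \<partial>lborel)
    = (\<integral>\<^sup>+w. ennreal (dens w) * indicator A w *
        indicator {w. 0 < d + fst w \<and> 0 < snd w \<and> digit (\<epsilon> / (d + fst w)) = k \<and>
          (\<epsilon> / (d + fst w), \<epsilon> * (1 / snd w - d)) \<in> open_dom} w \<partial>lborel)"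
proof -
  have \<epsilon>: "\<epsilon> = 1 \<or> \<epsilon> = -1" using k by (auto simp: \<epsilon>_def sgn_if)
  have \<epsilon>2: "\<epsilon> * (\<epsilon> * t) = t" for t using \<epsilon> by auto
  define F where "F = (\<lambda>x y. ennreal (dens (x, y)) * indicator open_dom (x, y) * indicator A (\<Phi> (x, y)) * indicator {z. digit (fst z) = k} (x, y))"
  have F[measurable]: "case_prod F \<in> borel_measurable (borel \<Otimes>\<^sub>M borel)"
  proof -
    have "(\<lambda>z. ennreal (dens z) * indicator open_dom z * indicator A (\<Phi> z) * indicator {z. digit (fst z) = k} z) \<in> borel_measurable (borel :: (real \<times> real) measure)"
      by measurable
    then show ?thesis unfolding F_def borel_prod by (simp add: case_prod_unfold)
  qed
  have F'[measurable]: "(\<lambda>x. F x y) \<in> borel_measurable borel" "F x \<in> borel_measurable borel" for x y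
  proof -
    have "(\<lambda>x. case_prod F (x, y)) \<in> borel_measurable borel" "(\<lambda>y. case_prod F (x, y)) \<in> borel_measurable borel"
      by (rule measurable_compose[OF _ F], simp)+
    then show "(\<lambda>x. F x y) \<in> borel_measurable borel" "F x \<in> borel_measurable borel" by simp_all
  qed
  have sgn_x: "sgn x = \<epsilon>" "0 < \<epsilon> * x" "d = ocf_d \<alpha> x" "x \<noteq> 0" if "digit x = k" "x \<in> I" for x
  proof -
    have x0: "x \<noteq> 0" using that k by (auto simp: digit_def)
    then have "1 \<le> ocf_d \<alpha> x" using ocf_d_ge_1 that by auto
    then show "sgn x = \<epsilon>" "0 < \<epsilon> * x" "d = ocf_d \<alpha> x" "x \<noteq> 0"
      using that x0 by (auto simp: digit_def \<epsilon>_def d_def split: if_splits)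
  qed
  have F0: "F x y = F x y * indicator {0<..} (\<epsilon> * x)" "F x y = F x y * indicator {0<..} (d + \<epsilon> * y)" for x y
  proof -
    have "digit x = k \<and> (x, y) \<in> open_dom \<Longrightarrow> 0 < \<epsilon> * x \<and> 0 < d + \<epsilon> * y"
      using sgn_x[of x] Phi_closed_dom(2)[of x y] open_subset_closed by (auto simp: open_dom_def)
    then show "F x y = F x y * indicator {0<..} (\<epsilon> * x)" "F x y = F x y * indicator {0<..} (d + \<epsilon> * y)"
      by (auto simp: F_def indicator_def)
  qed
  have "(\<integral>\<^sup>+z. ennreal (dens z) * indicator open_dom z * indicator A (\<Phi> z) * indicator {z. digit (fst z) = k} z \<partial>lborel)
      = (\<integral>\<^sup>+z. case_prod F z \<partial>(lborel \<Otimes>\<^sub>M lborel))"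
    by (simp add: lborel_prod F_def case_prod_unfold)
  also have "\<dots> = (\<integral>\<^sup>+y. \<integral>\<^sup>+x. F x y \<partial>lborel \<partial>lborel)"
    by (subst lborel_pair.nn_integral_snd[symmetric]) (simp_all add: measurable_lborel1)
  also have "\<dots> = (\<integral>\<^sup>+y. \<integral>\<^sup>+u. F (\<epsilon> / (d + u)) y * ennreal (1 / (d + u)\<^sup>2) * indicator {0<..} (d + u) \<partial>lborel \<partial>lborel)"
    by (subst F0(1)) (simp add: nn_integral_inverse_shift(1)[OF _ \<epsilon>, of _ d])
  also have "\<dots> = (\<integral>\<^sup>+u. \<integral>\<^sup>+y. F (\<epsilon> / (d + u)) y * ennreal (1 / (d + u)\<^sup>2) * indicator {0<..} (d + u) \<partial>lborel \<partial>lborel)"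
    by (rule lborel_pair.Fubini') measurable
  also have "\<dots> = (\<integral>\<^sup>+u. \<integral>\<^sup>+y. (F (\<epsilon> / (d + u)) y * ennreal (1 / (d + u)\<^sup>2) * indicator {0<..} (d + u)) * indicator {0<..} (d + \<epsilon> * y) \<partial>lborel \<partial>lborel)"
    by (subst F0(2)) (simp add: mult_ac)
  also have "\<dots> = (\<integral>\<^sup>+u. \<integral>\<^sup>+v. (F (\<epsilon> / (d + u)) (\<epsilon> * (1 / v - d)) * ennreal (1 / (d + u)\<^sup>2) * indicator {0<..} (d + u)) * ennreal (1 / v\<^sup>2) * indicator {0<..} v \<partial>lborel \<partial>lborel)"
    by (subst nn_integral_inverse_shift(2)[OF _ \<epsilon>, of _ d]) simp_all
  also have "\<dots> = (\<integral>\<^sup>+u. \<integral>\<^sup>+v. ennreal (dens (u, v)) * indicator A (u, v) *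
        indicator {w. 0 < d + fst w \<and> 0 < snd w \<and> digit (\<epsilon> / (d + fst w)) = k \<and>
          (\<epsilon> / (d + fst w), \<epsilon> * (1 / snd w - d)) \<in> open_dom} (u, v) \<partial>lborel \<partial>lborel)"
  proof (intro nn_integral_cong)
    fix u v :: real
    let ?x = "\<epsilon> / (d + u)" and ?y = "\<epsilon> * (1 / v - d)"
    show "(F ?x ?y * ennreal (1 / (d + u)\<^sup>2) * indicator {0<..} (d + u)) * ennreal (1 / v\<^sup>2) * indicator {0<..} v
      = ennreal (dens (u, v)) * indicator A (u, v) *
        indicator {w. 0 < d + fst w \<and> 0 < snd w \<and> digit (\<epsilon> / (d + fst w)) = k \<and>
          (\<epsilon> / (d + fst w), \<epsilon> * (1 / snd w - d)) \<in> open_dom} (u, v)"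
    proof (cases "0 < d + u \<and> 0 < v \<and> digit ?x = k \<and> (?x, ?y) \<in> open_dom")
      case True
      then have pos: "0 < d + u" "0 < v" and dig: "digit ?x = k" and dom: "(?x, ?y) \<in> open_dom" by auto
      then have "?x \<in> I" by (auto simp: open_dom_def)
      note sx = sgn_x[OF dig this]
      have "\<bar>?x\<bar> = 1 / (d + u)" using pos \<epsilon> by auto
      then have phi: "\<phi> ?x = u" using sx pos by (simp add: phi_eq)
      have "d + \<epsilon> * ?y = 1 / v" by (simp add: \<epsilon>2)
      then have Phi: "\<Phi> (?x, ?y) = (u, v)" using sx phi by (simp add: ocf_Phi_def)
      have "(1 + ?x * ?y) * ((d + u) * v) = 1 + u * v"
      proof -
        have "?x * ?y = (1 / v - d) / (d + u)" using \<epsilon> by auto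
        then have "(1 + ?x * ?y) * ((d + u) * v) = (1 + (1 / v - d) / (d + u)) * ((d + u) * v)" by (simp only:)
        also have "\<dots> = (d + u) * v + (1 / v - d) / (d + u) * (d + u) * v" by (simp only: distrib_right mult_1 mult.assoc)
        also have "\<dots> = (d + u) * v + (1 / v - d) * v" using pos by simp
        also have "\<dots> = 1 + u * v" using pos by (simp add: algebra_simps)
        finally show ?thesis .
      qed
      then have "dens (?x, ?y) * (1 / (d + u)\<^sup>2) * (1 / v\<^sup>2) = dens (u, v)"
        using pos by (simp add: dens_def power_mult_distrib[symmetric] mult_ac)
      then show ?thesis
        using True Phi dens_nonneg by (simp add: F_def ennreal_mult[symmetric] mult_ac)
    qed (auto simp: F_def indicator_def)
  qed
  also have "\<dots> = (\<integral>\<^sup>+w. ennreal (dens w) * indicator A w *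
        indicator {w. 0 < d + fst w \<and> 0 < snd w \<and> digit (\<epsilon> / (d + fst w)) = k \<and>
          (\<epsilon> / (d + fst w), \<epsilon> * (1 / snd w - d)) \<in> open_dom} w \<partial>(lborel \<Otimes>\<^sub>M lborel))"
  proof (rule lborel.nn_integral_fst)
    have "(\<lambda>w. (\<epsilon> / (d + fst w), \<epsilon> * (1 / snd w - d))) \<in> borel \<rightarrow>\<^sub>M (borel :: (real \<times> real) measure)"
      unfolding borel_prod[symmetric] by measurable
    from measurable_sets[OF this open_dom_borel] 
    have [measurable]: "{w. (\<epsilon> / (d + fst w), \<epsilon> * (1 / snd w - d)) \<in> open_dom} \<in> sets borel"
      by (simp add: vimage_def)
    have "(\<lambda>w. ennreal (dens w) * indicator A w *
        indicator ({w. 0 < d + fst w \<and> 0 < snd w \<and> digit (\<epsilon> / (d + fst w)) = k} \<inter>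
          {w. (\<epsilon> / (d + fst w), \<epsilon> * (1 / snd w - d)) \<in> open_dom}) w) \<in> borel_measurable borel"
      by measurable
    then show "(\<lambda>w. ennreal (dens w) * indicator A w *
        indicator {w. 0 < d + fst w \<and> 0 < snd w \<and> digit (\<epsilon> / (d + fst w)) = k \<and>
          (\<epsilon> / (d + fst w), \<epsilon> * (1 / snd w - d)) \<in> open_dom} w) \<in> borel_measurable (lborel \<Otimes>\<^sub>M lborel)"
      by (simp add: lborel_prod Int_def conj_assoc)
  qed
  finally show ?thesis by (simp only: lborel_prod)
qed

lemma emeasure_Phi_le:
  assumes A[measurable]: "A \<in> sets borel"
  shows "emeasure (distr \<mu> borel \<Phi>) A \<le> emeasure \<mu> A"
proof -
  \<comment> \<open>\<open>V k\<close> is the image under \<Phi> of the part of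
    \<open>open_dom\<close> with digit \<open>k\<close>, written through the inverse branch so that
    it is visibly Borel.\<close>
  define V where "V = (\<lambda>k :: int. {w :: real \<times> real. k \<noteq> 0 \<and> 0 < real_of_int \<bar>k\<bar> + fst w \<and> 0 < snd w \<and>
      digit (real_of_int (sgn k) / (real_of_int \<bar>k\<bar> + fst w)) = k \<and>
      (real_of_int (sgn k) / (real_of_int \<bar>k\<bar> + fst w), real_of_int (sgn k) * (1 / snd w - real_of_int \<bar>k\<bar>)) \<in> open_dom})"
  let ?f = "\<lambda>z. ennreal (dens z) * indicator open_dom z * indicator A (\<Phi> z)"
  have V_borel[measurable]: "V k \<in> sets borel" for k
  proof -
    have "(\<lambda>w. (real_of_int (sgn k) / (real_of_int \<bar>k\<bar> + fst w), real_of_int (sgn k) * (1 / snd w - real_of_int \<bar>k\<bar>)))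
        \<in> borel \<rightarrow>\<^sub>M (borel :: (real \<times> real) measure)"
      unfolding borel_prod[symmetric] by measurable
    from measurable_sets[OF this open_dom_borel]
    have [measurable]: "{w. (real_of_int (sgn k) / (real_of_int \<bar>k\<bar> + fst w), real_of_int (sgn k) * (1 / snd w - real_of_int \<bar>k\<bar>)) \<in> open_dom} \<in> sets borel"
      by (simp add: vimage_def)
    have "V k = {w. k \<noteq> 0 \<and> 0 < real_of_int \<bar>k\<bar> + fst w \<and> 0 < snd w \<and>
      digit (real_of_int (sgn k) / (real_of_int \<bar>k\<bar> + fst w)) = k} \<inter>
      {w. (real_of_int (sgn k) / (real_of_int \<bar>k\<bar> + fst w), real_of_int (sgn k) * (1 / snd w - real_of_int \<bar>k\<bar>)) \<in> open_dom}"
      by (auto simp: V_def)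
    also have "\<dots> \<in> sets borel" by measurable
    finally show ?thesis .
  qed
  have "\<Phi> -` A \<in> sets borel" using measurable_sets[OF Phi_measurable A] by simp
  moreover have "emeasure (distr \<mu> borel \<Phi>) A = emeasure \<mu> (\<Phi> -` A)"
    by (subst emeasure_distr) auto
  ultimately have "emeasure (distr \<mu> borel \<Phi>) A = (\<integral>\<^sup>+z. ?f z \<partial>lborel)"
    by (simp add: \<mu>_def emeasure_density indicator_def vimage_def)
  also have "\<dots> = (\<integral>\<^sup>+z. \<integral>\<^sup>+k. ?f z * indicator {z. digit (fst z) = k} z \<partial>count_space UNIV \<partial>lborel)"
  proof (rule nn_integral_cong)
    fix z :: "real \<times> real"
    have "(\<integral>\<^sup>+k. ?f z * indicator {z. digit (fst z) = k} z \<partial>count_space UNIV) = (\<integral>\<^sup>+k. ?f z * indicator {digit (fst z)} k \<partial>count_space UNIV)"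
      by (rule nn_integral_cong) (auto simp: indicator_def)
    also have "\<dots> = ?f z" by (subst nn_integral_indicator_singleton) auto
    finally show "?f z = (\<integral>\<^sup>+k. ?f z * indicator {z. digit (fst z) = k} z \<partial>count_space UNIV)" by simp
  qed
  also have "\<dots> = (\<integral>\<^sup>+k. \<integral>\<^sup>+z. ?f z * indicator {z. digit (fst z) = k} z \<partial>lborel \<partial>count_space UNIV)"
    by (rule nn_integral_int_swap) measurable
  also have "\<dots> = (\<integral>\<^sup>+k. \<integral>\<^sup>+w. ennreal (dens w) * indicator A w * indicator (V k) w \<partial>lborel \<partial>count_space UNIV)"
  proof (rule nn_integral_cong)
    fix k :: int
    show "(\<integral>\<^sup>+z. ?f z * indicator {z. digit (fst z) = k} z \<partial>lborel) = (\<integral>\<^sup>+w. ennreal (dens w) * indicator A w * indicator (V k) w \<partial>lborel)"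
    proof (cases "k = 0")
      case True
      have "AE z in lborel. (z :: real \<times> real) \<notin> {z. fst z = 0}"
        by (rule AE_not_in[OF null_vertical_line])
      then have "AE z in lborel. ?f z * indicator {z. digit (fst z) = k} z = 0"
      proof eventually_elim
        case (elim z)
        have "(fst z, snd z) \<in> open_dom \<Longrightarrow> digit (fst z) \<noteq> 0"
          using ocf_d_ge_1[of "fst z"] elim by (auto simp: digit_def open_dom_def)
        then show ?case using True by (auto simp: indicator_def)
      qed
      then have "(\<integral>\<^sup>+z. ?f z * indicator {z. digit (fst z) = k} z \<partial>lborel) = 0"
        by (subst nn_integral_0_iff_AE) auto
      then show ?thesis using True by (simp add: V_def)
    next
      case False
      then show ?thesis
        unfolding Phi_branch_integral[OF A False] by (simp add: V_def)
    qed
  qed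
  also have "\<dots> = (\<integral>\<^sup>+w. \<integral>\<^sup>+k. ennreal (dens w) * indicator A w * indicator (V k) w \<partial>count_space UNIV \<partial>lborel)"
    by (rule nn_integral_int_swap[symmetric]) measurable
  also have "\<dots> \<le> (\<integral>\<^sup>+w. ennreal (dens w) * indicator A w * indicator open_dom w \<partial>lborel)"
  proof (rule nn_integral_mono_AE)
    show "AE w in lborel. (\<integral>\<^sup>+k. ennreal (dens w) * indicator A w * indicator (V k) w \<partial>count_space UNIV)
       \<le> ennreal (dens w) * indicator A w * indicator open_dom w"
      using AE_generic
    proof eventually_elim
      case (elim w)
      have key: "\<exists>z\<in>open_dom. fst z \<noteq> 0 \<and> digit (fst z) = k \<and> \<Phi> z = w" if "w \<in> V k" for k
      proof -
        define \<epsilon> d where "\<epsilon> = real_of_int (sgn k)" and "d = real_of_int \<bar>k\<bar>"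
        define x y where "x = \<epsilon> / (d + fst w)" and "y = \<epsilon> * (1 / snd w - d)"
        have pos: "k \<noteq> 0" "0 < d + fst w" "0 < snd w" and dig: "digit x = k" and dom: "(x, y) \<in> open_dom"
          using that by (auto simp: V_def \<epsilon>_def d_def x_def y_def)
        have \<epsilon>: "\<epsilon> = 1 \<or> \<epsilon> = -1" using pos by (auto simp: \<epsilon>_def sgn_if)
        have x0: "x \<noteq> 0" using pos \<epsilon> by (auto simp: x_def)
        have "x \<in> I" using dom by (auto simp: open_dom_def)
        then have "1 \<le> ocf_d \<alpha> x" using ocf_d_ge_1 x0 by auto
        then have sx: "sgn x = \<epsilon>" "ocf_d \<alpha> x = d"
          using dig x0 by (auto simp: digit_def \<epsilon>_def d_def split: if_splits)
        have "\<bar>x\<bar> = 1 / (d + fst w)" using pos \<epsilon> by (auto simp: x_def)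
        then have "\<phi> x = fst w" using sx pos x0 by (simp add: phi_eq)
        moreover have "d + \<epsilon> * y = 1 / snd w" using \<epsilon> by (auto simp: y_def)
        ultimately have "\<Phi> (x, y) = w" using sx x0 by (simp add: ocf_Phi_def prod_eq_iff)
        then show ?thesis using dom dig x0 by (intro bexI[of _ "(x, y)"]) auto
      qed
      show ?case
      proof (cases "\<exists>k. w \<in> V k")
        case True
        then obtain k where k: "w \<in> V k" by auto
        then obtain z where z: "z \<in> open_dom" "fst z \<noteq> 0" "digit (fst z) = k" "\<Phi> z = w" using key by blast
        then have "w \<in> open_dom" using elim Phi_closed_dom' open_subset_closed by blast
        moreover have uniq: "k' = k" if k': "w \<in> V k'" for k'
        proof -
          obtain z' where "z' \<in> open_dom" "fst z' \<noteq> 0" "digit (fst z') = k'" "\<Phi> z' = w"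
            using key[OF k'] by blast
          then show ?thesis
            using Phi_inj_digit[of "fst z" "snd z" "fst z'" "snd z'"] z by simp
        qed
        have ind: "indicator (V k') w = (indicator {k} k' :: ennreal)" for k'
          using uniq[of k'] k by (cases "k' = k") (auto simp: indicator_def)
        have "(\<integral>\<^sup>+k. ennreal (dens w) * indicator A w * indicator (V k) w \<partial>count_space UNIV)
          = ennreal (dens w) * indicator A w"
          unfolding ind by (subst nn_integral_indicator_singleton) auto
        ultimately show ?thesis by simp
      next
        case False
        then show ?thesis by simp
      qed
    qed
  qed
  also have "\<dots> = emeasure \<mu> A"
    by (simp add: \<mu>_def emeasure_density mult_ac)
  finally show ?thesis .
qed

end

section \<open>The dilogarithm\<close>

definition Li2 :: "real \<Rightarrow> real" where
  "Li2 u = (\<Sum>n. 1 / (real n + 1)\<^sup>2 * u ^ Suc n)"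

lemma Li2_0: "Li2 0 = 0"
  by (simp add: Li2_def)

lemma Li2_1: "Li2 1 = pi\<^sup>2 / 6"
  using inverse_squares_sums by (simp add: Li2_def sums_unique[symmetric] add.commute)

lemma continuous_on_Li2: "continuous_on {0..1} Li2"
proof -
  have "uniformly_convergent_on {0..1} (\<lambda>N u. \<Sum>n<N. 1 / (real n + 1)\<^sup>2 * u ^ Suc n)"
  proof (rule Weierstrass_m_test'[of _ _ "\<lambda>n. 1 / (real n + 1)\<^sup>2"])
    fix n and u :: real assume u: "u \<in> {0..1}"
    then have "u ^ Suc n \<le> 1" by (intro power_le_one) auto
    then show "norm (1 / (real n + 1)\<^sup>2 * u ^ Suc n) \<le> 1 / (real n + 1)\<^sup>2"
      using u by (simp add: divide_right_mono)
  next
    show "summable (\<lambda>n. 1 / (real n + 1)\<^sup>2)"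
      using sums_summable[OF inverse_squares_sums] by (simp add: add.commute)
  qed
  then have "uniform_limit {0..1} (\<lambda>N u. \<Sum>n<N. 1 / (real n + 1)\<^sup>2 * u ^ Suc n) Li2 sequentially"
    unfolding uniformly_convergent_uniform_limit_iff
    by (rule uniform_limit_cong'[THEN iffD1, rotated 2])
       (auto simp: Li2_def suminf_eq_lim)
  then show ?thesis
    by (rule uniform_limit_theorem[rotated]) (auto intro!: always_eventually continuous_intros)
qed

lemma DERIV_Li2:
  assumes u: "0 < u" "u < 1"
  shows "(Li2 has_real_derivative - ln (1 - u) / u) (at u)"
proof -
  have coeff: "1 / (real n + 1)\<^sup>2 * real (Suc n) = 1 / (real n + 1)" for n
  proof -
    have "1 / m\<^sup>2 * m = 1 / m" if "m \<noteq> 0" for m :: real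
      using that by (simp add: power2_eq_square)
    from this[of "real (Suc n)"] show ?thesis by (simp add: add.commute)
  qed
  have sm: "summable (\<lambda>n. 1 / (real n + 1)\<^sup>2 * real (Suc n) * x ^ n)" if "x \<in> {-1<..<1}" for x :: real
  proof (rule summable_comparison_test'[of "\<lambda>n. \<bar>x\<bar> ^ n" 0])
    show "summable (\<lambda>n. \<bar>x\<bar> ^ n)" using that by (intro summable_geometric) auto
    fix n :: nat
    have "1 / (real n + 1) * \<bar>x\<bar> ^ n \<le> 1 * \<bar>x\<bar> ^ n"
      by (intro mult_right_mono) auto
    then show "norm (1 / (real n + 1)\<^sup>2 * real (Suc n) * x ^ n) \<le> \<bar>x\<bar> ^ n"
      unfolding coeff by (simp add: abs_mult power_abs)
  qed
  have "DERIV Li2 u :> (\<Sum>n. 1 / (real n + 1)\<^sup>2 * real (Suc n) * u ^ n)"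
    unfolding Li2_def[abs_def] by (rule DERIV_power_series'[OF sm, where R = 1]) (use u in auto)
  also have "(\<Sum>n. 1 / (real n + 1)\<^sup>2 * real (Suc n) * u ^ n) = - ln (1 - u) / u"
  proof -
    have "ln (1 - u) = (\<Sum>n. (- 1) ^ n * (1 / real (n + 1)) * ((1 - u) - 1) ^ Suc n)"
      by (rule ln_series) (use u in auto)
    also have "\<dots> = (\<Sum>n. (- u) * (1 / (real n + 1)\<^sup>2 * real (Suc n) * u ^ n))"
    proof (rule suminf_cong)
      fix n
      have "(- 1 :: real) ^ n * (- u) ^ n = u ^ n" by (simp flip: power_mult_distrib)
      then show "(- 1) ^ n * (1 / real (n + 1)) * ((1 - u) - 1) ^ Suc n = (- u) * (1 / (real n + 1)\<^sup>2 * real (Suc n) * u ^ n)"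
        unfolding coeff by (simp add: field_simps)
    qed
    also have "\<dots> = (- u) * (\<Sum>n. 1 / (real n + 1)\<^sup>2 * real (Suc n) * u ^ n)"
      by (rule suminf_mult) (use sm u in auto)
    finally show ?thesis using u by (simp add: field_simps)
  qed
  finally show ?thesis .
qed

text \<open>The integral of this function over [0, t] is - Li2(- t) for t > 0; the series
  \<open>Li2\<close> itself converges only for arguments of modulus at most 1.\<close>

definition ln_quot :: "real \<Rightarrow> real" where
  "ln_quot s = (if s = 0 then 1 else ln (1 + s) / s)"

lemma continuous_on_ln_quot: "continuous_on {0..} ln_quot"
proof (rule continuous_at_imp_continuous_on, rule ballI)
  fix s :: real assume s: "s \<in> {0..}"
  show "isCont ln_quot s"
  proof (cases "s = 0")
    case True
    have "((\<lambda>s :: real. ln (1 + s) / s) \<longlongrightarrow> 1) (at 0)" by real_asymp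
    then have "(ln_quot \<longlongrightarrow> 1) (at 0)"
      by (rule Lim_transform_eventually) (auto simp: eventually_at_filter ln_quot_def)
    then show ?thesis using True by (simp add: isCont_def ln_quot_def)
  next
    case False
    have "isCont (\<lambda>s. ln (1 + s) / s) s" using s False by (intro continuous_intros) auto
    moreover have "\<forall>\<^sub>F t in nhds s. ln_quot t = ln (1 + t) / t"
      using t1_space_nhds[OF False] by eventually_elim (simp add: ln_quot_def)
    ultimately show ?thesis by (subst isCont_cong)
  qed
qed

text \<open>A primitive of - ln |t| / (1 + t): an elementary term plus - Li2(- t), the latter
  continued to t > 0 by an integral. It is studied on [-1, 3], which contains all products b x that
  occur, as G * G = G + 1 < 3.\<close>

definition dilog_prim :: "real \<Rightarrow> real" where
  "dilog_prim t = - (ln \<bar>t\<bar> * ln (1 + t)) + (if t \<le> 0 then - Li2 (- t) else integral {0..t} ln_quot)"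

text \<open>At 0 and at -1 one factor is unbounded nearby and the other tends to 0. The limit 0 is
  also the value there, since the second factor vanishes at the point.\<close>

lemma continuous_on_lnln: "continuous_on {- 1..} (\<lambda>t :: real. ln \<bar>t\<bar> * ln (1 + t))"
proof (unfold continuous_on_def, rule ballI)
  fix t :: real assume "t \<in> {- 1..}"
  then consider "t = - 1" | "t = 0" | "- 1 < t" "t \<noteq> 0" by fastforce
  then show "((\<lambda>t. ln \<bar>t\<bar> * ln (1 + t)) \<longlongrightarrow> ln \<bar>t\<bar> * ln (1 + t)) (at t within {- 1..})"
  proof cases
    case 1
    have "((\<lambda>t :: real. ln (- t) * ln (1 + t)) \<longlongrightarrow> 0) (at_right (- 1))" by real_asymp
    then have "((\<lambda>t :: real. ln \<bar>t\<bar> * ln (1 + t)) \<longlongrightarrow> 0) (at_right (- 1))"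
    proof (rule Lim_transform_eventually)
      have "\<forall>\<^sub>F t in at_right (- 1 :: real). t < 0"
        by (rule eventually_at_rightI[of _ 0]) auto
      then show "\<forall>\<^sub>F t in at_right (- 1 :: real). ln (- t) * ln (1 + t) = ln \<bar>t\<bar> * ln (1 + t)"
        by eventually_elim simp
    qed
    then show ?thesis using 1 by (simp add: at_within_Ici_at_right)
  next
    case 2
    have "((\<lambda>t :: real. ln \<bar>t\<bar> * ln (1 + t)) \<longlongrightarrow> 0) (at 0)" by real_asymp
    then show ?thesis using 2 by (auto intro: tendsto_within_subset)
  next
    case 3
    then show ?thesis by (intro tendsto_intros) auto
  qed
qed

lemma continuous_on_dilog_prim: "continuous_on {- 1..3} dilog_prim"
proof -
  have "continuous_on {0..3} ln_quot"
    by (rule continuous_on_subset[OF continuous_on_ln_quot]) auto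
  then have "continuous_on {0..3} (\<lambda>t. integral {0..t} ln_quot)"
    by (intro indefinite_integral_continuous_1 integrable_continuous_real)
  moreover have "continuous_on {- 1..0} (\<lambda>t. - Li2 (- t))"
    by (intro continuous_intros continuous_on_compose2[OF continuous_on_Li2]) auto
  ultimately have "continuous_on ({- 1..0} \<union> {0..3}) (\<lambda>t. if t \<le> 0 then - Li2 (- t) else integral {0..t} ln_quot)"
    by (intro continuous_on_cases) (auto simp: Li2_0)
  moreover have "{- 1..0} \<union> {0..3} = {- 1..3 :: real}" by auto
  moreover have "continuous_on {- 1..3} (\<lambda>t :: real. ln \<bar>t\<bar> * ln (1 + t))"
    by (rule continuous_on_subset[OF continuous_on_lnln]) auto
  ultimately show ?thesis
    unfolding dilog_prim_def by (intro continuous_on_add continuous_on_minus) simp_all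
qed

lemma DERIV_dilog_prim:
  assumes t: "- 1 < t" "t < 3" "t \<noteq> 0"
  shows "(dilog_prim has_real_derivative - ln \<bar>t\<bar> / (1 + t)) (at t)"
proof -
  have dln: "((\<lambda>t. ln \<bar>t\<bar>) has_real_derivative 1 / t) (at t)"
  proof (cases "0 < t")
    case True
    have "(ln has_real_derivative 1 / t) (at t)" using True by (auto intro!: derivative_eq_intros)
    moreover have "\<forall>\<^sub>F s in nhds t. ln \<bar>s\<bar> = ln s"
      using eventually_nhds_in_open[of "{0<..}" t] True by (auto elim: eventually_mono)
    ultimately show ?thesis by (subst DERIV_cong_ev[OF refl _ refl])
  next
    case False
    then have "t < 0" using t by simp
    have "((\<lambda>s. ln (- s)) has_real_derivative 1 / t) (at t)" using \<open>t < 0\<close> by (auto intro!: derivative_eq_intros)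
    moreover have "\<forall>\<^sub>F s in nhds t. ln \<bar>s\<bar> = ln (- s)"
      using eventually_nhds_in_open[of "{..<0}" t] \<open>t < 0\<close> by (auto elim: eventually_mono)
    ultimately show ?thesis by (subst DERIV_cong_ev[OF refl _ refl])
  qed
  have 1: "((\<lambda>t. - (ln \<bar>t\<bar> * ln (1 + t))) has_real_derivative - (ln (1 + t) / t + ln \<bar>t\<bar> / (1 + t))) (at t)"
  proof (rule DERIV_cong)
    show "((\<lambda>t. - (ln \<bar>t\<bar> * ln (1 + t))) has_real_derivative - (1 / t * ln (1 + t) + 1 / (1 + t) * ln \<bar>t\<bar>)) (at t)"
      by (intro DERIV_minus DERIV_mult dln) (use t in \<open>auto intro!: derivative_eq_intros\<close>)
  qed simp
  have 2: "((\<lambda>t. if t \<le> 0 then - Li2 (- t) else integral {0..t} ln_quot) has_real_derivative ln (1 + t) / t) (at t)"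
  proof (cases "0 < t")
    case True
    have "continuous_on {0..3} ln_quot"
      by (rule continuous_on_subset[OF continuous_on_ln_quot]) auto
    then have "((\<lambda>s. integral {0..s} ln_quot) has_real_derivative ln_quot t) (at t within {0..3})"
      by (rule integral_has_real_derivative) (use True t in auto)
    moreover have "at t within {0..3} = at t"
      by (rule at_within_interior) (use True t in auto)
    ultimately have "((\<lambda>s. integral {0..s} ln_quot) has_real_derivative ln (1 + t) / t) (at t)"
      using True by (simp add: ln_quot_def)
    moreover have "\<forall>\<^sub>F s in nhds t. (if s \<le> 0 then - Li2 (- s) else integral {0..s} ln_quot) = integral {0..s} ln_quot"
      using eventually_nhds_in_open[of "{0<..}" t] True by (auto elim!: eventually_mono)
    ultimately show ?thesis by (subst DERIV_cong_ev[OF refl _ refl])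
  next
    case False
    then have "t < 0" using t by simp
    have "(Li2 has_real_derivative - ln (1 - (- t)) / (- t)) (at (- t))"
      by (rule DERIV_Li2) (use t \<open>t < 0\<close> in auto)
    then have "((\<lambda>s. - Li2 (- s)) has_real_derivative ln (1 + t) / t) (at t)"
      using t by (auto intro!: derivative_eq_intros DERIV_chain2[where f = Li2])
    moreover have "\<forall>\<^sub>F s in nhds t. (if s \<le> 0 then - Li2 (- s) else integral {0..s} ln_quot) = - Li2 (- s)"
      using eventually_nhds_in_open[of "{..<0}" t] \<open>t < 0\<close> by (auto elim!: eventually_mono)
    ultimately show ?thesis by (subst DERIV_cong_ev[OF refl _ refl])
  qed
  show ?thesis
    unfolding dilog_prim_def using DERIV_add[OF 1 2] by simp
qed

text \<open>
  The substitution \<open>t \<mapsto> - 1 / (1 + t)\<close> turns the two halves of the integral into each other up to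
  elementary terms, which cancel at the golden ratio.
\<close>

lemma dilog_prim_golden: "dilog_prim gold_G - dilog_prim (gold_G - 2) = pi\<^sup>2 / 6"
proof -
  define E where "E = (\<lambda>z. dilog_prim z - dilog_prim (- 1 / (1 + z)) + ln \<bar>z\<bar> * ln (1 + z) - (ln (1 + z))\<^sup>2 / 2)"
  have Gpos: "0 < gold_G" "gold_G < 3" using gold_G_bounds by auto
  have "E gold_G = E 0"
  proof (rule DERIV_isconst_end[OF Gpos(1)])
    have "- 1 \<le> - 1 / (1 + z)" "- 1 / (1 + z) \<le> 3" if "0 \<le> z" for z :: real
    proof -
      have "1 / (1 + z) \<le> 1" "0 \<le> 1 / (1 + z)" using that by auto
      moreover have "- 1 / (1 + z) = - (1 / (1 + z))" by simp
      ultimately show "- 1 \<le> - 1 / (1 + z)" "- 1 / (1 + z) \<le> 3" by linarith+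
    qed
    then show "continuous_on {0..gold_G} E"
      unfolding E_def using Gpos
      by (intro continuous_intros continuous_on_compose2[OF continuous_on_dilog_prim]
            continuous_on_subset[OF continuous_on_lnln]) auto
    fix z assume z: "0 < z" "z < gold_G"
    define w where "w = 1 / (1 + z)"
    have w: "0 < w" "w < 1" "1 - w = z * w" "ln w = - ln (1 + z)" "(1 + z) * w = 1"
      using z by (auto simp: w_def field_simps ln_div)
    have dQ: "((\<lambda>z. dilog_prim (- 1 / (1 + z))) has_real_derivative (- ln \<bar>- w\<bar> / (1 + - w)) * w\<^sup>2) (at z)"
    proof (rule DERIV_chain2[where f = dilog_prim])
      show "(dilog_prim has_real_derivative - ln \<bar>- w\<bar> / (1 + - w)) (at (- 1 / (1 + z)))"
      proof -
        have "- 1 / (1 + z) = - w" by (simp add: w_def)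
        moreover have "(dilog_prim has_real_derivative - ln \<bar>- w\<bar> / (1 + - w)) (at (- w))"
          by (rule DERIV_dilog_prim) (use w(1,2) in auto)
        ultimately show ?thesis by (simp only:)
      qed
      show "((\<lambda>z. - 1 / (1 + z)) has_real_derivative w\<^sup>2) (at z)"
        using z by (auto intro!: derivative_eq_intros simp: w_def power2_eq_square field_simps)
    qed
    have "(- ln \<bar>- w\<bar> / (1 + - w)) * w\<^sup>2 = ln (1 + z) * w / z"
      using w z by (simp add: power2_eq_square)
    also have "\<dots> = ln (1 + z) / z - ln (1 + z) / (1 + z)"
      using z by (simp add: w_def field_simps)
    finally have eq: "(- ln \<bar>- w\<bar> / (1 + - w)) * w\<^sup>2 = ln (1 + z) / z - ln (1 + z) / (1 + z)" .
    have 1: "(dilog_prim has_real_derivative - ln z / (1 + z)) (at z)"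
      using DERIV_dilog_prim[of z] z Gpos by simp
    have 2: "((\<lambda>z. ln z * ln (1 + z)) has_real_derivative ln (1 + z) / z + ln z / (1 + z)) (at z)"
      using z by (auto intro!: derivative_eq_intros)
    have 3: "((\<lambda>z. (ln (1 + z))\<^sup>2 / 2) has_real_derivative ln (1 + z) / (1 + z)) (at z)"
      using z by (auto intro!: derivative_eq_intros simp: field_simps)
    have "((\<lambda>z. dilog_prim z - dilog_prim (- 1 / (1 + z)) + ln z * ln (1 + z) - (ln (1 + z))\<^sup>2 / 2)
       has_real_derivative - ln z / (1 + z) - (ln (1 + z) / z - ln (1 + z) / (1 + z)) + (ln (1 + z) / z + ln z / (1 + z)) - ln (1 + z) / (1 + z)) (at z)"
      by (intro DERIV_diff DERIV_add 1 2 3 dQ[unfolded eq])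
    then have "((\<lambda>z. dilog_prim z - dilog_prim (- 1 / (1 + z)) + ln z * ln (1 + z) - (ln (1 + z))\<^sup>2 / 2)
       has_real_derivative 0) (at z)"
      by simp
    moreover have "\<forall>\<^sub>F s in nhds z. E s = dilog_prim s - dilog_prim (- 1 / (1 + s)) + ln s * ln (1 + s) - (ln (1 + s))\<^sup>2 / 2"
      using eventually_nhds_in_open[of "{0<..}" z] z by (auto elim!: eventually_mono simp: E_def)
    ultimately show "(E has_real_derivative 0) (at z)" by (subst DERIV_cong_ev[OF refl _ refl])
  qed
  \<comment> \<open>At 0 only - \<open>dilog_prim (- 1)\<close>, which is \<open>Li2 1\<close>,
    survives.\<close>
  also have "E 0 = pi\<^sup>2 / 6"
    by (simp add: E_def dilog_prim_def Li2_0 Li2_1)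
  \<comment> \<open>As ln (1 + G) = 2 ln G, both elementary terms equal 2 (ln G)^2.\<close>
  also have "E gold_G = dilog_prim gold_G - dilog_prim (gold_G - 2)"
  proof -
    have "1 + gold_G = gold_G * gold_G" using gold_G_square by simp
    then have ln2: "ln (1 + gold_G) = 2 * ln gold_G" using Gpos by (simp add: ln_mult)
    have "- 1 / (1 + gold_G) = gold_G - 2"
      using gold_G_square Gpos by (simp add: field_simps)
    then show ?thesis using Gpos by (simp add: E_def ln2 power2_eq_square)
  qed
  finally show ?thesis .
qed

section \<open>The logarithmic integral over the domain\<close>

definition log_prim :: "real \<Rightarrow> real \<Rightarrow> real" where
  "log_prim b x = (if b = 0 then 0 else dilog_prim (b * x) + ln b * ln (1 + b * x))"

text \<open>b / (1 + b x) is the integral of (1 + x y)^-2 over 0 <= y <= b, so this primitive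
  measures a strip of height b. The substitution t = b x reduces it to
  \<open>dilog_prim\<close>.\<close>

lemma DERIV_log_prim:
  assumes "0 \<le> b" "x \<noteq> 0" "- 1 < b * x" "b * x < 3"
  shows "(log_prim b has_real_derivative - ln \<bar>x\<bar> * (b / (1 + b * x))) (at x)"
proof (cases "b = 0")
  case True
  then show ?thesis by (simp add: log_prim_def[abs_def])
next
  case False
  then have b: "0 < b" using assms by simp
  have 1: "((\<lambda>x. dilog_prim (b * x)) has_real_derivative (- ln \<bar>b * x\<bar> / (1 + b * x)) * b) (at x)"
    by (rule DERIV_chain2[where f = dilog_prim, OF DERIV_dilog_prim])
       (use assms b in \<open>auto intro!: derivative_eq_intros\<close>)
  have 2: "((\<lambda>x. ln b * ln (1 + b * x)) has_real_derivative ln b * (b / (1 + b * x))) (at x)"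
    using assms by (auto intro!: derivative_eq_intros)
  have "ln \<bar>b * x\<bar> = ln b + ln \<bar>x\<bar>"
    using b assms by (simp add: abs_mult ln_mult)
  then have eq: "(- ln \<bar>b * x\<bar> / (1 + b * x)) * b + ln b * (b / (1 + b * x)) = - ln \<bar>x\<bar> * (b / (1 + b * x))"
    by (simp add: algebra_simps add_divide_distrib diff_divide_distrib)
  show ?thesis
    using DERIV_add[OF 1 2] False unfolding eq by (simp add: log_prim_def[abs_def])
qed

lemma continuous_on_log_prim:
  assumes "0 \<le> b" "\<And>x. x \<in> S \<Longrightarrow> - 1 < b * x \<and> b * x < 3"
  shows "continuous_on S (log_prim b)"
proof (cases "b = 0")
  case False
  have "continuous_on S (\<lambda>x. dilog_prim (b * x) + ln b * ln (1 + b * x))"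
    using assms
    by (intro continuous_intros continuous_on_compose2[OF continuous_on_dilog_prim])
       (auto dest!: assms(2) intro: less_imp_le)
  then show ?thesis using False by (simp add: log_prim_def[abs_def])
qed (simp add: log_prim_def[abs_def])

text \<open>
  The integral of \<open>- ln \<bar>x\<bar>\<close> against the measure with density \<open>(1 + x y)\<^sup>-\<^sup>2\<close> on the domain with parameter
  \<open>a\<close>: each rectangle contributes the values of \<open>log_prim\<close> at its corners.
\<close>

definition log_mass :: "real \<Rightarrow> real" where
  "log_mass a = log_prim gold_G a - log_prim (2 - gold_G) (a - 2)
     - (log_prim 1 (1 / a - 1) - log_prim (2 - gold_G) (1 / a - 1))
     - (log_prim gold_G (1 / (2 - a) - 1) - log_prim 1 (1 / (2 - a) - 1))"

lemma log_mass_args: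
  assumes a: "gold_g \<le> a" "a \<le> gold_G"
  shows "- 1 < gold_G * a \<and> gold_G * a < 3"
    "- 1 < (2 - gold_G) * (a - 2) \<and> (2 - gold_G) * (a - 2) < 3"
    "- 1 < 1 / a - 1 \<and> 1 / a - 1 < 3"
    "- 1 < (2 - gold_G) * (1 / a - 1) \<and> (2 - gold_G) * (1 / a - 1) < 3"
    "- 1 < gold_G * (1 / (2 - a) - 1) \<and> gold_G * (1 / (2 - a) - 1) < 3"
    "- 1 < 1 / (2 - a) - 1 \<and> 1 / (2 - a) - 1 < 3"
proof -
  interpret odd_cf a using a by unfold_locales
  have "gold_G * a \<le> gold_G * gold_G" using a gold_G_bounds by (intro mult_left_mono) auto
  moreover have "0 < gold_G * a" using \<alpha>_bounds gold_G_bounds by simp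
  ultimately show "- 1 < gold_G * a \<and> gold_G * a < 3"
    using gold_G_square gold_G_bounds by - (intro conjI; linarith)
  have "(2 - gold_G) * (2 - a) \<le> (382 / 1000) * (1382 / 1000)"
    using \<alpha>_bounds gold_G_bounds by (intro mult_mono) auto
  moreover have "0 \<le> (2 - gold_G) * (2 - a)" using \<alpha>_bounds gold_G_bounds by simp
  moreover have "(2 - gold_G) * (a - 2) = - ((2 - gold_G) * (2 - a))" by (simp add: algebra_simps)
  ultimately show "- 1 < (2 - gold_G) * (a - 2) \<and> (2 - gold_G) * (a - 2) < 3" by - (intro conjI; linarith)
  have l1: "- 1 / 2 \<le> 1 / a - 1" "1 / a - 1 \<le> 1"
  proof -
    have "1 / 2 \<le> 1 / a" "1 / a \<le> 2" using \<alpha>_bounds by (simp_all add: divide_le_eq le_divide_eq)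
    then show "- 1 / 2 \<le> 1 / a - 1" "1 / a - 1 \<le> 1" by linarith+
  qed
  then show "- 1 < 1 / a - 1 \<and> 1 / a - 1 < 3" by - (intro conjI; linarith)
  have c: "0 < 2 - gold_G" "2 - gold_G < 1" using gold_G_bounds by auto
  define m where "m = (2 - gold_G) * (1 / a - 1)"
  have "\<bar>m\<bar> \<le> (2 - gold_G) * 1"
    unfolding abs_mult m_def using l1 c by (intro mult_mono) auto
  then have "m \<le> 2 - gold_G" "- m \<le> 2 - gold_G" by (simp_all add: abs_le_iff)
  then show "- 1 < (2 - gold_G) * (1 / a - 1) \<and> (2 - gold_G) * (1 / a - 1) < 3"
    unfolding m_def[symmetric] using c by - (intro conjI; linarith)
  have l2: "- 28 / 100 \<le> 1 / (2 - a) - 1" "1 / (2 - a) - 1 \<le> gold_G"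
  proof -
    have "72 / 100 \<le> 1 / (1382 / 1000 :: real)" by simp
    also have "\<dots> \<le> 1 / (2 - a)" using \<alpha>_bounds by (intro frac_le) auto
    finally show "- 28 / 100 \<le> 1 / (2 - a) - 1" by simp
    have "1 / (2 - a) \<le> 1 / (2 - gold_G)" using a gold_G_bounds by (intro frac_le) auto
    also have "\<dots> = 1 + gold_G" using gold_G_bounds gold_G_square by (simp add: field_simps)
    finally show "1 / (2 - a) - 1 \<le> gold_G" by simp
  qed
  have "gold_G * (1 / (2 - a) - 1) \<le> gold_G * gold_G"
    using l2 gold_G_bounds by (intro mult_left_mono) auto
  moreover have "gold_G * (28 / 100) \<le> (17 / 10) * (28 / 100)" using gold_G_bounds by simp
  moreover have "gold_G * (- 28 / 100) \<le> gold_G * (1 / (2 - a) - 1)"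
    using l2 gold_G_bounds by (intro mult_left_mono) auto
  ultimately show "- 1 < gold_G * (1 / (2 - a) - 1) \<and> gold_G * (1 / (2 - a) - 1) < 3"
    using gold_G_square gold_G_bounds by - (intro conjI; linarith)
  show "- 1 < 1 / (2 - a) - 1 \<and> 1 / (2 - a) - 1 < 3" using l2 gold_G_bounds by - (intro conjI; linarith)
qed

text \<open>
  All four boundary terms of the derivative carry the same factor \<open>1 / (a + g)\<close>, and the
  logarithms in front of it add up to 0.
\<close>

lemma DERIV_log_mass:
  assumes a: "gold_g < a" "a < gold_G" "a \<noteq> 1"
  shows "(log_mass has_real_derivative 0) (at a)"
proof -
  interpret odd_cf a using a by unfold_locales auto
  define c where "c = 2 - gold_G"
  define D where "D = 1 / (a + gold_G - 1)"
  have ab: "0 < a" "0 < 2 - a" "0 < a + gold_G - 1" using \<alpha>_bounds gold_G_bounds by auto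
  have c0: "0 < c" using gold_G_bounds by (simp add: c_def)
  note args = log_mass_args[of a, folded c_def]
  have args': "- 1 < gold_G * a" "- 1 < c * (a - 2)" "- 1 < c * (1 / a - 1)" "- 1 < gold_G * (1 / (2 - a) - 1)"
    using args a by auto
  have I1: "gold_G / (1 + gold_G * a) = D"
  proof -
    have "gold_G * (a + gold_G - 1) = 1 + gold_G * a" using gold_G_square by (simp add: algebra_simps)
    then show ?thesis using ab args' by (simp add: D_def field_simps)
  qed
  have I2: "c / (1 + c * (a - 2)) = D"
  proof -
    have "c * (a + gold_G - 1) = 1 + c * (a - 2)" using gold_G_square by (simp add: c_def algebra_simps)
    then show ?thesis using ab args' by (simp add: D_def field_simps)
  qed
  have I3: "(1 / (1 + (1 / a - 1)) - c / (1 + c * (1 / a - 1))) * (- 1 / a\<^sup>2) = - D"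
  proof -
    have p: "(1 + c * (1 / a - 1)) * a = a + c * (1 - a)" using ab by (simp add: field_simps)
    have "0 < (1 + c * (1 / a - 1)) * a" using ab args' by simp
    then have pos: "0 < a + c * (1 - a)" unfolding p .
    have "c / (1 + c * (1 / a - 1)) = c * a / (a + c * (1 - a))"
      unfolding p[symmetric] using ab by simp
    then have "(1 / (1 + (1 / a - 1)) - c / (1 + c * (1 / a - 1))) * (- 1 / a\<^sup>2)
       = (a - c * a / (a + c * (1 - a))) * (- 1 / a\<^sup>2)" using ab by simp
    also have "a - c * a / (a + c * (1 - a)) = a\<^sup>2 * ((1 - c) / (a + c * (1 - a)))"
      using pos by (simp add: field_simps power2_eq_square)
    also have "(1 - c) / (a + c * (1 - a)) = D"
    proof -
      have "(1 - c) * (a + gold_G - 1) = a + c * (1 - a)" using gold_G_square by (simp add: c_def algebra_simps)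
      then show ?thesis using ab pos by (simp add: D_def field_simps)
    qed
    finally show ?thesis using ab by simp
  qed
  have I4: "(gold_G / (1 + gold_G * (1 / (2 - a) - 1)) - 1 / (1 + (1 / (2 - a) - 1))) * (1 / (2 - a)\<^sup>2) = D"
  proof -
    define b where "b = 2 - a"
    have b: "0 < b" using ab by (simp add: b_def)
    have p: "(1 + gold_G * (1 / b - 1)) * b = b + gold_G * (1 - b)" using b by (simp add: field_simps)
    have "0 < (1 + gold_G * (1 / b - 1)) * b" using b args' by (simp add: b_def)
    then have pos: "0 < b + gold_G * (1 - b)" unfolding p .
    have "gold_G / (1 + gold_G * (1 / b - 1)) = gold_G * b / (b + gold_G * (1 - b))"
      unfolding p[symmetric] using b by simp
    then have "(gold_G / (1 + gold_G * (1 / b - 1)) - 1 / (1 + (1 / b - 1))) * (1 / b\<^sup>2)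
       = (gold_G * b / (b + gold_G * (1 - b)) - b) * (1 / b\<^sup>2)" using b by simp
    also have "gold_G * b / (b + gold_G * (1 - b)) - b = b\<^sup>2 * ((gold_G - 1) / (b + gold_G * (1 - b)))"
      using pos by (simp add: field_simps power2_eq_square)
    also have "(gold_G - 1) / (b + gold_G * (1 - b)) = D"
    proof -
      have "(gold_G - 1) * (a + gold_G - 1) = b + gold_G * (1 - b)" using gold_G_square by (simp add: b_def algebra_simps)
      then show ?thesis using ab pos by (simp add: D_def field_simps)
    qed
    finally show ?thesis using b by (simp add: b_def)
  qed
  \<comment> \<open>The parameter 1 is excluded because both inner corners are 0 there, where the
    logarithm is singular.\<close>
  have nz: "a \<noteq> 0" "a - 2 \<noteq> 0" "1 / a - 1 \<noteq> 0" "1 / (2 - a) - 1 \<noteq> 0"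
    using ab a by (auto simp: field_simps)
  have dl1: "((\<lambda>a. 1 / a - 1) has_real_derivative - 1 / a\<^sup>2) (at a)"
    using ab by (auto intro!: derivative_eq_intros simp: power2_eq_square)
  have dl2: "((\<lambda>a. 1 / (2 - a) - 1) has_real_derivative 1 / (2 - a)\<^sup>2) (at a)"
    using ab by (auto intro!: derivative_eq_intros simp: power2_eq_square)
  have d2: "((\<lambda>a. a - 2) has_real_derivative 1) (at a)" by (auto intro!: derivative_eq_intros)
  let ?l1 = "1 / a - 1" and ?l2 = "1 / (2 - a) - 1"
  have 1: "(log_prim gold_G has_real_derivative - ln \<bar>a\<bar> * (gold_G / (1 + gold_G * a))) (at a)"
    by (rule DERIV_log_prim) (use args a nz gold_G_bounds in auto)
  have 2: "((\<lambda>a. log_prim c (a - 2)) has_real_derivative (- ln \<bar>a - 2\<bar> * (c / (1 + c * (a - 2)))) * 1) (at a)"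
    by (rule DERIV_chain2[where f = "log_prim c", OF DERIV_log_prim d2]) (use args a nz c0 in auto)
  have 3: "((\<lambda>a. log_prim 1 (1 / a - 1)) has_real_derivative (- ln \<bar>?l1\<bar> * (1 / (1 + 1 * ?l1))) * (- 1 / a\<^sup>2)) (at a)"
    by (rule DERIV_chain2[where f = "log_prim 1", OF DERIV_log_prim dl1]) (use args a nz in auto)
  have 4: "((\<lambda>a. log_prim c (1 / a - 1)) has_real_derivative (- ln \<bar>?l1\<bar> * (c / (1 + c * ?l1))) * (- 1 / a\<^sup>2)) (at a)"
    by (rule DERIV_chain2[where f = "log_prim c", OF DERIV_log_prim dl1]) (use args a nz c0 in auto)
  have 5: "((\<lambda>a. log_prim gold_G (1 / (2 - a) - 1)) has_real_derivative (- ln \<bar>?l2\<bar> * (gold_G / (1 + gold_G * ?l2))) * (1 / (2 - a)\<^sup>2)) (at a)"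
    by (rule DERIV_chain2[where f = "log_prim gold_G", OF DERIV_log_prim dl2]) (use args a nz gold_G_bounds in auto)
  have 6: "((\<lambda>a. log_prim 1 (1 / (2 - a) - 1)) has_real_derivative (- ln \<bar>?l2\<bar> * (1 / (1 + 1 * ?l2))) * (1 / (2 - a)\<^sup>2)) (at a)"
    by (rule DERIV_chain2[where f = "log_prim 1", OF DERIV_log_prim dl2]) (use args a nz in auto)
  define X3 X4 X5 X6 where "X3 = 1 / (1 + 1 * ?l1)" and "X4 = c / (1 + c * ?l1)"
    and "X5 = gold_G / (1 + gold_G * ?l2)" and "X6 = 1 / (1 + 1 * ?l2)"
  note X = X3_def[symmetric] X4_def[symmetric] X5_def[symmetric] X6_def[symmetric]
  have I3': "(X3 - X4) * (- 1 / a\<^sup>2) = - D" using I3 by (simp add: X3_def X4_def)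
  have I4': "(X5 - X6) * (1 / (2 - a)\<^sup>2) = D" using I4 by (simp add: X5_def X6_def)
  have "(log_mass has_real_derivative
      - ln \<bar>a\<bar> * (gold_G / (1 + gold_G * a)) - (- ln \<bar>a - 2\<bar> * (c / (1 + c * (a - 2)))) * 1
      - ((- ln \<bar>?l1\<bar> * X3) * (- 1 / a\<^sup>2) - (- ln \<bar>?l1\<bar> * X4) * (- 1 / a\<^sup>2))
      - ((- ln \<bar>?l2\<bar> * X5) * (1 / (2 - a)\<^sup>2) - (- ln \<bar>?l2\<bar> * X6) * (1 / (2 - a)\<^sup>2))) (at a)"
    unfolding log_mass_def[abs_def] c_def[symmetric]
    by (intro DERIV_diff 1 2 3[unfolded X] 4[unfolded X] 5[unfolded X] 6[unfolded X])
  moreover have "- ln \<bar>a\<bar> * (gold_G / (1 + gold_G * a)) - (- ln \<bar>a - 2\<bar> * (c / (1 + c * (a - 2)))) * 1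
      - ((- ln \<bar>?l1\<bar> * X3) * (- 1 / a\<^sup>2) - (- ln \<bar>?l1\<bar> * X4) * (- 1 / a\<^sup>2))
      - ((- ln \<bar>?l2\<bar> * X5) * (1 / (2 - a)\<^sup>2) - (- ln \<bar>?l2\<bar> * X6) * (1 / (2 - a)\<^sup>2)) = 0"
  proof -
    have gen: "(- L * X) * k - (- L * Y) * k = - L * ((X - Y) * k)" for L X Y k :: real
      by (simp add: algebra_simps)
    have "(- ln \<bar>?l1\<bar> * X3) * (- 1 / a\<^sup>2) - (- ln \<bar>?l1\<bar> * X4) * (- 1 / a\<^sup>2) = - ln \<bar>?l1\<bar> * ((X3 - X4) * (- 1 / a\<^sup>2))"
      by (rule gen)
    moreover have "(- ln \<bar>?l2\<bar> * X5) * (1 / (2 - a)\<^sup>2) - (- ln \<bar>?l2\<bar> * X6) * (1 / (2 - a)\<^sup>2) = - ln \<bar>?l2\<bar> * ((X5 - X6) * (1 / (2 - a)\<^sup>2))"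
      by (rule gen)
    \<comment> \<open>The term ln |1 - a| is common to the two inner corners; ln a and ln (2 - a)
      are left over and cancel against the outer corners.\<close>
    moreover have "ln \<bar>?l1\<bar> = ln \<bar>1 - a\<bar> - ln a"
    proof -
      have "?l1 = (1 - a) / a" using ab by (simp add: field_simps)
      then show ?thesis using ab a by (simp add: abs_divide ln_div)
    qed
    moreover have "ln \<bar>?l2\<bar> = ln \<bar>1 - a\<bar> - ln (2 - a)"
    proof -
      have "?l2 = (a - 1) / (2 - a)" using ab by (simp add: field_simps)
      then have "\<bar>?l2\<bar> = \<bar>1 - a\<bar> / (2 - a)" using ab by (simp add: abs_divide abs_minus_commute)
      then show ?thesis using ab a by (simp add: ln_div)
    qed
    moreover have "\<bar>a\<bar> = a" "\<bar>a - 2\<bar> = 2 - a" using ab by auto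
    ultimately show ?thesis
      by (simp only: I1 I2 I3' I4') (simp add: algebra_simps)
  qed
  ultimately show ?thesis by simp
qed

lemma continuous_on_log_mass: "continuous_on {gold_g..gold_G} log_mass"
proof -
  have pos: "a \<noteq> 0" "2 - a \<noteq> 0" if "a \<in> {gold_g..gold_G}" for a
    using that gold_G_bounds by (auto simp: gold_g_eq)
  have c: "0 \<le> 2 - gold_G" "0 \<le> gold_G" using gold_G_bounds by auto
  have comp: "continuous_on {gold_g..gold_G} (\<lambda>a. log_prim b (f a))"
    if f: "continuous_on {gold_g..gold_G} f" and "0 \<le> b"
      and *: "\<And>a. a \<in> {gold_g..gold_G} \<Longrightarrow> - 1 < b * f a \<and> b * f a < 3" for f b
  proof (rule continuous_on_compose2[OF _ f])
    show "continuous_on (f ` {gold_g..gold_G}) (log_prim b)"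
      by (rule continuous_on_log_prim) (use that in auto)
  qed simp
  show ?thesis
    unfolding log_mass_def[abs_def]
    by (intro continuous_intros comp) (use pos c log_mass_args in auto)
qed

lemma log_mass_eq:
  assumes "gold_g \<le> a" "a \<le> gold_G"
  shows "log_mass a = pi\<^sup>2 / 6"
proof -
  have const: "log_mass q = log_mass p" if "gold_g \<le> p" "p \<le> q" "q \<le> gold_G" "q \<le> 1 \<or> 1 \<le> p" for p q
  proof (cases "p = q")
    case False
    then have "p < q" using that by simp
    then show ?thesis
    proof (rule DERIV_isconst_end)
      show "continuous_on {p..q} log_mass"
        by (rule continuous_on_subset[OF continuous_on_log_mass]) (use that in auto)
      show "(log_mass has_real_derivative 0) (at x)" if "p < x" "x < q" for x
        by (rule DERIV_log_mass) (use that \<open>gold_g \<le> p\<close> \<open>q \<le> gold_G\<close> \<open>q \<le> 1 \<or> 1 \<le> p\<close> in auto)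
    qed
  qed simp
  have "log_mass a = log_mass gold_G"
  proof (cases "1 \<le> a")
    case True
    then show ?thesis using const[of a gold_G] assms by simp
  next
    case False
    then show ?thesis using const[of a 1] const[of 1 gold_G] assms gold_G_bounds by (simp add: gold_g_eq)
  qed
  also have "log_mass gold_G = dilog_prim gold_G - dilog_prim (gold_G - 2)"
  proof -
    \<comment> \<open>At G the inner corners merge with the outer ones, and a single rectangle of
      height 1 is left.\<close>
    have 1: "1 / gold_G - 1 = gold_G - 2" using gold_G_square gold_G_bounds by (simp add: field_simps)
    have 2: "1 / (2 - gold_G) - 1 = gold_G" using gold_G_square gold_G_bounds by (simp add: field_simps)
    show ?thesis unfolding log_mass_def 1 2 by (simp add: log_prim_def)
  qed
  finally show ?thesis using dilog_prim_golden by simp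
qed

section \<open>Integrals over the domain: total mass and entropy integral\<close>

lemma diff_quotient_nonneg:
  fixes a b x :: real
  assumes "a \<le> b" "0 < 1 + a * x" "0 < 1 + b * x"
  shows "0 \<le> b / (1 + b * x) - a / (1 + a * x)"
proof -
  have "b / (1 + b * x) - a / (1 + a * x) = (b * (1 + a * x) - a * (1 + b * x)) / ((1 + b * x) * (1 + a * x))"
    by (rule diff_frac_eq) (use assms in auto)
  also have "b * (1 + a * x) - a * (1 + b * x) = b - a" by (simp add: algebra_simps)
  finally show ?thesis using assms by simp
qed

text \<open>In y the density has the primitive y / (1 + x y), so only an integral in x remains. The
  finite set \<open>S\<close> absorbs x = 0, where \<open>log_prim\<close> is continuous but not
  shown to be differentiable.\<close>

lemma nn_integral_rectangle:
  fixes F \<Psi> :: "real \<Rightarrow> real"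
  assumes F[measurable]: "F \<in> borel_measurable borel" and F0: "\<And>x. x \<in> {p..q} \<Longrightarrow> 0 \<le> F x"
    and pq: "p \<le> q" and ab: "0 \<le> a" "a \<le> b" and pos: "\<And>x. x \<in> {p..q} \<Longrightarrow> 0 < 1 + b * x"
    and S: "finite S"
    and deriv: "\<And>x. x \<in> {p<..<q} - S \<Longrightarrow> (\<Psi> has_real_derivative F x * (b / (1 + b * x) - a / (1 + a * x))) (at x)"
    and cont: "continuous_on {p..q} \<Psi>"
  shows "(\<integral>\<^sup>+z. ennreal (F (fst z) * (1 / (1 + fst z * snd z)\<^sup>2)) * indicator ({p..q} \<times> {a..b}) z \<partial>lborel)
    = ennreal (\<Psi> q - \<Psi> p)"
proof -
  let ?w = "\<lambda>x. b / (1 + b * x) - a / (1 + a * x)"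
  have pos': "0 < 1 + y * x" if "x \<in> {p..q}" "y \<in> {a..b}" for x y
  proof (cases "0 \<le> x")
    case True
    then have "0 \<le> y * x" using that ab by simp
    then show ?thesis by simp
  next
    case False
    then have "b * x \<le> y * x" using that by (intro mult_right_mono_neg) auto
    then show ?thesis using pos[OF that(1)] by simp
  qed
  have w0: "0 \<le> ?w x" if "x \<in> {p..q}" for x
    by (rule diff_quotient_nonneg) (use ab pos'[OF that, of a] pos'[OF that, of b] in auto)
  have "(\<integral>\<^sup>+z. ennreal (F (fst z) * (1 / (1 + fst z * snd z)\<^sup>2)) * indicator ({p..q} \<times> {a..b}) z \<partial>lborel)
     = (\<integral>\<^sup>+x. \<integral>\<^sup>+y. ennreal (F x * (1 / (1 + x * y)\<^sup>2)) * indicator ({p..q} \<times> {a..b}) (x, y) \<partial>lborel \<partial>lborel)"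
    unfolding lborel_prod[symmetric]
    by (subst lborel.nn_integral_fst[symmetric]) (auto simp: borel_prod)
  also have "\<dots> = (\<integral>\<^sup>+x. ennreal (F x * ?w x * indicator {p..q} x) \<partial>lborel)"
  proof (rule nn_integral_cong)
    fix x
    show "(\<integral>\<^sup>+y. ennreal (F x * (1 / (1 + x * y)\<^sup>2)) * indicator ({p..q} \<times> {a..b}) (x, y) \<partial>lborel)
        = ennreal (F x * ?w x * indicator {p..q} x)"
    proof (cases "x \<in> {p..q}")
      case True
      have "(\<integral>\<^sup>+y. ennreal (F x * (1 / (1 + x * y)\<^sup>2)) * indicator ({p..q} \<times> {a..b}) (x, y) \<partial>lborel)
          = (\<integral>\<^sup>+y. ennreal (F x) * (ennreal (1 / (1 + x * y)\<^sup>2) * indicator {a..b} y) \<partial>lborel)"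
        using True F0[OF True] by (intro nn_integral_cong) (auto simp: indicator_def ennreal_mult[symmetric])
      also have "\<dots> = ennreal (F x) * (\<integral>\<^sup>+y. ennreal (1 / (1 + x * y)\<^sup>2) * indicator {a..b} y \<partial>lborel)"
        by (rule nn_integral_cmult) measurable
      also have "(\<integral>\<^sup>+y. ennreal (1 / (1 + x * y)\<^sup>2) * indicator {a..b} y \<partial>lborel) = ennreal (b / (1 + x * b) - a / (1 + x * a))"
      proof (rule nn_integral_FTC_Icc[where F = "\<lambda>y. y / (1 + x * y)"])
        fix y assume y: "y \<in> {a..b}"
        then have "0 < 1 + x * y" using pos'[OF True, of y] by (simp add: mult.commute)
        then show "((\<lambda>y. y / (1 + x * y)) has_real_derivative 1 / (1 + x * y)\<^sup>2) (at y)"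
          by (auto intro!: derivative_eq_intros simp: power2_eq_square algebra_simps)
      qed (use ab in auto)
      finally show ?thesis
        using True F0[OF True] w0[OF True] by (simp add: ennreal_mult[symmetric] mult.commute)
    qed auto
  qed
  also have "\<dots> = ennreal (\<Psi> q - \<Psi> p)"
  proof (rule nn_integral_has_integral_lborel)
    show "(\<lambda>x. F x * ?w x * indicator {p..q} x) \<in> borel_measurable borel" by measurable
    show "0 \<le> F x * ?w x * indicator {p..q} x" for x
      using F0[of x] w0[of x] by (cases "x \<in> {p..q}") auto
    have "((\<lambda>x. F x * ?w x) has_integral (\<Psi> q - \<Psi> p)) {p..q}"
      by (rule fundamental_theorem_of_calculus_interior_strong[OF S pq _ cont])
         (use deriv in \<open>simp add: has_real_derivative_iff_has_vector_derivative\<close>)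
    then have "((\<lambda>x. if x \<in> {p..q} then F x * ?w x else 0) has_integral (\<Psi> q - \<Psi> p)) UNIV"
      by (simp only: has_integral_restrict_UNIV)
    then show "((\<lambda>x. F x * ?w x * indicator {p..q} x) has_integral (\<Psi> q - \<Psi> p)) UNIV"
      by (rule has_integral_eq[rotated]) (auto simp: indicator_def)
  qed
  finally show ?thesis .
qed

context odd_cf
begin

lemma l_bounds: "\<alpha> - 2 \<le> l1" "l1 \<le> \<alpha>" "\<alpha> - 2 \<le> l2" "l2 \<le> \<alpha>"
proof -
  have "(\<alpha> - 1) * \<alpha> \<le> 1" "1 \<le> (\<alpha> + 1) * \<alpha>" using \<alpha>_quad by (simp_all add: algebra_simps)
  then show "\<alpha> - 2 \<le> l1" "l1 \<le> \<alpha>"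
    using \<alpha>_bounds by (simp_all add: l1_def field_simps)
  have "(\<alpha> - 1) * (2 - \<alpha>) \<le> 1" "1 \<le> (\<alpha> + 1) * (2 - \<alpha>)"
    using zero_le_square[of "\<alpha> - 3 / 2"] \<alpha>_quad by (simp_all add: algebra_simps)
  then show "\<alpha> - 2 \<le> l2" "l2 \<le> \<alpha>"
    using \<alpha>_bounds by (simp_all add: l2_def field_simps)
qed

lemma open_dom_rectangles:
  "AE z in lborel. indicator open_dom z =
     indicator ({\<alpha> - 2..\<alpha>} \<times> {0..2 - G}) z + indicator ({l1..\<alpha>} \<times> {2 - G..1}) z +
     (indicator ({l2..\<alpha>} \<times> {1..G}) z :: ennreal)"
proof -
  have "AE z in lborel. (z :: real \<times> real) \<notin> {z. fst z = l1}"
       "AE z in lborel. (z :: real \<times> real) \<notin> {z. fst z = \<alpha>}"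
    by (rule AE_not_in, rule null_vertical_line)+
  moreover have
       "AE z in lborel. (z :: real \<times> real) \<notin> {z. snd z = 2 - G}"
       "AE z in lborel. (z :: real \<times> real) \<notin> {z. snd z = 1}"
       "AE z in lborel. (z :: real \<times> real) \<notin> {z. snd z = G}"
       "AE z in lborel. (z :: real \<times> real) \<notin> {z. snd z = 0}"
    by (rule AE_not_in, rule null_horizontal_line)+
  ultimately show ?thesis
  proof eventually_elim
    case (elim z)
    obtain x y where z: "z = (x, y)" by (cases z)
    have ne: "x \<noteq> l1" "x \<noteq> \<alpha>" "y \<noteq> 2 - G" "y \<noteq> 1" "y \<noteq> G" "y \<noteq> 0" using elim z by auto
    consider "y < 0 \<or> G < y" | "0 < y" "y < 2 - G" | "2 - G < y" "y < 1" | "1 < y" "y < G"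
      using ne by linarith
    then show ?case
    proof cases
      case 1
      then have "(x, y) \<notin> open_dom" "(x, y) \<notin> {\<alpha> - 2..\<alpha>} \<times> {0..2 - G}"
        "(x, y) \<notin> {l1..\<alpha>} \<times> {2 - G..1}" "(x, y) \<notin> {l2..\<alpha>} \<times> {1..G}"
        using gold_G_bounds by (auto simp: open_dom_def)
      then show ?thesis by (simp add: z)
    next
      case 2
      then have "(x, y) \<in> open_dom \<longleftrightarrow> x \<in> {\<alpha> - 2..\<alpha>}" "(x, y) \<in> {\<alpha> - 2..\<alpha>} \<times> {0..2 - G} \<longleftrightarrow> x \<in> {\<alpha> - 2..\<alpha>}"
        "(x, y) \<notin> {l1..\<alpha>} \<times> {2 - G..1}" "(x, y) \<notin> {l2..\<alpha>} \<times> {1..G}"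
        using gold_G_bounds ne(2) by (auto simp: open_dom_def mem_I)
      then show ?thesis by (simp only: z indicator_def of_bool_eq) simp
    next
      case 3
      then have "(x, y) \<in> open_dom \<longleftrightarrow> x \<in> {l1..\<alpha>}" "(x, y) \<in> {l1..\<alpha>} \<times> {2 - G..1} \<longleftrightarrow> x \<in> {l1..\<alpha>}"
        "(x, y) \<notin> {\<alpha> - 2..\<alpha>} \<times> {0..2 - G}" "(x, y) \<notin> {l2..\<alpha>} \<times> {1..G}"
        using gold_G_bounds l_bounds(1) ne(1,2) by (auto simp: open_dom_def mem_I)
      then show ?thesis by (simp only: z indicator_def of_bool_eq) simp
    next
      case 4
      then have "(x, y) \<in> open_dom \<longleftrightarrow> x \<in> {l2..\<alpha>}" "(x, y) \<in> {l2..\<alpha>} \<times> {1..G} \<longleftrightarrow> x \<in> {l2..\<alpha>}"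
        "(x, y) \<notin> {\<alpha> - 2..\<alpha>} \<times> {0..2 - G}" "(x, y) \<notin> {l1..\<alpha>} \<times> {2 - G..1}"
        using gold_G_bounds l_bounds(3) ne(2) by (auto simp: open_dom_def mem_I)
      then show ?thesis by (simp only: z indicator_def of_bool_eq) simp
    qed
  qed
qed

text \<open>Applied with F = 1 for the total mass and with F = ln 2 - ln |x| for the entropy
  integral. Each rectangle contributes the values of \<open>\<Psi>\<close> at its corners; on the
  common right side x = \<alpha> they telescope to \<open>\<Psi> G \<alpha>\<close>.\<close>

lemma nn_integral_\<mu>_fst:
  fixes F :: "real \<Rightarrow> real" and \<Psi> :: "real \<Rightarrow> real \<Rightarrow> real"
  assumes F[measurable]: "F \<in> borel_measurable borel" and F0: "\<And>x. x \<in> {\<alpha> - 2..\<alpha>} \<Longrightarrow> 0 \<le> F x"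
    and deriv: "\<And>b x. 0 \<le> b \<Longrightarrow> x \<noteq> 0 \<Longrightarrow> - 1 < b * x \<Longrightarrow> b * x < 3 \<Longrightarrow>
      (\<Psi> b has_real_derivative F x * (b / (1 + b * x))) (at x)"
    and cont: "\<And>b S. 0 \<le> b \<Longrightarrow> (\<And>x. x \<in> S \<Longrightarrow> - 1 < b * x \<and> b * x < 3) \<Longrightarrow> continuous_on S (\<Psi> b)"
    and \<Psi>0: "\<And>x. \<Psi> 0 x = 0"
  shows "(\<integral>\<^sup>+z. F (fst z) \<partial>\<mu>) = ennreal ((\<Psi> G \<alpha> - \<Psi> (2 - G) (\<alpha> - 2)
     - (\<Psi> 1 l1 - \<Psi> (2 - G) l1) - (\<Psi> G l2 - \<Psi> 1 l2)) / mass)"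
proof -
  let ?f = "\<lambda>z. ennreal (F (fst z) * (1 / (1 + fst z * snd z)\<^sup>2))"
  define R where "R = (\<lambda>p a b. {p..\<alpha>} \<times> {a..b} :: (real \<times> real) set)"
  have rect: "(\<integral>\<^sup>+z. ?f z * indicator (R p a b) z \<partial>lborel)
      = ennreal ((\<Psi> b \<alpha> - \<Psi> a \<alpha>) - (\<Psi> b p - \<Psi> a p)) \<and> 0 \<le> (\<Psi> b \<alpha> - \<Psi> a \<alpha>) - (\<Psi> b p - \<Psi> a p)"
    if p: "\<alpha> - 2 \<le> p" "p \<le> \<alpha>" and ab: "0 \<le> a" "a \<le> b" and bp: "- 1 < b * p" and b\<alpha>: "b * \<alpha> < 3" for p a b
  proof -
    have range: "- 1 < c * x \<and> c * x < 3" if x: "x \<in> {p..\<alpha>}" and c: "c \<in> {a..b}" for x c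
    proof (cases "0 \<le> x")
      case True
      then have "0 \<le> c * x" "c * x \<le> b * \<alpha>" using x c ab by (auto intro!: mult_mono)
      then show ?thesis using b\<alpha> by linarith
    next
      case False
      then have "b * x \<le> c * x" using c by (intro mult_right_mono_neg) auto
      moreover have "b * p \<le> b * x" using x ab by (intro mult_left_mono) auto
      moreover have "c * x \<le> 0" using False c ab by (intro mult_nonneg_nonpos) auto
      ultimately show ?thesis using bp by linarith
    qed
    let ?w = "\<lambda>x. b / (1 + b * x) - a / (1 + a * x)"
    have d: "((\<lambda>x. \<Psi> b x - \<Psi> a x) has_real_derivative F x * ?w x) (at x)" if "x \<in> {p<..<\<alpha>} - {0}" for x
    proof -
      have "((\<lambda>x. \<Psi> b x - \<Psi> a x) has_real_derivative F x * (b / (1 + b * x)) - F x * (a / (1 + a * x))) (at x)"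
        by (intro DERIV_diff deriv) (use that ab range[of x a] range[of x b] in auto)
      then show ?thesis by (simp add: right_diff_distrib)
    qed
    have c: "continuous_on {p..\<alpha>} (\<lambda>x. \<Psi> b x - \<Psi> a x)"
      by (intro continuous_on_diff cont) (use ab range in auto)
    have "(\<integral>\<^sup>+z. ?f z * indicator (R p a b) z \<partial>lborel) = ennreal ((\<Psi> b \<alpha> - \<Psi> a \<alpha>) - (\<Psi> b p - \<Psi> a p))"
      unfolding R_def
    proof (rule nn_integral_rectangle[where S = "{0}"])
      show "0 \<le> F x" if "x \<in> {p..\<alpha>}" for x using F0[of x] that p by simp
      show "0 < 1 + b * x" if "x \<in> {p..\<alpha>}" for x using range[OF that, of b] ab by simp
    qed (use p ab d c in simp_all)
    moreover have "\<Psi> b p - \<Psi> a p \<le> \<Psi> b \<alpha> - \<Psi> a \<alpha>"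
    proof -
      have *: "((\<lambda>x. F x * ?w x) has_integral ((\<Psi> b \<alpha> - \<Psi> a \<alpha>) - (\<Psi> b p - \<Psi> a p))) {p..\<alpha>}"
        by (rule fundamental_theorem_of_calculus_interior_strong[of "{0}", OF _ p(2) _ c])
           (use d in \<open>simp_all add: has_real_derivative_iff_has_vector_derivative\<close>)
      have "0 \<le> F x * ?w x" if x: "x \<in> {p..\<alpha>}" for x
      proof -
        have "0 \<le> ?w x"
          by (rule diff_quotient_nonneg) (use ab range[OF x, of a] range[OF x, of b] in auto)
        then show ?thesis using F0[of x] x p by simp
      qed
      from has_integral_nonneg[OF * this] show ?thesis by simp
    qed
    ultimately show ?thesis by simp
  qed
  note args = log_mass_args[OF \<alpha>_ge \<alpha>_le, folded l1_def l2_def]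
  have c: "0 \<le> 2 - G" "2 - G \<le> 1" "1 \<le> G" using gold_G_bounds by auto
  have "(2 - G) * \<alpha> \<le> 1 * \<alpha>" using c \<alpha>_bounds by (intro mult_right_mono) auto
  then have c\<alpha>: "(2 - G) * \<alpha> < 3" using \<alpha>_bounds by linarith
  define v where "v = (\<lambda>p a b. (\<Psi> b \<alpha> - \<Psi> a \<alpha>) - (\<Psi> b p - \<Psi> a p))"
  have r1: "(\<integral>\<^sup>+z. ?f z * indicator (R (\<alpha> - 2) 0 (2 - G)) z \<partial>lborel) = ennreal (v (\<alpha> - 2) 0 (2 - G)) \<and> 0 \<le> v (\<alpha> - 2) 0 (2 - G)"
    unfolding v_def by (rule rect) (use l_bounds c args c\<alpha> in auto)
  have r2: "(\<integral>\<^sup>+z. ?f z * indicator (R l1 (2 - G) 1) z \<partial>lborel) = ennreal (v l1 (2 - G) 1) \<and> 0 \<le> v l1 (2 - G) 1"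
    unfolding v_def by (rule rect) (use l_bounds c args \<alpha>_bounds in auto)
  have r3: "(\<integral>\<^sup>+z. ?f z * indicator (R l2 1 G) z \<partial>lborel) = ennreal (v l2 1 G) \<and> 0 \<le> v l2 1 G"
    unfolding v_def by (rule rect) (use l_bounds c args in auto)
  have [measurable]: "R p a b \<in> sets borel" for p a b
    unfolding R_def borel_prod[symmetric] by measurable
  have "(\<integral>\<^sup>+z. F (fst z) \<partial>\<mu>) = (\<integral>\<^sup>+z. ennreal (dens z) * indicator open_dom z * ennreal (F (fst z)) \<partial>lborel)"
    unfolding \<mu>_def by (subst nn_integral_density) auto
  also have "\<dots> = (\<integral>\<^sup>+z. ennreal (1 / mass) * (?f z * indicator open_dom z) \<partial>lborel)"
  proof (rule nn_integral_cong)
    fix z :: "real \<times> real"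
    show "ennreal (dens z) * indicator open_dom z * ennreal (F (fst z)) = ennreal (1 / mass) * (?f z * indicator open_dom z)"
    proof (cases "z \<in> open_dom")
      case True
      then have "0 \<le> F (fst z)" using F0[of "fst z"] by (auto simp: open_dom_def mem_I)
      then show ?thesis using True mass_pos by (simp add: dens_def ennreal_mult[symmetric] mult_ac)
    qed simp
  qed
  also have "\<dots> = ennreal (1 / mass) * (\<integral>\<^sup>+z. ?f z * indicator open_dom z \<partial>lborel)"
    by (rule nn_integral_cmult) measurable
  also have "(\<integral>\<^sup>+z. ?f z * indicator open_dom z \<partial>lborel)
     = (\<integral>\<^sup>+z. ?f z * indicator (R (\<alpha> - 2) 0 (2 - G)) z + ?f z * indicator (R l1 (2 - G) 1) z + ?f z * indicator (R l2 1 G) z \<partial>lborel)"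
    by (rule nn_integral_cong_AE)
       (use open_dom_rectangles in eventually_elim, simp only: R_def distrib_left)
  also have "\<dots> = (\<integral>\<^sup>+z. ?f z * indicator (R (\<alpha> - 2) 0 (2 - G)) z \<partial>lborel)
     + (\<integral>\<^sup>+z. ?f z * indicator (R l1 (2 - G) 1) z \<partial>lborel) + (\<integral>\<^sup>+z. ?f z * indicator (R l2 1 G) z \<partial>lborel)"
    by (simp add: nn_integral_add)
  also have "\<dots> = ennreal (v (\<alpha> - 2) 0 (2 - G) + v l1 (2 - G) 1 + v l2 1 G)"
    using r1 r2 r3 by (simp add: ennreal_plus)
  also have "v (\<alpha> - 2) 0 (2 - G) + v l1 (2 - G) 1 + v l2 1 G = \<Psi> G \<alpha> - \<Psi> (2 - G) (\<alpha> - 2)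
     - (\<Psi> 1 l1 - \<Psi> (2 - G) l1) - (\<Psi> G l2 - \<Psi> 1 l2)"
    by (simp add: v_def \<Psi>0)
  finally show ?thesis using mass_pos by (simp add: ennreal_mult'[symmetric])
qed

text \<open>All arguments factor into s = \<alpha> + G - 1, \<alpha>, 2 - \<alpha> and numbers
  depending on G only. Everything that depends on \<alpha> cancels, and ln G - ln (2 - G) = 3 ln G
  remains.\<close>

lemma ln_mass_total: "ln (1 + G * \<alpha>) - ln (1 + (2 - G) * (\<alpha> - 2))
     - (ln (1 + 1 * l1) - ln (1 + (2 - G) * l1)) - (ln (1 + G * l2) - ln (1 + 1 * l2)) = mass"
proof -
  define s where "s = \<alpha> + G - 1"
  have pos: "0 < s" "0 < \<alpha>" "0 < 2 - \<alpha>" "0 < G" "0 < G - 1" "0 < 2 - G"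
    using \<alpha>_bounds gold_G_bounds by (auto simp: s_def)
  have "1 + G * \<alpha> = G * s" "1 + (2 - G) * (\<alpha> - 2) = (2 - G) * s"
    using gold_G_square by (simp_all add: s_def algebra_simps)
  moreover have "1 + 1 * l1 = 1 / \<alpha>" "1 + 1 * l2 = 1 / (2 - \<alpha>)" by (simp_all add: l1_def l2_def)
  moreover have "1 + (2 - G) * l1 = (G - 1) * s / \<alpha>"
  proof -
    have "(1 + (2 - G) * l1) * \<alpha> = \<alpha> + (2 - G) * (1 - \<alpha>)"
      using pos by (simp add: l1_def algebra_simps)
    also have "\<dots> = (G - 1) * s" using gold_G_square by (simp add: s_def algebra_simps)
    finally show ?thesis using pos by (simp add: field_simps)
  qed
  moreover have "1 + G * l2 = (G - 1) * s / (2 - \<alpha>)"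
  proof -
    have "l2 * (2 - \<alpha>) = \<alpha> - 1" using one_plus_l2 by (simp add: algebra_simps)
    then have "(1 + G * l2) * (2 - \<alpha>) = (2 - \<alpha>) + G * (\<alpha> - 1)"
      by (simp add: distrib_right mult.assoc)
    also have "\<dots> = (G - 1) * s" using gold_G_square by (simp add: s_def algebra_simps)
    finally show ?thesis using pos by (simp add: field_simps)
  qed
  moreover have "ln (2 - G) = - 2 * ln G"
  proof -
    have "(2 - G) * (G * G) = 1" using gold_G_square by (simp add: algebra_simps)
    then have "2 - G = 1 / (G * G)" using pos by (simp add: field_simps)
    then show ?thesis using pos by (simp add: ln_div ln_mult)
  qed
  ultimately show ?thesis
    using pos by (simp add: ln_mult ln_div mass_def)
qed

lemma nn_integral_\<mu>_one: "(\<integral>\<^sup>+z. ennreal 1 \<partial>\<mu>) = 1"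
proof -
  have "(\<integral>\<^sup>+z. ennreal ((\<lambda>_. 1) (fst z)) \<partial>\<mu>) = ennreal ((ln (1 + G * \<alpha>) - ln (1 + (2 - G) * (\<alpha> - 2))
     - (ln (1 + 1 * l1) - ln (1 + (2 - G) * l1)) - (ln (1 + G * l2) - ln (1 + 1 * l2))) / mass)"
  proof (rule nn_integral_\<mu>_fst[where \<Psi> = "\<lambda>b x. ln (1 + b * x)"])
    show "((\<lambda>x. ln (1 + b * x)) has_real_derivative 1 * (b / (1 + b * x))) (at x)"
      if "- 1 < b * x" for b x :: real
      using that by (auto intro!: derivative_eq_intros)
    show "continuous_on S (\<lambda>x. ln (1 + b * x))" if "\<And>x. x \<in> S \<Longrightarrow> - 1 < b * x \<and> b * x < 3" for b and S :: "real set"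
      by (intro continuous_intros) (use that in fastforce)
  qed auto
  then show ?thesis using mass_pos by (simp only: ln_mass_total) simp
qed

lemma emeasure_\<mu>_UNIV: "emeasure \<mu> UNIV = 1"
  using nn_integral_\<mu>_one by simp

lemma AE_\<mu>_open_dom: "AE z in \<mu>. z \<in> open_dom"
  unfolding \<mu>_def by (subst AE_density) (auto simp: indicator_def)

lemma distr_\<mu>_Phi: "distr \<mu> \<mu> \<Phi> = \<mu>"
proof -
  interpret m: prob_space \<mu>
    by (rule prob_spaceI) (simp add: emeasure_\<mu>_UNIV)
  have "distr \<mu> \<mu> \<Phi> = distr \<mu> borel \<Phi>" by (rule distr_cong) auto
  interpret d: prob_space "distr \<mu> borel \<Phi>"
    by (rule m.prob_space_distr) measurable
  have "distr \<mu> borel \<Phi> = \<mu>"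
  proof (rule measure_eqI)
    fix A assume "A \<in> sets (distr \<mu> borel \<Phi>)"
    then have A: "A \<in> sets borel" by simp
    have le: "measure (distr \<mu> borel \<Phi>) B \<le> measure \<mu> B" if "B \<in> sets borel" for B
      using emeasure_Phi_le[OF that] by (simp add: d.emeasure_eq_measure m.emeasure_eq_measure)
    have "measure (distr \<mu> borel \<Phi>) (UNIV - A) = 1 - measure (distr \<mu> borel \<Phi>) A"
      using d.prob_compl[of A] A by simp
    moreover have "measure \<mu> (UNIV - A) = 1 - measure \<mu> A"
      using m.prob_compl[of A] A by simp
    ultimately have "measure (distr \<mu> borel \<Phi>) A = measure \<mu> A"
      using le[OF A] le[of "UNIV - A"] A by auto
    then show "emeasure (distr \<mu> borel \<Phi>) A = emeasure \<mu> A"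
      by (simp add: d.emeasure_eq_measure m.emeasure_eq_measure)
  qed simp
  then show ?thesis using \<open>distr \<mu> \<mu> \<Phi> = distr \<mu> borel \<Phi>\<close> by simp
qed

sublocale plane: measure_preserving_system \<mu> \<Phi>
proof -
  interpret prob_space \<mu>
    by (rule prob_spaceI) (simp add: emeasure_\<mu>_UNIV)
  show "measure_preserving_system \<mu> \<Phi>"
  proof
    show "\<Phi> \<in> \<mu> \<rightarrow>\<^sub>M \<mu>" by measurable
    show "distr \<mu> \<mu> \<Phi> = \<mu>" by (rule distr_\<mu>_Phi)
  qed
qed

definition \<nu> :: "real measure" where
  "\<nu> = distr \<mu> borel fst"

lemma sets_\<nu>[measurable_cong, simp]: "sets \<nu> = sets borel"
  and space_\<nu>[simp]: "space \<nu> = UNIV"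
  by (auto simp: \<nu>_def)

sublocale line: measure_preserving_system \<nu> \<phi>
proof -
  interpret prob_space \<nu>
    unfolding \<nu>_def by (rule plane.prob_space_distr) measurable
  show "measure_preserving_system \<nu> \<phi>"
  proof
    show "\<phi> \<in> \<nu> \<rightarrow>\<^sub>M \<nu>" by measurable
    have "distr \<nu> \<nu> \<phi> = distr \<mu> borel (\<lambda>z. \<phi> (fst z))"
      unfolding \<nu>_def by (subst distr_distr) (auto simp: comp_def intro!: distr_cong)
    also have "\<dots> = distr \<mu> borel (\<lambda>z. fst (\<Phi> z))"
      by (simp add: fst_Phi)
    also have "\<dots> = distr (distr \<mu> \<mu> \<Phi>) borel fst"
      by (subst distr_distr) (auto simp: comp_def)
    also have "\<dots> = \<nu>" by (simp add: distr_\<mu>_Phi \<nu>_def)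
    finally show "distr \<nu> \<nu> \<phi> = \<nu>" .
  qed
qed

lemma AE_\<nu>_I: "AE x in \<nu>. x \<in> I"
  unfolding \<nu>_def
  by (subst AE_distr_iff) (use AE_\<mu>_open_dom in \<open>auto simp: open_dom_def mem_I elim!: eventually_mono\<close>)

lemma integrable_ln_abs: "integrable \<nu> (\<lambda>x. ln \<bar>x\<bar>)"
  and expectation_ln_abs: "line.expectation (\<lambda>x. - 2 * ln \<bar>x\<bar>) = pi\<^sup>2 / (9 * ln G)"
proof -
  \<comment> \<open>Adding ln 2 makes the integrand nonnegative, as |x| <= 2 on the
    interval.\<close>
  let ?F = "\<lambda>x. ln 2 - ln \<bar>x\<bar>"
  let ?\<Psi> = "\<lambda>b x. ln 2 * ln (1 + b * x) + log_prim b x"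
  have F0: "0 \<le> ?F x" if "x \<in> {\<alpha> - 2..\<alpha>}" for x
  proof (cases "x = 0")
    case False
    then have "ln \<bar>x\<bar> \<le> ln 2" using that \<alpha>_bounds by (subst ln_le_cancel_iff) auto
    then show ?thesis by simp
  qed simp
  have "(\<integral>\<^sup>+x. ?F x \<partial>\<nu>) = (\<integral>\<^sup>+z. ?F (fst z) \<partial>\<mu>)"
    unfolding \<nu>_def by (subst nn_integral_distr) auto
  also have "\<dots> = ennreal ((?\<Psi> G \<alpha> - ?\<Psi> (2 - G) (\<alpha> - 2)
     - (?\<Psi> 1 l1 - ?\<Psi> (2 - G) l1) - (?\<Psi> G l2 - ?\<Psi> 1 l2)) / mass)"
  proof (rule nn_integral_\<mu>_fst[where \<Psi> = ?\<Psi>, OF _ F0])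
    show "(?\<Psi> b has_real_derivative ?F x * (b / (1 + b * x))) (at x)"
      if "0 \<le> b" "x \<noteq> 0" "- 1 < b * x" "b * x < 3" for b x
    proof -
      have "((\<lambda>x. ln 2 * ln (1 + b * x)) has_real_derivative ln 2 * (b / (1 + b * x))) (at x)"
        using that by (auto intro!: derivative_eq_intros)
      moreover have gen: "p * K + - q * K = (p - q) * K" for p q K :: real
        by (simp add: algebra_simps)
      ultimately show ?thesis
        using DERIV_add[OF _ DERIV_log_prim[OF that]] unfolding gen[symmetric] by blast
    qed
    show "continuous_on S (?\<Psi> b)" if "0 \<le> b" "\<And>x. x \<in> S \<Longrightarrow> - 1 < b * x \<and> b * x < 3" for b S
      by (intro continuous_intros continuous_on_log_prim[OF that]) (use that(2) in fastforce)
  qed (auto simp: log_prim_def)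
  also have "?\<Psi> G \<alpha> - ?\<Psi> (2 - G) (\<alpha> - 2) - (?\<Psi> 1 l1 - ?\<Psi> (2 - G) l1) - (?\<Psi> G l2 - ?\<Psi> 1 l2)
     = ln 2 * (ln (1 + G * \<alpha>) - ln (1 + (2 - G) * (\<alpha> - 2))
     - (ln (1 + 1 * l1) - ln (1 + (2 - G) * l1)) - (ln (1 + G * l2) - ln (1 + 1 * l2))) + log_mass \<alpha>"
    by (simp add: log_mass_def l1_def l2_def algebra_simps)
  also have "\<dots> / mass = ln 2 + pi\<^sup>2 / (18 * ln G)"
    unfolding ln_mass_total log_mass_eq[OF \<alpha>_ge \<alpha>_le]
    using mass_pos by (simp add: mass_def field_simps)
  finally have nn: "(\<integral>\<^sup>+x. ?F x \<partial>\<nu>) = ennreal (ln 2 + pi\<^sup>2 / (18 * ln G))" .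
  have nonneg: "AE x in \<nu>. 0 \<le> ?F x"
    using AE_\<nu>_I by eventually_elim (rule F0, auto simp: mem_I)
  have pos: "0 \<le> ln 2 + pi\<^sup>2 / (18 * ln G)"
    using gold_G_bounds by simp
  have hb: "has_bochner_integral \<nu> ?F (ln 2 + pi\<^sup>2 / (18 * ln G))"
    by (rule has_bochner_integral_nn_integral[OF _ nonneg pos nn]) measurable
  then have iF: "integrable \<nu> ?F" by (rule integrable.intros)
  have "integrable \<nu> (\<lambda>x. (\<lambda>y. ln 2 - y) (?F x))"
    by (intro Bochner_Integration.integrable_diff iF) auto
  moreover have "(\<lambda>y. ln 2 - y) (?F x) = ln \<bar>x\<bar>" for x by simp
  ultimately show int: "integrable \<nu> (\<lambda>x. ln \<bar>x\<bar>)"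
    by (rule back_subst[where P = "integrable \<nu>", OF _ ext])
  have "ln 2 + pi\<^sup>2 / (18 * ln G) = line.expectation ?F"
    using hb by (simp add: has_bochner_integral_iff)
  also have "\<dots> = ln 2 - line.expectation (\<lambda>x. ln \<bar>x\<bar>)"
    using int line.prob_space by (subst Bochner_Integration.integral_diff) auto
  finally show "line.expectation (\<lambda>x. - 2 * ln \<bar>x\<bar>) = pi\<^sup>2 / (9 * ln G)"
    by (simp add: field_simps)
qed

end

section \<open>Cylinders\<close>

text \<open>Pulling an interval back along one increasing branch creates at most the new endpoints \<open>lo\<close>, \<open>hi\<close>.\<close>

lemma interval_pullback:
  fixes f :: "real \<Rightarrow> real"
  assumes mono: "\<And>s t. lo \<le> s \<Longrightarrow> s < t \<Longrightarrow> t \<le> hi \<Longrightarrow> f s < f t"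
    and surj: "\<And>c. f lo < c \<Longrightarrow> c < f hi \<Longrightarrow> \<exists>t. lo < t \<and> t < hi \<and> f t = c"
    and K: "{a<..<b} \<subseteq> K" "K \<subseteq> {a..b}"
    and S: "{lo<..<hi} \<subseteq> S" "S \<subseteq> {lo..hi}"
    and st: "s \<in> S" "t \<in> S" "s < t" "f s \<in> K" "f t \<in> K"
  obtains a' b' where "a' < b'" "a' = lo \<or> (lo < a' \<and> a' < hi \<and> f a' = a)"
    "b' = hi \<or> (lo < b' \<and> b' < hi \<and> f b' = b)"
    "{a'<..<b'} \<subseteq> {t \<in> S. f t \<in> K}" "{t \<in> S. f t \<in> K} \<subseteq> {a'..b'}"
proof -
  have lohi: "lo \<le> s" "t \<le> hi" using S st by auto
  have le: "f x \<le> f y" if "lo \<le> x" "x \<le> y" "y \<le> hi" for x y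
    using mono[of x y] that by (cases "x = y") auto
  have ab: "a \<le> f s" "f t \<le> b" "f s < f t"
    using K st mono[of s t] lohi by auto
  have a_hi: "a < f hi" using ab le[of t hi] lohi st by auto
  have b_lo: "f lo < b" using ab le[of lo s] lohi st by auto
  obtain a' where a': "a' = lo \<and> a \<le> f lo \<or> (lo < a' \<and> a' < hi \<and> f a' = a)"
    using surj[of a] a_hi by (cases "f lo < a") auto
  obtain b' where b': "b' = hi \<and> f hi \<le> b \<or> (lo < b' \<and> b' < hi \<and> f b' = b)"
    using surj[of b] b_lo by (cases "b < f hi") auto
  have range: "lo \<le> a'" "a' \<le> hi" "lo \<le> b'" "b' \<le> hi" using a' b' lohi st by auto
  have sub: "{x \<in> S. f x \<in> K} \<subseteq> {a'..b'}"
  proof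
    fix x assume "x \<in> {x \<in> S. f x \<in> K}"
    then have x: "lo \<le> x" "x \<le> hi" "a \<le> f x" "f x \<le> b" using S K by auto
    have "a' \<le> x"
    proof (rule ccontr)
      assume neg: "\<not> a' \<le> x"
      then have "f x < f a'" using mono[of x a'] x range by auto
      then show False using a' x neg by auto
    qed
    moreover have "x \<le> b'"
    proof (rule ccontr)
      assume neg: "\<not> x \<le> b'"
      then have "f b' < f x" using mono[of b' x] x range by auto
      then show False using b' x neg by auto
    qed
    ultimately show "x \<in> {a'..b'}" by simp
  qed
  have "s \<in> {a'..b'}" "t \<in> {a'..b'}" using sub st by auto
  then have "a' < b'" using st by auto
  moreover have "{a'<..<b'} \<subseteq> {x \<in> S. f x \<in> K}"
  proof
    fix x assume "x \<in> {a'<..<b'}"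
    then have x: "a' < x" "x < b'" "lo < x" "x < hi" using range by auto
    have "f a' < f x" "f x < f b'" using mono[of a' x] mono[of x b'] x range by auto
    then have "a < f x" "f x < b" using a' b' by auto
    then show "x \<in> {x \<in> S. f x \<in> K}" using x S K by auto
  qed
  ultimately show thesis using a' b' sub by (intro that[of a' b']) auto
qed

context odd_cf
begin

abbreviation "digits \<equiv> word \<phi> digit"

text \<open>\<open>xprod n x\<close> squared is the reciprocal of the absolute derivative of
  \<open>\<phi> ^^ n\<close> at x, since each branch has derivative of size 1 / x^2.\<close>

definition xprod :: "nat \<Rightarrow> real \<Rightarrow> real" where
  "xprod n x = (\<Prod>i<n. \<bar>(\<phi> ^^ i) x\<bar>)"

text \<open>The square is the absolute derivative of the second coordinate of
  \<open>\<Phi> ^^ n\<close> in the second variable. The product runs over times 1 to n because 1 /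
  (d + y) has derivative of size v^2 at its new value v.\<close>

definition yprod :: "nat \<Rightarrow> real \<times> real \<Rightarrow> real" where
  "yprod n z = (\<Prod>i<n. snd ((\<Phi> ^^ Suc i) z))"

lemma xprod_0[simp]: "xprod 0 x = 1"
  and xprod_Suc: "xprod (Suc n) x = \<bar>x\<bar> * xprod n (\<phi> x)"
  by (simp_all add: xprod_def prod.lessThan_Suc_shift funpow_swap1 del: prod.lessThan_Suc)

lemma yprod_0[simp]: "yprod 0 z = 1"
  and yprod_Suc: "yprod (Suc n) z = snd (\<Phi> z) * yprod n (\<Phi> z)"
  by (simp_all add: yprod_def prod.lessThan_Suc_shift funpow_swap1 del: prod.lessThan_Suc)

lemma xprod_nonneg: "0 \<le> xprod n x"
  by (simp add: xprod_def prod_nonneg)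

lemma phi_funpow_in_I: "x \<in> I \<Longrightarrow> (\<phi> ^^ n) x \<in> I"
  by (induction n) (auto simp: phi_in_I)

lemma fst_funpow_Phi: "fst ((\<Phi> ^^ n) z) = (\<phi> ^^ n) (fst z)"
  by (induction n) (auto simp: fst_Phi)

lemma digit_eq_0: "x \<in> I \<Longrightarrow> digit x = 0 \<longleftrightarrow> x = 0"
  using ocf_d_ge_1[of x] by (auto simp: digit_def)

lemma digit_sgn:
  assumes "x \<in> I" "digit x = k" "k \<noteq> 0"
  shows "ocf_d \<alpha> x = \<bar>k\<bar>" "sgn x = real_of_int (sgn k)"
    "x = real_of_int (sgn k) / (real_of_int \<bar>k\<bar> + \<phi> x)" "0 < real_of_int \<bar>k\<bar> + \<phi> x" "odd k"
    "x \<noteq> 0"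
proof -
  have x0: "x \<noteq> 0" using assms by (auto simp: digit_def)
  have d: "1 \<le> ocf_d \<alpha> x" by (rule ocf_d_ge_1[OF assms(1) x0])
  show 1: "ocf_d \<alpha> x = \<bar>k\<bar>" and 2: "sgn x = real_of_int (sgn k)"
    using d assms x0 by (auto simp: digit_def split: if_splits)
  have "x = sgn x * \<bar>x\<bar>" by (simp add: sgn_mult_abs)
  also have "\<dots> = real_of_int (sgn k) / (real_of_int \<bar>k\<bar> + \<phi> x)"
    using denom_pos(3)[OF x0] 1 2 by simp
  finally show "x = real_of_int (sgn k) / (real_of_int \<bar>k\<bar> + \<phi> x)" .
  show "0 < real_of_int \<bar>k\<bar> + \<phi> x" using denom_pos(1)[OF x0] 1 by simp
  show "odd k" using odd_ocf_d[of x] 1 by simp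
  show "x \<noteq> 0" by (rule x0)
qed

lemma digit_branch_diff:
  assumes "x \<in> I" "x' \<in> I" "digit x = digit x'" "digit x \<noteq> 0"
  shows "\<bar>x - x'\<bar> = \<bar>x\<bar> * \<bar>x'\<bar> * \<bar>\<phi> x - \<phi> x'\<bar>"
proof -
  define k where "k = digit x"
  note s = digit_sgn[OF assms(1) k_def[symmetric]] and s' = digit_sgn[OF assms(2) assms(3)[symmetric, folded k_def]]
  have k: "k \<noteq> 0" using assms by (simp add: k_def)
  define e e' where "e = real_of_int \<bar>k\<bar> + \<phi> x" and "e' = real_of_int \<bar>k\<bar> + \<phi> x'"
  have e: "0 < e" "0 < e'" and ax: "\<bar>x\<bar> = 1 / e" "\<bar>x'\<bar> = 1 / e'"
    using s(1,4)[OF k] s'(1,4)[OF k] denom_pos(3)[of x] denom_pos(3)[of x'] s(6)[OF k] s'(6)[OF k]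
    by (auto simp: e_def e'_def)
  have "\<bar>x - x'\<bar> = \<bar>\<bar>x\<bar> - \<bar>x'\<bar>\<bar>"
    using s(2)[OF k] s'(2)[OF k] by (auto simp: sgn_if split: if_splits)
  also have "\<dots> = \<bar>(e' - e) / (e * e')\<bar>"
    using e unfolding ax by (simp add: field_simps)
  also have "\<dots> = \<bar>x\<bar> * \<bar>x'\<bar> * \<bar>e' - e\<bar>"
    using e unfolding ax by (simp add: abs_mult)
  also have "\<bar>e' - e\<bar> = \<bar>\<phi> x - \<phi> x'\<bar>" by (simp add: e_def e'_def)
  finally show ?thesis .
qed

text \<open>An identity rather than an estimate: a Moebius map f satisfies |f x - f x'|^2 = |f' x|
  |f' x'| |x - x'|^2.\<close>

lemma cylinder_diff:
  assumes "x \<in> I" "x' \<in> I" "digits n x = digits n x'" "0 \<notin> set (digits n x)"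
  shows "\<bar>x - x'\<bar> = xprod n x * xprod n x' * \<bar>(\<phi> ^^ n) x - (\<phi> ^^ n) x'\<bar>"
  using assms
proof (induction n arbitrary: x x')
  case (Suc n)
  have "\<bar>\<phi> x - \<phi> x'\<bar> = xprod n (\<phi> x) * xprod n (\<phi> x') * \<bar>(\<phi> ^^ n) (\<phi> x) - (\<phi> ^^ n) (\<phi> x')\<bar>"
    using Suc.prems by (intro Suc.IH) (auto simp: phi_in_I)
  moreover have "\<bar>x - x'\<bar> = \<bar>x\<bar> * \<bar>x'\<bar> * \<bar>\<phi> x - \<phi> x'\<bar>"
    using Suc.prems by (intro digit_branch_diff) auto
  ultimately show ?case by (simp add: xprod_Suc funpow_swap1)
qed simp

text \<open>The square root of the invariance of the density: \<Phi> stretches the first coordinate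
  by 1 / x^2 and shrinks the second by v^2.\<close>

lemma Phi_jacobian:
  assumes "z \<in> closed_dom" "fst z \<noteq> 0"
  shows "\<bar>fst z\<bar> * (1 + fst (\<Phi> z) * snd (\<Phi> z)) = snd (\<Phi> z) * (1 + fst z * snd z)"
    and "0 < snd (\<Phi> z)"
proof -
  obtain x y where z: "z = (x, y)" by (cases z)
  define v where "v = 1 / (ocf_d \<alpha> x + sgn x * y)"
  have x: "x \<noteq> 0" using assms z by simp
  have den: "0 < ocf_d \<alpha> x + sgn x * y" using Phi_closed_dom(2)[of x y] assms z by simp
  have P: "\<Phi> z = (\<phi> x, v)" using x by (simp add: z ocf_Phi_def v_def)
  have v: "v * (ocf_d \<alpha> x + sgn x * y) = 1" "0 < v" using den by (auto simp: v_def)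
  have "\<bar>x\<bar> * (1 + \<phi> x * v) = \<bar>x\<bar> * (v * (ocf_d \<alpha> x + sgn x * y) + \<phi> x * v)" using v by simp
  also have "\<dots> = v * (\<bar>x\<bar> * (ocf_d \<alpha> x + \<phi> x) + (\<bar>x\<bar> * sgn x) * y)" by (simp add: algebra_simps)
  also have "\<dots> = v * (1 + x * y)" using denom_pos(2)[OF x] by (simp add: abs_mult_sgn mult.commute)
  finally show "\<bar>fst z\<bar> * (1 + fst (\<Phi> z) * snd (\<Phi> z)) = snd (\<Phi> z) * (1 + fst z * snd z)"
    by (simp add: P) (simp add: z)
  show "0 < snd (\<Phi> z)" using v by (simp add: P)
qed

text \<open>In the relation of \<open>Phi_jacobian\<close> the factor 1 + x y telescopes along the
  orbit.\<close>

lemma xprod_yprod: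
  assumes "z \<in> closed_dom" "0 \<notin> set (digits n (fst z))"
  shows "xprod n (fst z) * (1 + fst ((\<Phi> ^^ n) z) * snd ((\<Phi> ^^ n) z)) = yprod n z * (1 + fst z * snd z)"
    and "0 < yprod n z"
proof -
  have "xprod n (fst z) * (1 + fst ((\<Phi> ^^ n) z) * snd ((\<Phi> ^^ n) z)) = yprod n z * (1 + fst z * snd z) \<and> 0 < yprod n z"
    using assms
  proof (induction n arbitrary: z)
    case (Suc n)
    have "fst z \<noteq> 0" using Suc.prems by (auto simp: digit_def)
    note J = Phi_jacobian[OF Suc.prems(1) this]
    have IH: "xprod n (fst (\<Phi> z)) * (1 + fst ((\<Phi> ^^ n) (\<Phi> z)) * snd ((\<Phi> ^^ n) (\<Phi> z))) = yprod n (\<Phi> z) * (1 + fst (\<Phi> z) * snd (\<Phi> z)) \<and> 0 < yprod n (\<Phi> z)"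
      using Suc.prems by (intro Suc.IH) (auto simp: fst_Phi intro: Phi_closed_dom')
    have "xprod (Suc n) (fst z) * (1 + fst ((\<Phi> ^^ Suc n) z) * snd ((\<Phi> ^^ Suc n) z))
      = \<bar>fst z\<bar> * (xprod n (fst (\<Phi> z)) * (1 + fst ((\<Phi> ^^ n) (\<Phi> z)) * snd ((\<Phi> ^^ n) (\<Phi> z))))"
      by (simp add: xprod_Suc fst_Phi funpow_swap1)
    also have "\<dots> = (\<bar>fst z\<bar> * (1 + fst (\<Phi> z) * snd (\<Phi> z))) * yprod n (\<Phi> z)" using IH by simp
    also have "\<dots> = yprod (Suc n) z * (1 + fst z * snd z)" unfolding J(1) by (simp add: yprod_Suc)
    finally show ?case using IH J(2) by (simp add: yprod_Suc)
  qed simp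
  then show "xprod n (fst z) * (1 + fst ((\<Phi> ^^ n) z) * snd ((\<Phi> ^^ n) z)) = yprod n z * (1 + fst z * snd z)"
    and "0 < yprod n z" by auto
qed

text \<open>10 is the quotient of the bounds 4 and 2/5 in \<open>closed_dom_denom\<close>.\<close>

lemma xprod_yprod_le:
  assumes "z \<in> closed_dom" "0 \<notin> set (digits n (fst z))"
  shows "xprod n (fst z) \<le> 10 * yprod n z" "yprod n z \<le> 10 * xprod n (fst z)"
proof -
  let ?c = "1 + fst z * snd z" and ?c' = "1 + fst ((\<Phi> ^^ n) z) * snd ((\<Phi> ^^ n) z)"
  have "2 / 5 \<le> ?c" "?c \<le> 4" using closed_dom_denom[of "fst z" "snd z"] assms by auto
  moreover have "2 / 5 \<le> ?c'" "?c' \<le> 4"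
    using closed_dom_denom[of "fst ((\<Phi> ^^ n) z)" "snd ((\<Phi> ^^ n) z)"] funpow_Phi_closed_dom[OF assms(1)] by auto
  moreover note eq = xprod_yprod(1)[OF assms] and y = xprod_yprod(2)[OF assms]
  ultimately have c: "2 / 5 \<le> ?c" "?c \<le> 4" "2 / 5 \<le> ?c'" "?c' \<le> 4" and y: "0 \<le> yprod n z" by auto
  note mult_left_mono[OF c(3) xprod_nonneg] mult_left_mono[OF c(4) xprod_nonneg]
    mult_left_mono[OF c(1) y] mult_left_mono[OF c(2) y]
  from this(1)[of n "fst z"] this(2)[of n "fst z"] this(3,4)
  show "xprod n (fst z) \<le> 10 * yprod n z" "yprod n z \<le> 10 * xprod n (fst z)"
    using eq by linarith+
qed

lemma snd_Phi_digit:
  assumes "z \<in> closed_dom" "z' \<in> closed_dom" "digit (fst z) = digit (fst z')" "digit (fst z) \<noteq> 0"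
  shows "\<bar>snd (\<Phi> z) - snd (\<Phi> z')\<bar> = snd (\<Phi> z) * snd (\<Phi> z') * \<bar>snd z - snd z'\<bar>"
proof -
  obtain x y x' y' where z: "z = (x, y)" "z' = (x', y')" by (cases z, cases z')
  define k where "k = digit x"
  have I: "x \<in> I" "x' \<in> I" using assms closed_dom_I z by auto
  have k: "digit x = k" "digit x' = k" "k \<noteq> 0" using assms z by (auto simp: k_def)
  note s = digit_sgn[OF I(1) k(1,3)] and s' = digit_sgn[OF I(2) k(2,3)]
  define e e' where "e = real_of_int \<bar>k\<bar> + real_of_int (sgn k) * y" and "e' = real_of_int \<bar>k\<bar> + real_of_int (sgn k) * y'"
  have e: "0 < e" "0 < e'"
    using Phi_closed_dom(2)[of x y] Phi_closed_dom(2)[of x' y'] s s' assms z by (auto simp: e_def e'_def)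
  have P: "snd (\<Phi> z) = 1 / e" "snd (\<Phi> z') = 1 / e'"
    using s s' by (auto simp: z ocf_Phi_def e_def e'_def)
  have "\<bar>1 / e - 1 / e'\<bar> = \<bar>(e' - e) / (e * e')\<bar>"
    using e by (simp add: field_simps)
  also have "\<dots> = 1 / e * (1 / e') * \<bar>e' - e\<bar>" using e by (simp add: abs_mult)
  also have "\<bar>e' - e\<bar> = \<bar>y - y'\<bar>"
    using k(3) by (auto simp: e_def e'_def sgn_if)
  finally show ?thesis by (simp add: P) (simp add: z)
qed

lemma cylinder_diff_snd:
  assumes "z \<in> closed_dom" "z' \<in> closed_dom" "digits n (fst z) = digits n (fst z')" "0 \<notin> set (digits n (fst z))"
  shows "\<bar>snd ((\<Phi> ^^ n) z) - snd ((\<Phi> ^^ n) z')\<bar> = yprod n z * yprod n z' * \<bar>snd z - snd z'\<bar>"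
  using assms
proof (induction n arbitrary: z z')
  case (Suc n)
  have "\<bar>snd ((\<Phi> ^^ n) (\<Phi> z)) - snd ((\<Phi> ^^ n) (\<Phi> z'))\<bar> = yprod n (\<Phi> z) * yprod n (\<Phi> z') * \<bar>snd (\<Phi> z) - snd (\<Phi> z')\<bar>"
    using Suc.prems by (intro Suc.IH) (auto simp: fst_Phi intro: Phi_closed_dom')
  moreover have "\<bar>snd (\<Phi> z) - snd (\<Phi> z')\<bar> = snd (\<Phi> z) * snd (\<Phi> z') * \<bar>snd z - snd z'\<bar>"
    using Suc.prems by (intro snd_Phi_digit) auto
  ultimately show ?case by (simp add: yprod_Suc funpow_swap1)
qed simp

text \<open>The second coordinates along the orbit depend on the first coordinate only through its
  digits.\<close>

lemma yprod_cong:
  assumes "z \<in> closed_dom" "z' \<in> closed_dom" "digits n (fst z) = digits n (fst z')" "0 \<notin> set (digits n (fst z))"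
    "snd z = snd z'"
  shows "yprod n z = yprod n z'"
  using assms
proof (induction n arbitrary: z z')
  case (Suc n)
  have "snd (\<Phi> z) = snd (\<Phi> z')"
    using Suc.prems snd_Phi_digit[of z z'] by auto
  moreover have "yprod n (\<Phi> z) = yprod n (\<Phi> z')"
    using Suc.prems \<open>snd (\<Phi> z) = snd (\<Phi> z')\<close> by (intro Suc.IH) (auto simp: fst_Phi intro: Phi_closed_dom')
  ultimately show ?case by (simp add: yprod_Suc)
qed simp

text \<open>Start both points at y = 0. Their values of \<open>yprod\<close> coincide, and each
  \<open>xprod\<close> differs from the common value by a factor of at most 10.\<close>

lemma distortion:
  assumes "x \<in> I" "x' \<in> I" "digits n x = digits n x'" "0 \<notin> set (digits n x)"
  shows "xprod n x \<le> 100 * xprod n x'"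
proof -
  have c: "(x, 0) \<in> closed_dom" "(x', 0) \<in> closed_dom" using assms axis_closed_dom by auto
  have "xprod n x \<le> 10 * yprod n (x, 0)" using xprod_yprod_le(1)[OF c(1)] assms by simp
  also have "yprod n (x, 0) = yprod n (x', 0)" by (rule yprod_cong[OF c]) (use assms in auto)
  also have "yprod n (x', 0) \<le> 10 * xprod n x'" using xprod_yprod_le(2)[OF c(2)] assms by simp
  finally show ?thesis by simp
qed

lemma xprod_pos: "x \<in> I \<Longrightarrow> 0 \<notin> set (digits n x) \<Longrightarrow> 0 < xprod n x"
  by (induction n arbitrary: x) (auto simp: xprod_Suc digit_eq_0 phi_in_I)

lemma xprod_le: "x \<in> I \<Longrightarrow> xprod n x \<le> 2 * (9 / 10) ^ (n div 2)"
proof (induction n arbitrary: x rule: induct_nat_012)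
  case 0
  then show ?case by simp
next
  case 1
  then show ?case using \<alpha>_bounds by (auto simp: xprod_Suc mem_I)
next
  case (ge2 n)
  have "xprod (Suc (Suc n)) x = \<bar>x * \<phi> x\<bar> * xprod n (\<phi> (\<phi> x))"
    by (simp add: xprod_Suc abs_mult)
  also have "\<dots> \<le> 9 / 10 * (2 * (9 / 10) ^ (n div 2))"
    using two_step_contraction[OF ge2.prems] ge2.IH(1)[OF phi_in_I] xprod_nonneg
    by (intro mult_mono) auto
  finally show ?case by simp
qed

section \<open>Inverse branches and the images of cylinders\<close>

definition cylinder :: "int list \<Rightarrow> real set" where
  "cylinder w = {x \<in> I. digits (length w) x = w}"

lemma digit_branch_convex:
  assumes "x \<in> I" "x' \<in> I" "digit x = k" "digit x' = k" "k \<noteq> 0" "x \<le> t" "t \<le> x'"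
  shows "t \<in> I" "digit t = k" "\<phi> x \<le> \<phi> t \<and> \<phi> t \<le> \<phi> x' \<or> \<phi> x' \<le> \<phi> t \<and> \<phi> t \<le> \<phi> x"
proof -
  note s = digit_sgn[OF assms(1,3,5)] and s' = digit_sgn[OF assms(2,4,5)]
  show tI: "t \<in> I" using assms by (auto simp: mem_I)
  define u where "u = 1 / \<bar>t\<bar> - real_of_int \<bar>k\<bar>"
  have phi: "\<phi> x = 1 / \<bar>x\<bar> - real_of_int \<bar>k\<bar>" "\<phi> x' = 1 / \<bar>x'\<bar> - real_of_int \<bar>k\<bar>"
    using s s' by (auto simp: phi_eq)
  have sign: "0 < x \<and> 0 < k \<or> x' < 0 \<and> k < 0"
    using s(2) s'(2) assms(5-7) by (auto simp: sgn_if split: if_splits)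
  then have between: "\<phi> x \<le> u \<and> u \<le> \<phi> x' \<or> \<phi> x' \<le> u \<and> u \<le> \<phi> x"
  proof
    assume "0 < x \<and> 0 < k"
    then have pos: "0 < x" "0 < t" "0 < x'" using assms by auto
    have "1 / t \<le> 1 / x" by (rule frac_le) (use assms pos in auto)
    moreover have "1 / x' \<le> 1 / t" by (rule frac_le) (use assms pos in auto)
    ultimately show ?thesis using pos unfolding phi u_def by auto
  next
    assume "x' < 0 \<and> k < 0"
    then have neg: "x < 0" "t < 0" "x' < 0" using assms by auto
    have "1 / (- x) \<le> 1 / (- t)" by (rule frac_le) (use assms neg in auto)
    moreover have "1 / (- t) \<le> 1 / (- x')" by (rule frac_le) (use assms neg in auto)
    ultimately show ?thesis using neg unfolding phi u_def by auto
  qed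
  then have uI: "u \<in> I" using phi_in_I[of x] phi_in_I[of x'] by (auto simp: mem_I)
  have t0: "t \<noteq> 0" using sign assms by auto
  have "0 < real_of_int \<bar>k\<bar> + u" "\<bar>t\<bar> = 1 / (real_of_int \<bar>k\<bar> + u)" using t0 by (auto simp: u_def)
  then have "ocf_d \<alpha> t = \<bar>k\<bar>" "\<phi> t = u"
    using ocf_d_eqI[where d = "\<bar>k\<bar>" and u = u and x = t] uI s(5) by auto
  then show "digit t = k" "\<phi> x \<le> \<phi> t \<and> \<phi> t \<le> \<phi> x' \<or> \<phi> x' \<le> \<phi> t \<and> \<phi> t \<le> \<phi> x"
    using sign assms between t0 by (auto simp: digit_def)
qed

text \<open>Each branch is monotone, increasing or decreasing, so a point between x and x' keeps
  lying between their images. This lets two points of a cylinder bound its measure from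
  below.\<close>

lemma cylinder_convex:
  assumes "x \<in> cylinder w" "x' \<in> cylinder w" "0 \<notin> set w" "x \<le> t" "t \<le> x'"
  shows "t \<in> cylinder w"
  using assms
proof (induction w arbitrary: x x' t)
  case Nil
  then show ?case by (auto simp: cylinder_def mem_I)
next
  case (Cons k w)
  have x: "x \<in> I" "x' \<in> I" "digit x = k" "digit x' = k" "k \<noteq> 0"
    using Cons.prems by (auto simp: cylinder_def)
  note conv = digit_branch_convex[OF x Cons.prems(4,5)]
  have "\<phi> x \<in> cylinder w" "\<phi> x' \<in> cylinder w"
    using Cons.prems by (auto simp: cylinder_def phi_in_I)
  then have "\<phi> t \<in> cylinder w"
    using conv(3) Cons.IH[of "\<phi> x" "\<phi> x'" "\<phi> t"] Cons.IH[of "\<phi> x'" "\<phi> x" "\<phi> t"] Cons.prems(3) by auto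
  then show ?case using conv(1,2) by (auto simp: cylinder_def)
qed

text \<open>The left end of the image of a branch. Only the two branches with partial quotient 1,
  cut off by the ends of the interval, can fail to be full.\<close>

definition branch_low :: "int \<Rightarrow> real" where
  "branch_low k = (if k = 1 then l1 else if k = -1 then l2 else \<alpha> - 2)"

definition branch :: "int \<Rightarrow> real \<Rightarrow> real" where
  "branch k t = real_of_int (sgn k) / (real_of_int \<bar>k\<bar> + t)"

lemma branch_low_bounds: "\<alpha> - 2 \<le> branch_low k" "branch_low k \<le> \<alpha>"
  using l_bounds \<alpha>_bounds by (auto simp: branch_low_def)

lemma odd_int_cases:
  fixes k :: int
  assumes "odd k"
  obtains "k = 1" | "k = -1" | "3 \<le> \<bar>k\<bar>"
proof -
  have "k = 1 \<or> k = -1 \<or> 3 \<le> \<bar>k\<bar>" using assms by presburger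
  then show thesis using that by blast
qed

lemma branch_denom_pos:
  assumes "odd k" "branch_low k \<le> t"
  shows "0 < real_of_int \<bar>k\<bar> + t"
proof (rule odd_int_cases[OF assms(1)])
  assume "3 \<le> \<bar>k\<bar>"
  then have "3 \<le> real_of_int \<bar>k\<bar>" by linarith
  then show ?thesis using assms(2) branch_low_bounds(1)[of k] \<alpha>_bounds by linarith
qed (use assms l_pos in \<open>auto simp: branch_low_def\<close>)

text \<open>For |k| >= 3 the point has absolute value below 1 / (1 + \<alpha>), which by
  \<open>\<alpha>_quad\<close> is at most \<alpha> and at most 2 - \<alpha>. For |k| = 1 the bound
  on t says that the point has not passed the end of \<open>I\<close>.\<close>

lemma branch_inverse:
  assumes k: "odd k" and t: "branch_low k < t" "t < \<alpha>"
  shows "branch k t \<in> I" "digit (branch k t) = k" "\<phi> (branch k t) = t"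
proof -
  have pos: "0 < real_of_int \<bar>k\<bar> + t" using branch_denom_pos[OF k, of t] t by simp
  have tI: "t \<in> I" using t branch_low_bounds(1)[of k] by (auto simp: mem_I)
  have k0: "k \<noteq> 0" using k by auto
  have abs: "\<bar>branch k t\<bar> = 1 / (real_of_int \<bar>k\<bar> + t)" using pos k0 by (simp add: branch_def abs_div sgn_if)
  have d: "ocf_d \<alpha> (branch k t) = \<bar>k\<bar>" and p: "\<phi> (branch k t) = t"
    using ocf_d_eqI[where d = "\<bar>k\<bar>" and u = t and x = "branch k t"] k tI pos abs by auto
  show "\<phi> (branch k t) = t" by (rule p)
  have sgn: "sgn (branch k t) = real_of_int (sgn k)" 
  proof -
    have "sgn (branch k t) = sgn (real_of_int (sgn k)) / sgn (real_of_int \<bar>k\<bar> + t)"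
      by (simp only: branch_def sgn_divide)
    also have "sgn (real_of_int \<bar>k\<bar> + t) = 1" using pos by (simp only: sgn_pos)
    finally show ?thesis using k0 by (simp add: sgn_if)
  qed
  then show "digit (branch k t) = k"
    using d k0 by (auto simp: digit_def sgn_if split: if_splits)
  show "branch k t \<in> I"
  proof (rule odd_int_cases[OF k])
    assume k1: "k = 1"
    have "1 < \<alpha> * (1 + t)"
    proof -
      have "\<alpha> * (1 + l1) < \<alpha> * (1 + t)" using t k1 \<alpha>_bounds by (simp add: branch_low_def)
      then show ?thesis using one_plus_l1 by (simp add: mult.commute)
    qed
    then have "1 / (1 + t) < \<alpha>" using pos k1 by (simp add: pos_divide_less_eq)
    moreover have "0 < 1 / (1 + t)" using pos k1 by simp
    moreover have "branch k t = 1 / (1 + t)" using k1 by (simp add: branch_def)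
    ultimately show ?thesis unfolding mem_I using \<alpha>_bounds by - (intro conjI; linarith)
  next
    assume k1: "k = -1"
    have "1 \<le> (2 - \<alpha>) * (1 + t)"
    proof -
      have "(2 - \<alpha>) * (1 + l2) \<le> (2 - \<alpha>) * (1 + t)" using t k1 \<alpha>_bounds by (intro mult_left_mono) (auto simp: branch_low_def)
      then show ?thesis using one_plus_l2 by (simp add: mult.commute)
    qed
    then have "1 / (1 + t) \<le> 2 - \<alpha>" using pos k1 by (simp add: pos_divide_le_eq)
    moreover have "0 < 1 / (1 + t)" using pos k1 by simp
    moreover have "branch k t = - (1 / (1 + t))" using k1 by (simp add: branch_def)
    ultimately show ?thesis unfolding mem_I using \<alpha>_bounds by - (intro conjI; linarith)
  next
    assume k3: "3 \<le> \<bar>k\<bar>"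
    then have "1 + \<alpha> < real_of_int \<bar>k\<bar> + t" using t branch_low_bounds(1)[of k] by linarith
    then have "1 / (real_of_int \<bar>k\<bar> + t) < 1 / (1 + \<alpha>)" using \<alpha>_bounds by (intro divide_strict_left_mono) auto
    moreover have "1 \<le> \<alpha> * (1 + \<alpha>)" "1 \<le> (2 - \<alpha>) * (1 + \<alpha>)"
      using \<alpha>_quad by (simp_all add: algebra_simps)
    then have "1 / (1 + \<alpha>) \<le> \<alpha>" "1 / (1 + \<alpha>) \<le> 2 - \<alpha>"
      using \<alpha>_bounds by (simp_all only: pos_divide_le_eq)
    ultimately have "\<bar>branch k t\<bar> < \<alpha>" "\<bar>branch k t\<bar> < 2 - \<alpha>" unfolding abs by auto
    then show ?thesis by (auto simp: mem_I)
  qed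
qed

lemma branch_phi:
  assumes "x \<in> I" "digit x = k" "k \<noteq> 0"
  shows "branch k (\<phi> x) = x" "branch_low k \<le> \<phi> x" "\<phi> x < \<alpha>" "odd k"
proof -
  note s = digit_sgn[OF assms]
  show "branch k (\<phi> x) = x" "odd k" using s by (auto simp: branch_def)
  show "\<phi> x < \<alpha>" by (rule phi_bounds)
  show "branch_low k \<le> \<phi> x"
    using first_branch_pos[of x] first_branch_neg[of x] assms s phi_bounds(1)[of x]
    by (auto simp: branch_low_def sgn_if split: if_splits)
qed

lemma branch_strict_mono:
  assumes k: "odd k" and st: "branch_low k \<le> s" "s < t"
  shows "k < 0 \<Longrightarrow> branch k s < branch k t" "0 < k \<Longrightarrow> branch k t < branch k s"
proof -
  have "0 < real_of_int \<bar>k\<bar> + s" using branch_denom_pos[OF k st(1)] .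
  then have "1 / (real_of_int \<bar>k\<bar> + t) < 1 / (real_of_int \<bar>k\<bar> + s)" using st by (intro divide_strict_left_mono) auto
  then show "k < 0 \<Longrightarrow> branch k s < branch k t" "0 < k \<Longrightarrow> branch k t < branch k s"
    by (auto simp: branch_def)
qed

lemma branch_surj:
  assumes k: "odd k" and c: "branch k (branch_low k) < c \<and> c < branch k \<alpha> \<or> branch k \<alpha> < c \<and> c < branch k (branch_low k)"
  shows "\<exists>t. branch_low k < t \<and> t < \<alpha> \<and> branch k t = c"
proof -
  have p1: "0 < real_of_int \<bar>k\<bar> + branch_low k" using branch_denom_pos[OF k] by simp
  have p2: "0 < real_of_int \<bar>k\<bar> + \<alpha>" using p1 branch_low_bounds(2)[of k] by linarith
  have k0: "k \<noteq> 0" using k by auto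
  define t where "t = 1 / \<bar>c\<bar> - real_of_int \<bar>k\<bar>"
  have mono: "1 / (real_of_int \<bar>k\<bar> + \<alpha>) \<le> 1 / (real_of_int \<bar>k\<bar> + branch_low k)"
    using p1 p2 branch_low_bounds(2)[of k] by (intro frac_le) auto
  have q: "0 < 1 / (real_of_int \<bar>k\<bar> + \<alpha>)" using p2 by simp
  define L U where "L = 1 / (real_of_int \<bar>k\<bar> + \<alpha>)" and "U = 1 / (real_of_int \<bar>k\<bar> + branch_low k)"
  have b: "branch k \<alpha> = real_of_int (sgn k) * L" "branch k (branch_low k) = real_of_int (sgn k) * U"
    by (simp_all add: branch_def L_def U_def)
  have LU: "0 < L" "L \<le> U" using q mono by (simp_all only: L_def U_def)
  have "sgn c = real_of_int (sgn k) \<and> L < \<bar>c\<bar> \<and> \<bar>c\<bar> < U"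
  proof (cases "0 < k")
    case True
    then have "L < c" "c < U" using c LU unfolding b by auto
    then show ?thesis using True LU by (auto simp: sgn_if)
  next
    case False
    then have "L < - c" "- c < U" using c LU k0 unfolding b by auto
    then show ?thesis using False k0 LU by (auto simp: sgn_if)
  qed
  then have cc: "sgn c = real_of_int (sgn k)" "1 / (real_of_int \<bar>k\<bar> + \<alpha>) < \<bar>c\<bar>" "\<bar>c\<bar> < 1 / (real_of_int \<bar>k\<bar> + branch_low k)"
    by (auto simp: L_def U_def)
  have c0: "0 < \<bar>c\<bar>" using cc(2) q by linarith
  have "1 / \<bar>c\<bar> < real_of_int \<bar>k\<bar> + \<alpha>" using cc(2) c0 p2 by (simp add: field_simps)
  moreover have "real_of_int \<bar>k\<bar> + branch_low k < 1 / \<bar>c\<bar>" using cc(3) c0 p1 by (simp add: field_simps)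
  moreover have "branch k t = c"
  proof -
    have "branch k t = sgn c * \<bar>c\<bar>" unfolding cc(1) using c0 by (simp add: branch_def t_def)
    then show ?thesis by (simp add: sgn_mult_abs)
  qed
  ultimately show ?thesis by (intro exI[of _ t]) (auto simp: t_def)
qed

text \<open>A new end point is an end of a branch image or the image of an old end point under
  \<open>\<phi>\<close>. Each point has only one image, so the set grows linearly, and the number of
  pairs of end points is polynomial.\<close>

primrec endpoints :: "nat \<Rightarrow> real set" where
  "endpoints 0 = {\<alpha> - 2, \<alpha>}"
| "endpoints (Suc n) = {\<alpha> - 2, \<alpha>, l1, l2} \<union> \<phi> ` endpoints n"

lemma finite_endpoints: "finite (endpoints n)"
  by (induction n) auto

lemma card_endpoints: "card (endpoints n) \<le> 4 * n + 2"
proof (induction n)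
  case 0
  then show ?case by (simp add: card_insert_if)
next
  case (Suc n)
  have "card (endpoints (Suc n)) \<le> card {\<alpha> - 2, \<alpha>, l1, l2} + card (\<phi> ` endpoints n)"
    by (simp only: endpoints.simps) (rule card_Un_le)
  also have "card {\<alpha> - 2, \<alpha>, l1, l2} \<le> 4" by (simp add: card_insert_if)
  also have "card (\<phi> ` endpoints n) \<le> card (endpoints n)" by (rule card_image_le[OF finite_endpoints])
  finally show ?case using Suc by simp
qed

text \<open>Which of its end points \<open>K\<close> contains varies, so it is only squeezed between
  an open and a closed interval. Two different points keep the new interval nondegenerate. Inverse
  branches increase for k < 0 and decrease for k > 0; the second case is reduced to the first kind
  by reflection.\<close>

lemma branch_interval:
  assumes K: "{a<..<b} \<subseteq> K" "K \<subseteq> {a..b}" "K \<subseteq> I" and k: "k \<noteq> 0"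
    and u: "u \<in> K" "u' \<in> K" "digit u = k" "digit u' = k" "u \<noteq> u'"
  obtains a' b' where "a' < b'" "a' \<in> {\<alpha> - 2, \<alpha>, l1, l2} \<union> \<phi> ` {a, b}" "b' \<in> {\<alpha> - 2, \<alpha>, l1, l2} \<union> \<phi> ` {a, b}"
    "{a'<..<b'} \<subseteq> \<phi> ` {x \<in> K. digit x = k}" "\<phi> ` {x \<in> K. digit x = k} \<subseteq> {a'..b'}"
proof -
  have odd: "odd k" using branch_phi(4)[of u k] u K k by auto
  define S where "S = \<phi> ` {x \<in> I. digit x = k}"
  let ?lo = "branch_low k"
  have S1: "{?lo<..<\<alpha>} \<subseteq> S"
  proof
    fix t assume "t \<in> {?lo<..<\<alpha>}"
    then show "t \<in> S" using branch_inverse[OF odd, of t] unfolding S_def by (intro image_eqI[of _ _ "branch k t"]) auto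
  qed
  have S2: "S \<subseteq> {?lo..\<alpha>}"
    using branch_phi(2)[OF _ _ k] by (auto simp: S_def intro: less_imp_le[OF phi_bounds(2)])
  have image: "\<phi> ` {x \<in> K. digit x = k} = {t \<in> S. branch k t \<in> K}"
  proof (intro equalityI subsetI)
    fix t assume "t \<in> \<phi> ` {x \<in> K. digit x = k}"
    then obtain x where x: "x \<in> K" "digit x = k" "t = \<phi> x" by auto
    then show "t \<in> {t \<in> S. branch k t \<in> K}" using branch_phi(1)[of x k] K k by (auto simp: S_def)
  next
    fix t assume "t \<in> {t \<in> S. branch k t \<in> K}"
    then obtain x where x: "x \<in> I" "digit x = k" "t = \<phi> x" "branch k t \<in> K" by (auto simp: S_def)
    then show "t \<in> \<phi> ` {x \<in> K. digit x = k}" using branch_phi(1)[of x k] k by auto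
  qed
  have uI: "u \<in> I" "u' \<in> I" using u K by auto
  have lo: "?lo \<in> {\<alpha> - 2, \<alpha>, l1, l2}" by (auto simp: branch_low_def)
  have is_end: "t \<in> {\<alpha> - 2, \<alpha>, l1, l2} \<union> \<phi> ` {a, b}"
    if "t = ?lo \<or> t = \<alpha> \<or> (?lo < t \<and> t < \<alpha> \<and> (branch k t = a \<or> branch k t = b))" for t
    using that lo branch_inverse(3)[OF odd, of t] by auto
  have ne: "\<phi> u \<noteq> \<phi> u'" using branch_phi(1)[OF uI(1) u(3) k] branch_phi(1)[OF uI(2) u(4) k] u(5) by auto
  have uS: "\<phi> u \<in> S" "\<phi> u' \<in> S" "branch k (\<phi> u) \<in> K" "branch k (\<phi> u') \<in> K"
    using uI u branch_phi(1)[OF uI(1) u(3) k] branch_phi(1)[OF uI(2) u(4) k] by (auto simp: S_def)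
  obtain s t where st: "s \<in> S" "t \<in> S" "s < t" "branch k s \<in> K" "branch k t \<in> K"
    using ne uS by (cases "\<phi> u < \<phi> u'") (auto simp: not_less)
  show thesis
  proof (cases "0 < k")
    case False
    then have neg: "k < 0" using k by simp
    obtain a' b' where *: "a' < b'" "a' = ?lo \<or> (?lo < a' \<and> a' < \<alpha> \<and> branch k a' = a)"
      "b' = \<alpha> \<or> (?lo < b' \<and> b' < \<alpha> \<and> branch k b' = b)"
      "{a'<..<b'} \<subseteq> {t \<in> S. branch k t \<in> K}" "{t \<in> S. branch k t \<in> K} \<subseteq> {a'..b'}"
      by (rule interval_pullback[of ?lo \<alpha> "branch k" a b K S s t])
         (use branch_strict_mono(1)[OF odd _ _ neg] branch_surj[OF odd] K S1 S2 st in auto)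
    show thesis
      by (rule that[of a' b']) (use * is_end[of a'] is_end[of b'] in \<open>auto simp: image\<close>)
  next
    case True
    have surj: "\<exists>t. ?lo < t \<and> t < \<alpha> \<and> - branch k t = c" if "- branch k ?lo < c" "c < - branch k \<alpha>" for c
      using branch_surj[OF odd, of "- c"] that by (auto simp: minus_equation_iff)
    have K': "{- b<..<- a} \<subseteq> uminus ` K" "uminus ` K \<subseteq> {- b..- a}"
    proof -
      show "{- b<..<- a} \<subseteq> uminus ` K"
      proof
        fix x assume "x \<in> {- b<..<- a}"
        then have "- x \<in> K" using K(1) by auto
        then show "x \<in> uminus ` K" by (intro image_eqI[of _ _ "- x"]) auto
      qed
      show "uminus ` K \<subseteq> {- b..- a}" using K(2) by auto
    qed
    have mem: "- branch k t \<in> uminus ` K \<longleftrightarrow> branch k t \<in> K" for t by auto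
    obtain a' b' where *: "a' < b'" "a' = ?lo \<or> (?lo < a' \<and> a' < \<alpha> \<and> - branch k a' = - b)"
      "b' = \<alpha> \<or> (?lo < b' \<and> b' < \<alpha> \<and> - branch k b' = - a)"
      "{a'<..<b'} \<subseteq> {t \<in> S. - branch k t \<in> uminus ` K}" "{t \<in> S. - branch k t \<in> uminus ` K} \<subseteq> {a'..b'}"
      by (rule interval_pullback[of ?lo \<alpha> "\<lambda>t. - branch k t" "- b" "- a" "uminus ` K" S s t])
         (use branch_strict_mono(2)[OF odd _ _ True] surj K' S1 S2 st in \<open>auto simp only: mem neg_less_iff_less\<close>)
    show thesis
      by (rule that[of a' b']) (use * is_end[of a'] is_end[of b'] in \<open>auto simp: image mem\<close>)
  qed
qed

lemma cylinder_snoc: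
  "cylinder (w @ [k]) = {x \<in> cylinder w. digit ((\<phi> ^^ length w) x) = k}"
  by (auto simp: cylinder_def word_add[of _ _ "length w" 1, simplified])

text \<open>The two different points rule out cylinders consisting of one point, for which no a < b
  exists.\<close>

lemma cylinder_image:
  assumes "0 \<notin> set w" "x \<in> cylinder w" "x' \<in> cylinder w" "x \<noteq> x'"
  shows "\<exists>a\<in>endpoints (length w). \<exists>b\<in>endpoints (length w). a < b \<and>
    {a<..<b} \<subseteq> (\<phi> ^^ length w) ` cylinder w \<and> (\<phi> ^^ length w) ` cylinder w \<subseteq> {a..b}"
  using assms
\<comment> \<open>A letter appended on the right restricts the image already reached to one branch
  and applies \<open>\<phi>\<close> once more.\<close>
proof (induction w arbitrary: x x' rule: rev_induct)
  case Nil
  then show ?case using \<alpha>_bounds by (auto simp: cylinder_def mem_I)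
next
  case (snoc k w)
  let ?n = "length w"
  define K where "K = (\<phi> ^^ ?n) ` cylinder w"
  have x: "x \<in> cylinder w" "x' \<in> cylinder w" "digit ((\<phi> ^^ ?n) x) = k" "digit ((\<phi> ^^ ?n) x') = k"
    using snoc.prems by (auto simp: cylinder_snoc)
  obtain a b where ab: "a \<in> endpoints ?n" "b \<in> endpoints ?n" "a < b" "{a<..<b} \<subseteq> K" "K \<subseteq> {a..b}"
    using snoc.IH[OF _ x(1,2) snoc.prems(4)] snoc.prems(1) unfolding K_def by auto
  have KI: "K \<subseteq> I" by (auto simp: K_def cylinder_def phi_funpow_in_I)
  have "\<bar>x - x'\<bar> = xprod ?n x * xprod ?n x' * \<bar>(\<phi> ^^ ?n) x - (\<phi> ^^ ?n) x'\<bar>"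
    using x snoc.prems(1) by (intro cylinder_diff) (auto simp: cylinder_def)
  then have ne: "(\<phi> ^^ ?n) x \<noteq> (\<phi> ^^ ?n) x'" using snoc.prems(4) by auto
  have k: "k \<noteq> 0" using snoc.prems(1) by auto
  obtain a' b' where *: "a' < b'" "a' \<in> {\<alpha> - 2, \<alpha>, l1, l2} \<union> \<phi> ` {a, b}" "b' \<in> {\<alpha> - 2, \<alpha>, l1, l2} \<union> \<phi> ` {a, b}"
    "{a'<..<b'} \<subseteq> \<phi> ` {x \<in> K. digit x = k}" "\<phi> ` {x \<in> K. digit x = k} \<subseteq> {a'..b'}"
    using branch_interval[OF ab(4,5) KI k, of "(\<phi> ^^ ?n) x" "(\<phi> ^^ ?n) x'"] x ne
    by (auto simp: K_def)
  have E: "(\<phi> ^^ length (w @ [k])) ` cylinder (w @ [k]) = \<phi> ` {x \<in> K. digit x = k}"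
    by (auto simp: K_def cylinder_snoc)
  have "a' \<in> endpoints (length (w @ [k]))" "b' \<in> endpoints (length (w @ [k]))"
    using *(2,3) ab(1,2) by auto
  then show ?case
    unfolding E using *(1,4,5) by (intro bexI[of _ a'] bexI[of _ b'] conjI)
qed

section \<open>Comparison of cylinders with Lebesgue measure\<close>

definition \<nu>_max :: real where "\<nu>_max = 25 / 2 / mass"
definition \<nu>_min :: real where "\<nu>_min = (2 - G) / 16 / mass"

lemma \<nu>_max_pos: "0 < \<nu>_max" and \<nu>_min_pos: "0 < \<nu>_min"
  using mass_pos gold_G_bounds by (auto simp: \<nu>_max_def \<nu>_min_def)

lemma \<nu>_eq_nn_integral:
  assumes [measurable]: "A \<in> sets borel"
  shows "emeasure \<nu> A = (\<integral>\<^sup>+z. ennreal (dens z) * indicator open_dom z * indicator (A \<times> UNIV) z \<partial>lborel)"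
proof -
  have "A \<times> (UNIV :: real set) \<in> sets borel"
    unfolding borel_prod[symmetric] by measurable
  moreover have "emeasure \<nu> A = emeasure \<mu> (A \<times> UNIV)"
    unfolding \<nu>_def by (subst emeasure_distr) (auto simp: vimage_def intro!: arg_cong[where f = "emeasure \<mu>"])
  ultimately show ?thesis by (simp add: \<mu>_def emeasure_density)
qed

text \<open>1 + x y >= 2/5 bounds the density by 25/4, and the fibres have height less than
  2.\<close>

lemma \<nu>_le:
  assumes A[measurable]: "A \<in> sets borel"
  shows "emeasure \<nu> A \<le> ennreal \<nu>_max * emeasure lborel A"
proof -
  have [measurable]: "A \<times> {0..2 :: real} \<in> sets (borel \<Otimes>\<^sub>M borel)" by measurable
  have "emeasure \<nu> A \<le> (\<integral>\<^sup>+z. ennreal (25 / 4 / mass) * indicator (A \<times> {0..2 :: real}) z \<partial>(lborel \<Otimes>\<^sub>M lborel))"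
    unfolding \<nu>_eq_nn_integral[OF A] lborel_prod
  proof (rule nn_integral_mono)
    fix z :: "real \<times> real"
    show "ennreal (dens z) * indicator open_dom z * indicator (A \<times> UNIV) z \<le> ennreal (25 / 4 / mass) * indicator (A \<times> {0..2}) z"
    proof (cases "z \<in> open_dom \<and> fst z \<in> A")
      case True
      then have "2 / 5 \<le> 1 + fst z * snd z" "0 \<le> snd z" "snd z \<le> 2"
        using closed_dom_denom(1)[of "fst z" "snd z"] open_dom_y[of "fst z" "snd z"] open_subset_closed gold_G_bounds by auto
      moreover from this have "(2 / 5)\<^sup>2 \<le> (1 + fst z * snd z)\<^sup>2" by (intro power_mono) auto
      then have "1 / (1 + fst z * snd z)\<^sup>2 \<le> 1 / (2 / 5)\<^sup>2" by (intro frac_le) auto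
      then have "dens z \<le> 25 / 4 / mass"
        unfolding dens_def using mass_pos by (intro divide_right_mono) (auto simp: power2_eq_square)
      ultimately show ?thesis using True by (auto simp: indicator_def mem_Times_iff intro!: ennreal_leI)
    qed (auto simp: indicator_def)
  qed
  also have "\<dots> = ennreal (25 / 4 / mass) * emeasure (lborel \<Otimes>\<^sub>M lborel) (A \<times> {0..2 :: real})"
    by (rule nn_integral_cmult_indicator) (simp add: sets_lborel cong: sets_pair_measure_cong)
  also have "emeasure (lborel \<Otimes>\<^sub>M lborel) (A \<times> {0..2 :: real}) = emeasure lborel A * emeasure lborel {0..2 :: real}"
    by (rule lborel.emeasure_pair_measure_Times) auto
  also have "ennreal (25 / 4 / mass) * (emeasure lborel A * emeasure lborel {0..2 :: real}) = ennreal \<nu>_max * emeasure lborel A"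
  proof -
    have "ennreal (25 / 4 / mass) * ennreal 2 = ennreal \<nu>_max"
      using mass_pos by (subst ennreal_mult[symmetric]) (auto simp: \<nu>_max_def)
    moreover have "emeasure lborel {0..2 :: real} = ennreal 2" by simp
    moreover have "ennreal (25 / 4 / mass) * (emeasure lborel A * ennreal 2) = (ennreal (25 / 4 / mass) * ennreal 2) * emeasure lborel A"
      by (simp only: mult_ac)
    ultimately show ?thesis by (simp only:)
  qed
  finally show ?thesis .
qed

text \<open>The fibre over every point of \<open>I\<close> contains the interval from 0 to 2 - G,
  and 1 + x y <= 4 bounds the density below by 1/16.\<close>

lemma \<nu>_ge:
  assumes A[measurable]: "A \<in> sets borel" and AI: "A \<subseteq> I"
  shows "ennreal \<nu>_min * emeasure lborel A \<le> emeasure \<nu> A"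
proof -
  have "ennreal \<nu>_min * emeasure lborel A = ennreal (1 / 16 / mass) * (emeasure lborel A * emeasure lborel {0<..<2 - G})"
  proof -
    have "ennreal (1 / 16 / mass) * ennreal (2 - G) = ennreal \<nu>_min"
      using mass_pos gold_G_bounds by (subst ennreal_mult[symmetric]) (auto simp: \<nu>_min_def)
    moreover have "emeasure lborel {0<..<2 - G} = ennreal (2 - G)" using gold_G_bounds by simp
    ultimately show ?thesis by (simp add: mult_ac)
  qed
  also have "\<dots> = ennreal (1 / 16 / mass) * emeasure (lborel \<Otimes>\<^sub>M lborel) (A \<times> {0<..<2 - G})"
    by (subst lborel.emeasure_pair_measure_Times) auto
  also have "\<dots> = (\<integral>\<^sup>+z. ennreal (1 / 16 / mass) * indicator (A \<times> {0<..<2 - G}) z \<partial>(lborel \<Otimes>\<^sub>M lborel))"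
    by (rule nn_integral_cmult_indicator[symmetric]) (simp add: sets_lborel cong: sets_pair_measure_cong)
  also have "\<dots> \<le> emeasure \<nu> A"
    unfolding \<nu>_eq_nn_integral[OF A] lborel_prod
  proof (rule nn_integral_mono)
    fix z :: "real \<times> real"
    show "ennreal (1 / 16 / mass) * indicator (A \<times> {0<..<2 - G}) z \<le> ennreal (dens z) * indicator open_dom z * indicator (A \<times> UNIV) z"
    proof (cases "z \<in> A \<times> {0<..<2 - G}")
      case True
      then have "(fst z, snd z) \<in> open_dom" using AI by (auto simp: open_dom_def)
      then have z: "z \<in> open_dom" by simp
      then have "2 / 5 \<le> 1 + fst z * snd z" "1 + fst z * snd z \<le> 4"
        using closed_dom_denom[of "fst z" "snd z"] open_subset_closed by auto
      moreover from this have "(1 + fst z * snd z)\<^sup>2 \<le> 4\<^sup>2" by (intro power_mono) auto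
      ultimately have "1 / 4\<^sup>2 \<le> 1 / (1 + fst z * snd z)\<^sup>2" by (intro frac_le) auto
      then have "1 / 16 / mass \<le> dens z"
        unfolding dens_def using mass_pos by (intro divide_right_mono) auto
      then show ?thesis using True z by (auto simp: indicator_def mem_Times_iff intro!: ennreal_leI)
    qed (auto simp: indicator_def)
  qed
  finally show ?thesis .
qed

lemma \<nu>_interval_le:
  assumes "a \<le> b"
  shows "line.prob {a..b} \<le> \<nu>_max * (b - a)"
proof -
  have "ennreal (line.prob {a..b}) \<le> ennreal (\<nu>_max * (b - a))"
    using \<nu>_le[of "{a..b}"] assms \<nu>_max_pos
    by (simp add: line.emeasure_eq_measure ennreal_mult)
  then show ?thesis using assms \<nu>_max_pos by (subst (asm) ennreal_le_iff) auto
qed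

lemma \<nu>_interval_ge:
  assumes "a \<le> b" "{a..b} \<subseteq> I"
  shows "\<nu>_min * (b - a) \<le> line.prob {a..b}"
proof -
  have "ennreal (\<nu>_min * (b - a)) \<le> ennreal (line.prob {a..b})"
    using \<nu>_ge[of "{a..b}"] assms \<nu>_min_pos
    by (simp add: line.emeasure_eq_measure ennreal_mult)
  then show ?thesis by (subst (asm) ennreal_le_iff) auto
qed

lemma digits_measurable[measurable]: "digits n \<in> borel \<rightarrow>\<^sub>M count_space UNIV"
proof -
  have "digits n \<in> \<nu> \<rightarrow>\<^sub>M count_space UNIV"
    by (rule line.word_measurable) measurable
  then show ?thesis
    by (simp only: measurable_cong_sets[OF sets_\<nu> refl])
qed

text \<open>The cylinder lies within r = 100 * 2 * (xprod n x)^2 of x: 100 from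
  \<open>distortion\<close>, 2 from the length of \<open>I\<close>.\<close>

lemma cell_prob_digits_le:
  assumes x: "x \<in> I" "0 \<notin> set (digits n x)"
  shows "line.cell_prob (digits n) x \<le> 800 * \<nu>_max * (xprod n x)\<^sup>2"
proof -
  define r where "r = 200 * (xprod n x)\<^sup>2"
  have r0: "0 \<le> r" by (simp add: r_def)
  have "line.cell_prob (digits n) x = line.prob {y \<in> space \<nu>. digits n y = digits n x}"
    by (simp add: line.cell_prob_def)
  also have "\<dots> \<le> line.prob {x - r..x + r}"
  proof (rule line.finite_measure_mono_AE)
    show "AE y in \<nu>. y \<in> {y \<in> space \<nu>. digits n y = digits n x} \<longrightarrow> y \<in> {x - r..x + r}"
      using AE_\<nu>_I
    proof eventually_elim
      case (elim y)
      show ?case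
      proof
        assume "y \<in> {y \<in> space \<nu>. digits n y = digits n x}"
        then have eq: "digits n x = digits n y" by simp
        have "\<bar>x - y\<bar> = xprod n x * xprod n y * \<bar>(\<phi> ^^ n) x - (\<phi> ^^ n) y\<bar>"
          by (rule cylinder_diff[OF x(1) elim eq x(2)])
        also have "\<dots> \<le> xprod n x * (100 * xprod n x) * 2"
        proof (intro mult_mono mult_nonneg_nonneg)
          show "xprod n y \<le> 100 * xprod n x" by (rule distortion[OF elim x(1) eq[symmetric]]) (use x eq in simp)
          show "\<bar>(\<phi> ^^ n) x - (\<phi> ^^ n) y\<bar> \<le> 2"
            using phi_funpow_in_I[OF x(1), of n] phi_funpow_in_I[OF elim, of n] by (auto simp: mem_I)
        qed (auto simp: xprod_nonneg)
        also have "\<dots> = r" by (simp add: r_def power2_eq_square)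
        finally show "y \<in> {x - r..x + r}" by auto
      qed
    qed
  qed auto
  also have "\<dots> \<le> \<nu>_max * ((x + r) - (x - r))"
    by (rule \<nu>_interval_le) (use r0 in simp)
  also have "\<dots> \<le> 800 * \<nu>_max * (xprod n x)\<^sup>2"
    using \<nu>_max_pos by (simp add: r_def)
  finally show ?thesis .
qed

text \<open>Pull two points of the image back to the cylinder; by convexity the cylinder contains
  the whole interval between them.\<close>

lemma cell_prob_digits_ge:
  assumes x: "x \<in> I" "0 \<notin> set (digits n x)"
    and ab: "a < b" "{a<..<b} \<subseteq> (\<phi> ^^ n) ` cylinder (digits n x)"
  shows "\<nu>_min * (b - a) * (xprod n x)\<^sup>2 / 20000 \<le> line.cell_prob (digits n) x"
proof -
  let ?w = "digits n x"
  \<comment> \<open>Interior points at distance (b - a) / 2, because the ends may be missing from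
    the image. The constant 20000 is 2 * 100^2.\<close>
  have "a + (b - a) / 4 \<in> {a<..<b}" "a + 3 * (b - a) / 4 \<in> {a<..<b}" using ab(1) by (auto simp: field_simps)
  then have "a + (b - a) / 4 \<in> (\<phi> ^^ n) ` cylinder ?w" "a + 3 * (b - a) / 4 \<in> (\<phi> ^^ n) ` cylinder ?w"
    using ab(2) by (auto simp only: subset_iff)
  then obtain y z where y: "y \<in> cylinder ?w" "a + (b - a) / 4 = (\<phi> ^^ n) y"
    and z: "z \<in> cylinder ?w" "a + 3 * (b - a) / 4 = (\<phi> ^^ n) z" by (elim imageE) blast
  have yI: "y \<in> I" "digits n y = ?w" "z \<in> I" "digits n z = ?w" using y z by (auto simp: cylinder_def)
  have "\<bar>y - z\<bar> = xprod n y * xprod n z * \<bar>(\<phi> ^^ n) y - (\<phi> ^^ n) z\<bar>"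
    by (rule cylinder_diff) (use yI x in auto)
  also have "\<bar>(\<phi> ^^ n) y - (\<phi> ^^ n) z\<bar> = (b - a) / 2"
    unfolding y(2)[symmetric] z(2)[symmetric] using ab(1) by (simp add: field_simps)
  finally have eq: "\<bar>y - z\<bar> = xprod n y * xprod n z * ((b - a) / 2)" .
  have "xprod n x / 100 \<le> xprod n y" "xprod n x / 100 \<le> xprod n z"
    using distortion[OF x(1) yI(1), of n] distortion[OF x(1) yI(3), of n] yI x by auto
  then have "(xprod n x / 100) * (xprod n x / 100) * ((b - a) / 2) \<le> \<bar>y - z\<bar>"
    unfolding eq using ab(1) by (intro mult_right_mono mult_mono) (auto simp: xprod_nonneg)
  then have len: "(xprod n x)\<^sup>2 * (b - a) / 20000 \<le> \<bar>y - z\<bar>" by (simp add: power2_eq_square)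
  define p q where "p = min y z" and "q = max y z"
  have pq: "p \<le> q" "q - p = \<bar>y - z\<bar>" "p \<in> cylinder ?w" "q \<in> cylinder ?w"
    using y z by (auto simp: p_def q_def min_def max_def)
  have sub: "{p..q} \<subseteq> cylinder ?w" using cylinder_convex[OF pq(3,4)] x(2) by auto
  have "\<nu>_min * ((xprod n x)\<^sup>2 * (b - a) / 20000) \<le> \<nu>_min * (q - p)"
    unfolding pq(2) using len \<nu>_min_pos by (intro mult_left_mono) auto
  also have "\<dots> \<le> line.prob {p..q}"
    by (rule \<nu>_interval_ge) (use pq sub in \<open>auto simp: cylinder_def\<close>)
  also have "\<dots> \<le> line.prob {y \<in> space \<nu>. digits n y = ?w}"
    by (rule line.finite_measure_mono) (use sub in \<open>auto simp: cylinder_def\<close>)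
  finally show ?thesis by (simp add: line.cell_prob_def mult_ac)
qed

end

lemma (in prob_space) label_entropy_cong_AE:
  fixes U V :: "'a \<Rightarrow> 'c::countable"
  assumes U[measurable]: "U \<in> M \<rightarrow>\<^sub>M count_space UNIV" and V[measurable]: "V \<in> M \<rightarrow>\<^sub>M count_space UNIV"
    and eq: "AE x in M. U x = V x"
  shows "label_entropy U = label_entropy V"
proof -
  have p: "prob {y \<in> space M. U y = c} = prob {y \<in> space M. V y = c}" for c
    by (rule measure_eq_AE) (use eq in \<open>auto elim!: eventually_mono\<close>)
  show ?thesis
    unfolding label_entropy_def
    by (rule integral_cong_AE) (use eq in \<open>auto simp: cell_prob_def p elim!: eventually_mono\<close>)
qed

lemma (in measure_preserving_system) label_entropy_word_cong_AE:
  fixes U V :: "'a \<Rightarrow> 'c::countable"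
  assumes U: "U \<in> M \<rightarrow>\<^sub>M count_space UNIV" and V: "V \<in> M \<rightarrow>\<^sub>M count_space UNIV"
    and eq: "AE x in M. U x = V x"
  shows "label_entropy (word T U n) = label_entropy (word T V n)"
proof (rule label_entropy_cong_AE)
  show "AE x in M. word T U n x = word T V n x"
    using AE_all_funpow[OF eq] by eventually_elim (auto simp: list_eq_iff_nth_eq nth_word)
qed (use U V in measurable)

lemma (in conull_restriction) ks_entropy_ge_any_label:
  fixes F :: "'a \<Rightarrow> nat"
  assumes F[measurable]: "F \<in> M \<rightarrow>\<^sub>M count_space UNIV" and fin: "finite (F ` space M)"
  shows "ereal (lim (\<lambda>n. label_entropy (word T F n) / real n)) \<le> ks_entropy N T"
proof -
  \<comment> \<open>Letters are shifted by one so that 0 is free to mark the null set outside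
    \<open>space N\<close>.\<close>
  define F' where "F' = (\<lambda>x. if x \<in> space N then Suc (F x) else 0)"
  have F'[measurable]: "F' \<in> M \<rightarrow>\<^sub>M count_space UNIV"
    unfolding F'_def by measurable
  have "label_entropy (word T F' n) = label_entropy (word T F n)" for n
  proof -
    have "label_entropy (word T F' n) = label_entropy (word T (\<lambda>x. Suc (F x)) n)"
      by (rule label_entropy_word_cong_AE) (use AE_space_N in \<open>auto simp: F'_def elim!: eventually_mono\<close>)
    also have "\<dots> = label_entropy (word T F n)"
      by (rule label_entropy_cong) (simp add: word_eq_iff)
    finally show ?thesis .
  qed
  moreover have "finite (F' ` space M)"
  proof (rule finite_subset)
    show "F' ` space M \<subseteq> insert 0 (Suc ` F ` space M)"
    proof (rule image_subsetI)
      fix x assume "x \<in> space M"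
      then show "F' x \<in> insert 0 (Suc ` F ` space M)"
        by (cases "x \<in> space N") (simp_all add: F'_def)
    qed
  qed (use fin in simp)
  then have "ereal (lim (\<lambda>n. label_entropy (word T F' n) / real n)) \<le> ks_entropy N T"
    by (rule ks_entropy_ge[OF F']) (auto simp: F'_def)
  ultimately show ?thesis by simp
qed

context odd_cf
begin

definition entropy_value :: real where
  "entropy_value = pi\<^sup>2 / (9 * ln G)"

lemma AE_regular: "AE x in \<nu>. x \<in> I \<and> (\<forall>n. 0 \<notin> set (digits n x))"
proof -
  have "line.prob {0} = 0"
    using \<nu>_interval_le[of 0 0] by (simp add: measure_le_0_iff)
  then have "AE x in \<nu>. x \<notin> {0}"
    by (subst line.prob_eq_0[symmetric]) auto
  then have "AE x in \<nu>. x \<noteq> 0" by simp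
  from AE_\<nu>_I line.AE_all_funpow[OF this] show ?thesis
  proof eventually_elim
    case (elim x)
    then have "digit ((\<phi> ^^ i) x) \<noteq> 0" for i
      using digit_eq_0[OF phi_funpow_in_I[of x i]] by auto
    then show ?case using elim(1) by (auto simp: in_set_conv_nth nth_word)
  qed
qed

lemma xprod_measurable[measurable]: "xprod n \<in> borel_measurable borel"
proof -
  have [measurable]: "\<phi> ^^ i \<in> borel \<rightarrow>\<^sub>M borel" for i
    by (rule measurable_compose_n) measurable
  show ?thesis unfolding xprod_def by measurable
qed

lemma integrable_ln_xprod: "integrable \<nu> (\<lambda>x. ln (xprod n x))"
  and expectation_ln_xprod: "line.expectation (\<lambda>x. ln (xprod n x)) = - real n * entropy_value / 2"
proof -
  have eq: "AE x in \<nu>. ln (xprod n x) = (\<Sum>i<n. ln \<bar>(\<phi> ^^ i) x\<bar>)"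
    using AE_regular
  proof eventually_elim
    case (elim x)
    have "(\<phi> ^^ i) x \<noteq> 0" if "i < n" for i
    proof -
      have "digit ((\<phi> ^^ i) x) \<in> set (digits n x)" using that by (force simp: in_set_conv_nth nth_word)
      then show ?thesis using elim by (auto simp: digit_def)
    qed
    then show ?case unfolding xprod_def by (intro ln_prod) auto
  qed
  note b = line.birkhoff_sum[OF integrable_ln_abs, of n]
  show "integrable \<nu> (\<lambda>x. ln (xprod n x))"
    by (rule iffD2[OF integrable_cong_AE b(1)]) (use eq b(1) in auto)
  have "line.expectation (\<lambda>x. ln (xprod n x)) = real n * line.expectation (\<lambda>x. ln \<bar>x\<bar>)"
    unfolding b(2)[symmetric] by (rule integral_cong_AE) (use eq b(1) in auto)
  also have "line.expectation (\<lambda>x. ln \<bar>x\<bar>) = - entropy_value / 2"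
    using expectation_ln_abs by (simp add: entropy_value_def)
  finally show "line.expectation (\<lambda>x. ln (xprod n x)) = - real n * entropy_value / 2" by simp
qed

section \<open>The upper bound\<close>

definition good_ends :: "int list \<Rightarrow> real \<Rightarrow> real \<Rightarrow> bool" where
  "good_ends w a b \<longleftrightarrow> a \<in> endpoints (length w) \<and> b \<in> endpoints (length w) \<and> a < b \<and>
    {a<..<b} \<subseteq> (\<phi> ^^ length w) ` cylinder w \<and> (\<phi> ^^ length w) ` cylinder w \<subseteq> {a..b}"

text \<open>A one-point cylinder has probability 0, and almost every point lies in a cell of
  positive probability.\<close>

lemma AE_good_ends: "AE x in \<nu>. \<exists>a b. good_ends (digits n x) a b"
proof -
  have "digits n \<in> \<nu> \<rightarrow>\<^sub>M count_space UNIV" by measurable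
  from AE_regular line.AE_cell_prob_pos[OF this] show ?thesis
  proof eventually_elim
    case (elim x)
    show ?case
    proof (cases "\<exists>y. y \<noteq> x \<and> y \<in> cylinder (digits n x)")
      case True
      then obtain y where "y \<noteq> x" "y \<in> cylinder (digits n x)" by auto
      moreover have "x \<in> cylinder (digits n x)" using elim by (simp add: cylinder_def)
      ultimately show ?thesis
        using cylinder_image[of "digits n x" x y] elim(1) by (auto simp: good_ends_def)
    next
      case False
      have "line.prob {y \<in> space \<nu>. digits n y = digits n x} \<le> line.prob {x..x}"
      proof (rule line.finite_measure_mono_AE)
        show "AE y in \<nu>. y \<in> {y \<in> space \<nu>. digits n y = digits n x} \<longrightarrow> y \<in> {x..x}"
          using AE_\<nu>_I by eventually_elim (use False in \<open>auto simp: cylinder_def\<close>)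
      qed auto
      also have "\<dots> \<le> 0" using \<nu>_interval_le[of x x] by simp
      finally have "line.cell_prob (digits n) x \<le> 0" by (simp add: line.cell_prob_def)
      then show ?thesis using elim by simp
    qed
  qed
qed

text \<open>The weight of a word divided by the probability of its cell. The length of the image of
  a cylinder is not controlled, so cell probabilities alone are not compared with
  \<open>xprod\<close> squared; the factor b - a in the denominator cancels the one in
  \<open>cell_prob_digits_ge\<close>. The default 0 concerns only words that occur with probability
  0.\<close>

definition code_ratio :: "int list \<Rightarrow> real" where
  "code_ratio w = (if \<exists>a b. good_ends w a b
     then 1 / (\<nu>_max * (let (a, b) = (SOME (a, b). good_ends w a b) in b - a) * (card (endpoints (length w)))\<^sup>2)
     else 0)"

lemma code_ratioE:
  assumes "\<exists>a b. good_ends w a b"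
  obtains a b where "good_ends w a b" "code_ratio w = 1 / (\<nu>_max * (b - a) * (card (endpoints (length w)))\<^sup>2)"
proof -
  define p where "p = (SOME (a, b). good_ends w a b)"
  have "\<exists>p. (\<lambda>(a, b). good_ends w a b) p" using assms by auto
  then have "(\<lambda>(a, b). good_ends w a b) p" unfolding p_def by (rule someI_ex)
  then show thesis
    using assms by (intro that[of "fst p" "snd p"]) (auto simp: code_ratio_def p_def[symmetric] split: prod.splits)
qed

lemma card_endpoints_pos: "0 < card (endpoints n)"
  using finite_endpoints[of n] by (cases n) (auto simp: card_gt_0_iff)

lemma code_ratio_nonneg: "0 \<le> code_ratio w"
proof (cases "\<exists>a b. good_ends w a b")
  case True
  from code_ratioE[OF this] obtain a b where "good_ends w a b"
    "code_ratio w = 1 / (\<nu>_max * (b - a) * (card (endpoints (length w)))\<^sup>2)" .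
  then show ?thesis using \<nu>_max_pos by (simp add: good_ends_def)
qed (simp add: code_ratio_def)

text \<open>
  The image of a cylinder is determined, up to its end points, by one of at most \<open>(4 n + 2)\<^sup>2\<close> pairs of
  points, and for each pair the measures of the cylinders add up to at most the measure of their image.
\<close>

lemma nn_integral_code_ratio: "(\<integral>\<^sup>+x. ennreal (code_ratio (digits n x)) \<partial>\<nu>) \<le> 1"
proof -
  define E where "E = {p \<in> endpoints n \<times> endpoints n. fst p < snd p}"
  let ?m = "card (endpoints n)"
  let ?g = "\<lambda>p. 1 / (\<nu>_max * (snd p - fst p) * ?m\<^sup>2)"
  have finE: "finite E" using finite_endpoints by (auto simp: E_def)
  have g0: "0 \<le> ?g p" if "p \<in> E" for p
    using that \<nu>_max_pos by (simp add: E_def)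
  have [measurable]: "\<phi> ^^ i \<in> borel \<rightarrow>\<^sub>M borel" for i
    by (rule measurable_compose_n) measurable
  have "(\<integral>\<^sup>+x. ennreal (code_ratio (digits n x)) \<partial>\<nu>)
      \<le> (\<integral>\<^sup>+x. (\<Sum>p\<in>E. ennreal (?g p) * indicator {fst p..snd p} ((\<phi> ^^ n) x)) \<partial>\<nu>)"
  proof (rule nn_integral_mono_AE)
    show "AE x in \<nu>. ennreal (code_ratio (digits n x)) \<le> (\<Sum>p\<in>E. ennreal (?g p) * indicator {fst p..snd p} ((\<phi> ^^ n) x))"
      using AE_\<nu>_I
    proof eventually_elim
      case (elim x)
      show ?case
      proof (cases "\<exists>a b. good_ends (digits n x) a b")
        case True
        from code_ratioE[OF this] obtain a b where ab: "good_ends (digits n x) a b"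
          "code_ratio (digits n x) = 1 / (\<nu>_max * (b - a) * ?m\<^sup>2)" by auto
        have "x \<in> cylinder (digits n x)" using elim by (simp add: cylinder_def)
        then have "(\<phi> ^^ n) x \<in> {a..b}" using ab(1) by (auto simp: good_ends_def)
        then have "ennreal (code_ratio (digits n x)) = ennreal (?g (a, b)) * indicator {fst (a, b)..snd (a, b)} ((\<phi> ^^ n) x)"
          using ab(2) by simp
        also have "\<dots> \<le> (\<Sum>p\<in>E. ennreal (?g p) * indicator {fst p..snd p} ((\<phi> ^^ n) x))"
          by (rule member_le_sum) (use ab(1) finE in \<open>auto simp: E_def good_ends_def\<close>)
        finally show ?thesis .
      qed (simp add: code_ratio_def)
    qed
  qed
  also have "\<dots> = (\<Sum>p\<in>E. \<integral>\<^sup>+x. ennreal (?g p) * indicator {fst p..snd p} ((\<phi> ^^ n) x) \<partial>\<nu>)"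
    by (rule nn_integral_sum) measurable
  also have "\<dots> \<le> (\<Sum>p\<in>E. ennreal (1 / ?m\<^sup>2))"
  proof (rule sum_mono)
    fix p assume p: "p \<in> E"
    then have lt: "fst p < snd p" by (simp add: E_def)
    have "(\<integral>\<^sup>+x. ennreal (?g p) * indicator {fst p..snd p} ((\<phi> ^^ n) x) \<partial>\<nu>)
        = (\<integral>\<^sup>+x. ennreal (?g p) * indicator {fst p..snd p} x \<partial>distr \<nu> \<nu> (\<phi> ^^ n))"
      by (subst nn_integral_distr) auto
    \<comment> \<open>Invariance of \<nu> replaces the point after n steps by the starting
      point.\<close>
    also have "\<dots> = ennreal (?g p) * emeasure \<nu> {fst p..snd p}"
      unfolding line.funpow_invariant by (rule nn_integral_cmult_indicator) simp
    also have "\<dots> \<le> ennreal (?g p) * ennreal (\<nu>_max * (snd p - fst p))"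
      using \<nu>_interval_le[of "fst p" "snd p"] lt
      by (intro mult_left_mono) (auto simp: line.emeasure_eq_measure intro!: ennreal_leI)
    also have "\<dots> = ennreal (?g p * (\<nu>_max * (snd p - fst p)))"
      using g0[OF p] lt \<nu>_max_pos by (intro ennreal_mult[symmetric]) auto
    also have "?g p * (\<nu>_max * (snd p - fst p)) = 1 / ?m\<^sup>2"
      using lt \<nu>_max_pos by simp
    finally show "(\<integral>\<^sup>+x. ennreal (?g p) * indicator {fst p..snd p} ((\<phi> ^^ n) x) \<partial>\<nu>) \<le> ennreal (1 / ?m\<^sup>2)" .
  qed
  also have "\<dots> = ennreal (real (card E) * (1 / ?m\<^sup>2))"
    by (simp add: ennreal_of_nat_eq_real_of_nat ennreal_mult[symmetric])
  also have "\<dots> \<le> 1"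
  proof -
    have "card E \<le> card (endpoints n \<times> endpoints n)"
      by (rule card_mono) (auto simp: E_def finite_endpoints)
    then have "real (card E) \<le> (real ?m)\<^sup>2"
      by (simp add: card_cartesian_product power2_eq_square flip: of_nat_mult)
    then have "real (card E) * (1 / ?m\<^sup>2) \<le> 1" using card_endpoints_pos[of n] by (simp add: field_simps)
    then show ?thesis by simp
  qed
  finally show ?thesis .
qed

text \<open>Gibbs' inequality for the digit words, dominated by the cell probability of the coarser
  finite label \<open>F\<close>. The length of the image has cancelled from the weights, which
  leaves \<open>xprod\<close> squared over the squared number of end points.\<close>

lemma label_entropy_digits_le:
  fixes F :: "real \<Rightarrow> 'c::countable"
  assumes F[measurable]: "F \<in> borel \<rightarrow>\<^sub>M count_space UNIV" and fin: "finite (range F)"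
    and dep: "\<And>x y. digits n x = digits n y \<Longrightarrow> F x = F y"
  shows "line.label_entropy F \<le> real n * entropy_value + 2 * ln (4 * real n + 2) + ln (20000 * \<nu>_max / \<nu>_min)"
proof -
  let ?p = "\<lambda>w. line.prob {y \<in> space \<nu>. digits n y = w}"
  let ?m = "card (endpoints n)"
  define q where "q = (\<lambda>w. code_ratio w * ?p w)"
  have W[measurable]: "digits n \<in> \<nu> \<rightarrow>\<^sub>M count_space UNIV" by measurable
  have q0: "0 \<le> q w" for w using code_ratio_nonneg by (simp add: q_def)
  have cell: "digits n -` {w} \<inter> space \<nu> = {y \<in> space \<nu>. digits n y = w}" for w by auto
  have "(\<integral>\<^sup>+w. ennreal (q w) \<partial>count_space UNIV) = (\<integral>\<^sup>+x. ennreal (code_ratio (digits n x)) \<partial>\<nu>)"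
  proof -
    have "(\<integral>\<^sup>+x. ennreal (code_ratio (digits n x)) \<partial>\<nu>)
        = (\<integral>\<^sup>+w. ennreal (code_ratio w) * emeasure \<nu> (digits n -` {w} \<inter> space \<nu>) \<partial>count_space UNIV)"
      by (rule nn_integral_countable_label[OF W])
    also have "\<dots> = (\<integral>\<^sup>+w. ennreal (q w) \<partial>count_space UNIV)"
      unfolding cell
      by (rule nn_integral_cong) (simp add: q_def ennreal_mult code_ratio_nonneg line.emeasure_eq_measure)
    finally show ?thesis by simp
  qed
  also have "\<dots> \<le> 1" by (rule nn_integral_code_ratio)
  finally have q1: "(\<integral>\<^sup>+w. ennreal (q w) \<partial>count_space UNIV) \<le> 1" .
  define \<kappa> where "\<kappa> = \<nu>_min / (20000 * \<nu>_max)"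
  have \<kappa>: "0 < \<kappa>" using \<nu>_min_pos \<nu>_max_pos by (simp add: \<kappa>_def)
  have m: "0 < real ?m" using card_endpoints_pos by simp
  have low: "AE x in \<nu>. 0 < xprod n x \<and> \<kappa> * (xprod n x)\<^sup>2 / (real ?m)\<^sup>2 \<le> q (digits n x)"
    using AE_regular AE_good_ends[of n]
  proof eventually_elim
    case (elim x)
    from code_ratioE[OF elim(2)] obtain a b where ab: "good_ends (digits n x) a b"
      "code_ratio (digits n x) = 1 / (\<nu>_max * (b - a) * ?m\<^sup>2)" by auto
    have "a < b" using ab by (simp add: good_ends_def)
    have "\<kappa> * (xprod n x)\<^sup>2 / (real ?m)\<^sup>2 = 1 / (\<nu>_max * (b - a) * ?m\<^sup>2) * (\<nu>_min * (b - a) * (xprod n x)\<^sup>2 / 20000)"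
      using \<open>a < b\<close> \<nu>_max_pos m by (simp add: \<kappa>_def field_simps)
    also have "\<dots> \<le> 1 / (\<nu>_max * (b - a) * ?m\<^sup>2) * line.cell_prob (digits n) x"
      using cell_prob_digits_ge[of x n a b] elim(1) ab(1) \<open>a < b\<close> \<nu>_max_pos
      by (intro mult_left_mono) (auto simp: good_ends_def)
    also have "\<dots> = q (digits n x)"
      unfolding q_def ab(2) by (simp add: line.cell_prob_def)
    finally show ?case using xprod_pos elim(1) by auto
  qed
  \<comment> \<open>Puts the logarithm of the weight between \<open>?B\<close> and 0, which gives
    its integrability.\<close>
  have up: "q w \<le> 1" for w
  proof -
    have "ennreal (q w) = (\<integral>\<^sup>+v. ennreal (q v) * indicator {w} v \<partial>count_space UNIV)"
      by (simp add: nn_integral_indicator_singleton)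
    also have "\<dots> \<le> (\<integral>\<^sup>+v. ennreal (q v) \<partial>count_space UNIV)"
      by (rule nn_integral_mono) (auto simp: indicator_def)
    also have "\<dots> \<le> 1" by (rule q1)
    finally show ?thesis by simp
  qed
  let ?B = "\<lambda>x. ln \<kappa> + 2 * ln (xprod n x) - 2 * ln (real ?m)"
  have lnlow: "AE x in \<nu>. ?B x \<le> ln (q (digits n x)) \<and> ln (q (digits n x)) \<le> 0 \<and> 0 < q (digits n x)"
    using low
  proof eventually_elim
    case (elim x)
    have pos: "0 < \<kappa> * (xprod n x)\<^sup>2 / (real ?m)\<^sup>2" using elim \<kappa> m by simp
    have "?B x = ln (\<kappa> * (xprod n x)\<^sup>2 / (real ?m)\<^sup>2)"
      using elim \<kappa> m by (simp add: ln_div ln_mult ln_realpow)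
    also have "\<dots> \<le> ln (q (digits n x))"
      using elim pos by (subst ln_le_cancel_iff) auto
    finally show ?case using elim pos up[of "digits n x"] by auto
  qed
  have iB: "integrable \<nu> ?B" using integrable_ln_xprod by simp
  have mq[measurable]: "(\<lambda>x. ln (q (digits n x))) \<in> borel_measurable \<nu>"
  proof -
    have "(\<lambda>x. q (digits n x)) \<in> borel_measurable \<nu>"
      using measurable_compose[OF W, of q borel] by simp
    then show ?thesis by measurable
  qed
  have iq: "integrable \<nu> (\<lambda>x. ln (q (digits n x)))"
  proof (rule Bochner_Integration.integrable_bound[OF iB mq])
    show "AE x in \<nu>. norm (ln (q (digits n x))) \<le> norm (?B x)"
      using lnlow by eventually_elim auto
  qed
  have "line.expectation ?B \<le> line.expectation (\<lambda>x. ln (q (digits n x)))"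
  proof (rule integral_mono_AE[OF iB iq])
    show "AE x in \<nu>. ?B x \<le> ln (q (digits n x))"
      using lnlow by eventually_elim auto
  qed
  also have "\<dots> \<le> line.expectation (\<lambda>x. ln (line.cell_prob F x))"
  proof (rule line.gibbs[OF W q0 q1])
    show "AE x in \<nu>. 0 < q (digits n x)" using lnlow by eventually_elim auto
    show "AE x in \<nu>. line.cell_prob (digits n) x \<le> line.cell_prob F x"
      unfolding line.cell_prob_def
      by (intro AE_I2 line.finite_measure_mono) (auto intro: dep)
    show "integrable \<nu> (\<lambda>x. ln (line.cell_prob F x))"
      by (rule line.integrable_ln_cell_prob) (use fin in auto)
  qed (rule iq)
  also have "\<dots> = - line.label_entropy F" by (simp add: line.label_entropy_def)
  finally have "line.label_entropy F \<le> - line.expectation ?B" by simp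
  also have "line.expectation ?B = ln \<kappa> - real n * entropy_value - 2 * ln (real ?m)"
    using integrable_ln_xprod[of n] expectation_ln_xprod[of n] line.prob_space
    by simp
  also have "- ln \<kappa> = ln (20000 * \<nu>_max / \<nu>_min)"
    using \<nu>_min_pos \<nu>_max_pos by (simp add: \<kappa>_def ln_div)
  then have "- (ln \<kappa> - real n * entropy_value - 2 * ln (real ?m))
    = real n * entropy_value + 2 * ln (real ?m) + ln (20000 * \<nu>_max / \<nu>_min)" by simp
  also have "ln (real ?m) \<le> ln (4 * real n + 2)"
  proof -
    have "real ?m \<le> real (4 * n + 2)" using card_endpoints[of n] by (simp only: of_nat_le_iff)
    then show ?thesis using m by (subst ln_le_cancel_iff) auto
  qed
  finally show ?thesis by simp
qed

section \<open>Finite labels of the plane and words of digits\<close>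

lemma plane_label_entropy_fst:
  fixes F :: "real \<Rightarrow> 'c::countable"
  assumes F[measurable]: "F \<in> borel \<rightarrow>\<^sub>M count_space UNIV"
  shows "plane.label_entropy (\<lambda>z. F (fst z)) = line.label_entropy F"
proof -
  have F'[measurable]: "F \<in> \<nu> \<rightarrow>\<^sub>M count_space UNIV" by measurable
  have p: "plane.prob {z \<in> space \<mu>. F (fst z) = c} = line.prob {x \<in> space \<nu>. F x = c}" for c
  proof -
    have "{x \<in> space borel. F x = c} \<in> sets borel" by measurable
    then show ?thesis unfolding \<nu>_def by (subst measure_distr) (auto simp: vimage_def)
  qed
  have "line.expectation f = plane.expectation (\<lambda>z. f (fst z))" if "f \<in> borel_measurable borel" for f :: "real \<Rightarrow> real"
    unfolding \<nu>_def by (rule integral_distr) (use that in measurable)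
  moreover have "(\<lambda>x. - ln (line.cell_prob F x)) \<in> borel_measurable borel"
    using line.cell_prob_measurable[OF F'] by (simp only: measurable_cong_sets[OF sets_\<nu> refl]) measurable
  ultimately have "line.label_entropy F = plane.expectation (\<lambda>z. - ln (line.cell_prob F (fst z)))"
    unfolding line.label_entropy_def by blast
  also have "\<dots> = plane.label_entropy (\<lambda>z. F (fst z))"
    unfolding plane.label_entropy_def by (simp add: line.cell_prob_def plane.cell_prob_def p[simplified])
  finally show ?thesis by simp
qed

lemma word_Phi_fst: "word \<Phi> (\<lambda>z. F (fst z)) n z = word \<phi> F n (fst z)"
  by (induction n arbitrary: z) (auto simp: fst_Phi)

text \<open>The last m digits bring the first coordinates at time m close together, as a cylinder of
  rank m is short; the first m digits have contracted the second coordinates.\<close>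

lemma Phi_cell_small:
  assumes z: "z \<in> closed_dom" "z' \<in> closed_dom" "digits (2 * m) (fst z) = digits (2 * m) (fst z')" "0 \<notin> set (digits (2 * m) (fst z))"
  shows "dist ((\<Phi> ^^ m) z) ((\<Phi> ^^ m) z') \<le> 1000 * (9 / 10) ^ (m div 2)"
proof -
  let ?x = "fst z" and ?x' = "fst z'" and ?t = "(9 / 10 :: real) ^ (m div 2)"
  have t: "0 \<le> ?t" "?t \<le> 1" by (auto intro: power_le_one)
  have I: "?x \<in> I" "?x' \<in> I" using z closed_dom_I[of ?x "snd z"] closed_dom_I[of ?x' "snd z'"] by auto
  have split: "digits (2 * m) x = digits m x @ digits m ((\<phi> ^^ m) x)" for x
    using word_add[of \<phi> digit m m x] by (simp add: mult_2)
  have eq1: "digits m ?x = digits m ?x'" "0 \<notin> set (digits m ?x)"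
    and eq2: "digits m ((\<phi> ^^ m) ?x) = digits m ((\<phi> ^^ m) ?x')" "0 \<notin> set (digits m ((\<phi> ^^ m) ?x))"
    using z(3,4) by (auto simp: split)
  let ?u = "(\<phi> ^^ m) ?x" and ?u' = "(\<phi> ^^ m) ?x'"
  have uI: "?u \<in> I" "?u' \<in> I" using I phi_funpow_in_I by auto
  have "\<bar>?u - ?u'\<bar> = xprod m ?u * xprod m ?u' * \<bar>(\<phi> ^^ m) ?u - (\<phi> ^^ m) ?u'\<bar>"
    by (rule cylinder_diff) (use uI eq2 in auto)
  also have "\<dots> \<le> (2 * ?t) * 2 * 2"
  proof (intro mult_mono mult_nonneg_nonneg)
    show "xprod m ?u \<le> 2 * ?t" by (rule xprod_le[OF uI(1)])
    have "xprod m ?u' \<le> 2 * ?t" by (rule xprod_le[OF uI(2)])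
    then show "xprod m ?u' \<le> 2" using t by linarith
    show "\<bar>(\<phi> ^^ m) ?u - (\<phi> ^^ m) ?u'\<bar> \<le> 2"
      using phi_funpow_in_I[OF uI(1), of m] phi_funpow_in_I[OF uI(2), of m] by (auto simp: mem_I)
  qed (use t in \<open>auto simp: xprod_nonneg\<close>)
  finally have dx: "\<bar>fst ((\<Phi> ^^ m) z) - fst ((\<Phi> ^^ m) z')\<bar> \<le> 8 * ?t" by (simp add: fst_funpow_Phi)
  have "\<bar>snd ((\<Phi> ^^ m) z) - snd ((\<Phi> ^^ m) z')\<bar> = yprod m z * yprod m z' * \<bar>snd z - snd z'\<bar>"
    by (rule cylinder_diff_snd) (use z eq1 in auto)
  also have "\<dots> \<le> (20 * ?t) * 20 * 2"
  proof (intro mult_mono mult_nonneg_nonneg)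
    have y1: "yprod m z \<le> 10 * xprod m ?x" by (rule xprod_yprod_le(2)) (use z eq1 in auto)
    then show "yprod m z \<le> 20 * ?t" using xprod_le[OF I(1), of m] by linarith
    have "yprod m z' \<le> 10 * xprod m ?x'" by (rule xprod_yprod_le(2)) (use z eq1 in auto)
    then show "yprod m z' \<le> 20" using xprod_le[OF I(2), of m] t by linarith
    show "\<bar>snd z - snd z'\<bar> \<le> 2"
      using closed_dom_y[of ?x "snd z"] closed_dom_y[of ?x' "snd z'"] z gold_G_bounds by auto
    show "0 \<le> yprod m z'"
      using xprod_yprod(2)[of z' m] z eq1 by auto
  qed (use t in auto)
  finally have dy: "\<bar>snd ((\<Phi> ^^ m) z) - snd ((\<Phi> ^^ m) z')\<bar> \<le> 800 * ?t" by simp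
  have "dist ((\<Phi> ^^ m) z) ((\<Phi> ^^ m) z') \<le> dist (fst ((\<Phi> ^^ m) z)) (fst ((\<Phi> ^^ m) z')) + dist (snd ((\<Phi> ^^ m) z)) (snd ((\<Phi> ^^ m) z'))"
    unfolding dist_prod_def by (rule sqrt_sum_squares_le_sum) auto
  also have "\<dots> \<le> 1000 * ?t" using dx dy t by (simp add: dist_real_def)
  finally show ?thesis .
qed

lemma AE_\<mu>_regular: "AE z in \<mu>. z \<in> closed_dom \<and> (\<forall>n. 0 \<notin> set (digits n (fst z)))"
proof -
  have "AE z in \<mu>. fst z \<in> I \<and> (\<forall>n. 0 \<notin> set (digits n (fst z)))"
    by (rule AE_distrD[OF _ AE_regular[unfolded \<nu>_def]]) measurable
  then show ?thesis
    using AE_\<mu>_open_dom by eventually_elim (use open_subset_closed in auto)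
qed

text \<open>Inner regularity makes any finite label of the plane nearly a function of finitely many digits.\<close>

lemma approximate_label:
  fixes X :: "real \<times> real \<Rightarrow> nat"
  assumes X[measurable]: "X \<in> borel \<rightarrow>\<^sub>M count_space UNIV" and fin: "finite (range X)" and \<epsilon>: "0 < \<epsilon>"
  obtains m and R :: "int list \<Rightarrow> nat" where "range R \<subseteq> insert 0 (range X)"
    "plane.prob {z. X ((\<Phi> ^^ m) z) \<noteq> R (digits (2 * m) (fst z))} \<le> \<epsilon>"
proof -
  define S where "S = range X"
  define \<eta> where "\<eta> = \<epsilon> / card S"
  have S: "finite S" "S \<noteq> {}" using fin by (auto simp: S_def)
  then have cS: "0 < real (card S)" by (simp add: card_gt_0_iff)
  then have \<eta>: "0 < \<eta>" using \<epsilon> by (simp add: \<eta>_def)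
  have vim[measurable]: "X -` {c} \<in> sets borel" for c
    using measurable_sets[OF X, of "{c}"] by simp
  have "\<exists>K. K \<subseteq> X -` {c} \<inter> closed_dom \<and> compact K \<and> plane.prob (X -` {c}) \<le> plane.prob K + \<eta>" for c
  proof -
    have B: "X -` {c} \<inter> closed_dom \<in> sets borel" by measurable
    have pB: "plane.prob (X -` {c}) = plane.prob (X -` {c} \<inter> closed_dom)"
      by (rule measure_eq_AE) (use AE_\<mu>_regular in \<open>auto elim!: eventually_mono\<close>)
    have SUP: "emeasure \<mu> (X -` {c} \<inter> closed_dom) = (SUP K\<in>{K. K \<subseteq> X -` {c} \<inter> closed_dom \<and> compact K}. emeasure \<mu> K)"
      by (rule inner_regular) (use B in \<open>auto simp: emeasure_\<mu>_UNIV\<close>)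
    show ?thesis
    proof (rule ccontr)
      assume neg: "\<nexists>K. K \<subseteq> X -` {c} \<inter> closed_dom \<and> compact K \<and> plane.prob (X -` {c}) \<le> plane.prob K + \<eta>"
      have "emeasure \<mu> (X -` {c} \<inter> closed_dom) \<le> ennreal (plane.prob (X -` {c}) - \<eta>)"
        unfolding SUP
      proof (rule SUP_least)
        fix K assume "K \<in> {K. K \<subseteq> X -` {c} \<inter> closed_dom \<and> compact K}"
        then have "plane.prob K < plane.prob (X -` {c}) - \<eta>" using neg by force
        then show "emeasure \<mu> K \<le> ennreal (plane.prob (X -` {c}) - \<eta>)"
          by (simp add: plane.emeasure_eq_measure ennreal_leI)
      qed
      then have "plane.prob (X -` {c}) \<le> plane.prob (X -` {c}) - \<eta> \<or> plane.prob (X -` {c}) = 0 \<and> plane.prob (X -` {c}) - \<eta> \<le> 0"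
        unfolding plane.emeasure_eq_measure pB[symmetric] by (auto simp: ennreal_le_iff2 intro: antisym measure_nonneg)
      moreover have "plane.prob (X -` {c}) \<noteq> 0"
      proof
        assume "plane.prob (X -` {c}) = 0"
        then have "plane.prob (X -` {c}) \<le> plane.prob {} + \<eta>" using \<eta> by simp
        then show False using neg by (auto dest!: spec[of _ "{}"])
      qed
      ultimately show False using \<eta> by linarith
    qed
  qed
  then obtain K where K: "\<And>c. K c \<subseteq> X -` {c} \<inter> closed_dom" "\<And>c. compact (K c)"
    "\<And>c. plane.prob (X -` {c}) \<le> plane.prob (K c) + \<eta>"
    by metis
  have K_borel[measurable]: "K c \<in> sets borel" for c using K(2) by (intro borel_compact)
  \<comment> \<open>Finitely many pairwise disjoint compact sets have a positive mutual
    distance.\<close>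
  obtain \<delta> where \<delta>: "0 < \<delta>" "\<And>c c' z z'. c \<in> S \<Longrightarrow> c' \<in> S \<Longrightarrow> c \<noteq> c' \<Longrightarrow> z \<in> K c \<Longrightarrow> z' \<in> K c' \<Longrightarrow> \<delta> \<le> dist z z'"
  proof -
    define Q where "Q = {p \<in> S \<times> S. fst p \<noteq> snd p}"
    have "finite Q" using S by (auto simp: Q_def)
    have "\<forall>p\<in>Q. \<exists>d>0. \<forall>z\<in>K (fst p). \<forall>z'\<in>K (snd p). d \<le> dist z z'"
    proof
      fix p assume "p \<in> Q"
      then have ne: "fst p \<noteq> snd p" by (simp add: Q_def)
      have "K (fst p) \<inter> K (snd p) = {}"
      proof (rule equals0I)
        fix z assume "z \<in> K (fst p) \<inter> K (snd p)"
        then have "X z = fst p" "X z = snd p" using K(1) by blast+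
        then show False using ne by simp
      qed
      then show "\<exists>d>0. \<forall>z\<in>K (fst p). \<forall>z'\<in>K (snd p). d \<le> dist z z'"
        by (intro separate_compact_closed K(2) compact_imp_closed)
    qed
    from bchoice[OF this] obtain d where d: "\<And>p. p \<in> Q \<Longrightarrow> 0 < d p"
      "\<And>p z z'. p \<in> Q \<Longrightarrow> z \<in> K (fst p) \<Longrightarrow> z' \<in> K (snd p) \<Longrightarrow> d p \<le> dist z z'"
      by blast
    define \<delta> where "\<delta> = Min (insert 1 (d ` Q))"
    have "0 < \<delta>" using \<open>finite Q\<close> d(1) by (simp add: \<delta>_def)
    moreover have "\<delta> \<le> dist z z'" if "c \<in> S" "c' \<in> S" "c \<noteq> c'" "z \<in> K c" "z' \<in> K c'" for c c' z z'
    proof -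
      have Q: "(c, c') \<in> Q" using that by (simp add: Q_def)
      then have "\<delta> \<le> d (c, c')" using \<open>finite Q\<close> by (auto simp: \<delta>_def)
      also have "\<dots> \<le> dist z z'" using d(2)[OF Q] that by simp
      finally show ?thesis .
    qed
    ultimately show thesis using that by blast
  qed
  obtain j :: nat where j: "1000 * (9 / 10 :: real) ^ j < \<delta>"
  proof -
    obtain j where "(9 / 10 :: real) ^ j < \<delta> / 1000"
      using real_arch_pow_inv[of "\<delta> / 1000" "9 / 10"] \<delta>(1) by auto
    then show thesis by (intro that[of j]) simp
  qed
  \<comment> \<open>Contraction by 9/10 takes two steps.\<close>
  define m where "m = 2 * j"
  \<comment> \<open>\<open>R\<close> reads off a label whose compact set meets the image of the
    digit cell. Two points of such an image are closer than \<delta>, so there is at most one such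
    label; 0 is a default for cells that meet none.\<close>
  define P where "P = (\<lambda>w c. c \<in> S \<and> (\<exists>z\<in>closed_dom. digits (2 * m) (fst z) = w \<and> 0 \<notin> set w \<and> (\<Phi> ^^ m) z \<in> K c))"
  define R where "R = (\<lambda>w. if \<exists>c. P w c then SOME c. P w c else 0)"
  have R_range: "range R \<subseteq> insert 0 S"
  proof
    fix c assume "c \<in> range R"
    then obtain w where w: "c = R w" by auto
    show "c \<in> insert 0 S"
    proof (cases "\<exists>c. P w c")
      case True
      then have "P w (R w)" unfolding R_def by (auto intro: someI_ex)
      then show ?thesis by (auto simp: w P_def)
    next
      case False
      show ?thesis unfolding w R_def if_not_P[OF False] by simp
    qed
  qed
  have R_eq: "R (digits (2 * m) (fst z)) = c"
    if z: "z \<in> closed_dom" "0 \<notin> set (digits (2 * m) (fst z))" and c: "c \<in> S" "(\<Phi> ^^ m) z \<in> K c" for z c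
  proof -
    let ?w = "digits (2 * m) (fst z)"
    have P: "P ?w c" using z c by (auto simp: P_def)
    then have "P ?w (R ?w)" unfolding R_def by (auto intro: someI_ex)
    then obtain z' where z': "z' \<in> closed_dom" "digits (2 * m) (fst z') = ?w" "(\<Phi> ^^ m) z' \<in> K (R ?w)" and RS: "R ?w \<in> S"
      by (auto simp: P_def)
    have "dist ((\<Phi> ^^ m) z) ((\<Phi> ^^ m) z') < \<delta>"
      using Phi_cell_small[OF z(1) z'(1) z'(2)[symmetric] z(2)] j by (simp add: m_def)
    then show ?thesis using \<delta>(2)[OF c(1) RS _ c(2) z'(3)] by force
  qed
  have "plane.prob {z. X ((\<Phi> ^^ m) z) \<noteq> R (digits (2 * m) (fst z))} \<le> plane.prob ((\<Phi> ^^ m) -` (\<Union>c\<in>S. X -` {c} - K c))"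
  proof (rule plane.finite_measure_mono_AE)
    show "AE z in \<mu>. z \<in> {z. X ((\<Phi> ^^ m) z) \<noteq> R (digits (2 * m) (fst z))} \<longrightarrow> z \<in> (\<Phi> ^^ m) -` (\<Union>c\<in>S. X -` {c} - K c)"
      using AE_\<mu>_regular
    proof eventually_elim
      case (elim z)
      let ?c = "X ((\<Phi> ^^ m) z)"
      have cS: "?c \<in> S" by (simp add: S_def)
      show ?case
      proof
        assume "z \<in> {z. X ((\<Phi> ^^ m) z) \<noteq> R (digits (2 * m) (fst z))}"
        then have "(\<Phi> ^^ m) z \<notin> K ?c" using R_eq[of z ?c] elim cS by auto
        then show "z \<in> (\<Phi> ^^ m) -` (\<Union>c\<in>S. X -` {c} - K c)" using cS by auto
      qed
    qed
    have "(\<Union>c\<in>S. X -` {c} - K c) \<in> sets \<mu>" using S by auto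
    from measurable_sets[OF plane.funpow_measurable this, of m]
    show "(\<Phi> ^^ m) -` (\<Union>c\<in>S. X -` {c} - K c) \<in> sets \<mu>" by simp
  qed
  also have "\<dots> = plane.prob (\<Union>c\<in>S. X -` {c} - K c)"
  proof -
    have *: "(\<Union>c\<in>S. X -` {c} - K c) \<in> sets \<mu>" using S by auto
    have "plane.prob (\<Union>c\<in>S. X -` {c} - K c) = measure (distr \<mu> \<mu> (\<Phi> ^^ m)) (\<Union>c\<in>S. X -` {c} - K c)"
      by (simp add: plane.funpow_invariant)
    also have "\<dots> = plane.prob ((\<Phi> ^^ m) -` (\<Union>c\<in>S. X -` {c} - K c) \<inter> space \<mu>)"
      by (rule measure_distr[OF plane.funpow_measurable *])
    finally show ?thesis by simp
  qed
  also have "\<dots> \<le> (\<Sum>c\<in>S. plane.prob (X -` {c} - K c))"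
    by (rule plane.finite_measure_subadditive_finite) (use S in auto)
  also have "\<dots> \<le> (\<Sum>c\<in>S. \<eta>)"
  proof (rule sum_mono)
    fix c
    have "K c \<subseteq> X -` {c}" using K(1)[of c] by auto
    then have "plane.prob (X -` {c} - K c) = plane.prob (X -` {c}) - plane.prob (K c)"
      by (intro plane.finite_measure_Diff) auto
    then show "plane.prob (X -` {c} - K c) \<le> \<eta>" using K(3)[of c] by simp
  qed
  also have "\<dots> = \<epsilon>" using cS by (simp add: \<eta>_def)
  finally show thesis using R_range by (intro that) (auto simp: S_def)
qed

text \<open>By invariance \<open>X\<close> may be replaced by \<open>A\<close>, its value m steps
  later, which agrees with a label \<open>B\<close> made of 2 m digits up to probability \<epsilon>.
  Guessing \<open>A\<close> from \<open>B\<close> costs at most \<epsilon> ln (k / \<epsilon>) - ln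
  (1 - \<epsilon>) per letter, with k the number of values of \<open>X\<close>, and n letters of
  \<open>B\<close> are a function of n + 2 m digits.\<close>

lemma word_entropy_le:
  fixes X :: "real \<times> real \<Rightarrow> nat"
  assumes X[measurable]: "X \<in> borel \<rightarrow>\<^sub>M count_space UNIV" and fin: "finite (range X)"
    and \<epsilon>: "0 < \<epsilon>" "\<epsilon> < 1"
  obtains m where "\<And>n. plane.label_entropy (word \<Phi> X n) \<le> real (n + 2 * m) * entropy_value
    + 2 * ln (4 * real (n + 2 * m) + 2) + ln (20000 * \<nu>_max / \<nu>_min)
    + real n * (\<epsilon> * ln (card (range X) / \<epsilon>) - ln (1 - \<epsilon>))"
proof -
  obtain m R where R: "range R \<subseteq> insert 0 (range X)"
    and approx: "plane.prob {z. X ((\<Phi> ^^ m) z) \<noteq> R (digits (2 * m) (fst z))} \<le> \<epsilon>"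
    by (rule approximate_label[OF X fin \<epsilon>(1)])
  define k where "k = real (card (range X))"
  have "1 \<le> card (range X)" using fin by (simp add: Suc_le_eq card_gt_0_iff)
  then have k: "1 \<le> k" by (simp add: k_def)
  define A where "A = (\<lambda>z. X ((\<Phi> ^^ m) z))"
  define B where "B = (\<lambda>z :: real \<times> real. R (digits (2 * m) (fst z)))"
  define Z where "Z = (\<lambda>z. (A z, B z))"
  \<comment> \<open>Bet 1 - \<epsilon> on agreement with the digits and spread \<epsilon> evenly
    over the values of \<open>X\<close>; restricting to these values keeps the total at most
    1.\<close>
  define \<kappa> where "\<kappa> = (\<lambda>(a, b). if a \<in> range X then if a = b then 1 - \<epsilon> else \<epsilon> / k else 0)"
  have [measurable]: "A \<in> \<mu> \<rightarrow>\<^sub>M count_space UNIV"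
    unfolding A_def using measurable_compose[OF plane.funpow_measurable, of X] X by (simp cong: measurable_cong_sets)
  have Bfst[measurable]: "B \<in> \<mu> \<rightarrow>\<^sub>M count_space UNIV"
    unfolding B_def by measurable
  have Z[measurable]: "Z \<in> \<mu> \<rightarrow>\<^sub>M count_space UNIV"
    unfolding Z_def by (rule measurable_compose_countable[of "\<lambda>a z. (a, B z)"]) measurable
  have finR: "finite (range R)" using R fin by (auto intro: finite_subset)
  have finB: "finite (B ` space \<mu>)" by (rule finite_subset[OF _ finR]) (auto simp: B_def)
  have finA: "finite (A ` space \<mu>)" by (rule finite_subset[OF _ fin]) (auto simp: A_def)
  have finZ: "finite (Z ` space \<mu>)"
    by (rule finite_subset[of _ "A ` space \<mu> \<times> B ` space \<mu>"]) (use finA finB in \<open>auto simp: Z_def\<close>)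
  have \<kappa>Z: "\<kappa> (Z z) = (if A z = B z then 1 - \<epsilon> else \<epsilon> / k)" for z
    by (auto simp: \<kappa>_def Z_def A_def)
  have \<kappa>0: "0 \<le> \<kappa> c" for c using \<epsilon> k by (auto simp: \<kappa>_def split: prod.split)
  have \<kappa>1: "(\<integral>\<^sup>+c. ennreal (\<kappa> c) * indicator {c. snd c = b} c \<partial>count_space UNIV) \<le> 1" for b
  proof -
    have "(\<integral>\<^sup>+c. ennreal (\<kappa> c) * indicator {c. snd c = b} c \<partial>count_space UNIV)
       = (\<integral>\<^sup>+c. ennreal (\<kappa> c) * indicator (range X \<times> {b}) c \<partial>count_space UNIV)"
      by (rule nn_integral_cong) (auto simp: \<kappa>_def indicator_def split: prod.split)
    also have "\<dots> = (\<Sum>c\<in>range X \<times> {b}. ennreal (\<kappa> c))"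
      using fin by (simp add: nn_integral_count_space_indicator[symmetric] nn_integral_count_space_finite)
    also have "\<dots> = ennreal (\<Sum>c\<in>range X \<times> {b}. \<kappa> c)"
      using \<kappa>0 by (intro sum_ennreal) auto
    also have "(\<Sum>c\<in>range X \<times> {b}. \<kappa> c) = (\<Sum>a\<in>range X. \<kappa> (a, b))"
      using sum.cartesian_product[of "\<lambda>a b. \<kappa> (a, b)" "{b}" "range X"] by simp
    also have "\<dots> \<le> (\<Sum>a\<in>range X. (if a = b then 1 - \<epsilon> else 0) + \<epsilon> / k)"
      using \<epsilon> k by (intro sum_mono) (auto simp: \<kappa>_def)
    also have "\<dots> = (if b \<in> range X then 1 - \<epsilon> else 0) + k * (\<epsilon> / k)"
      using fin by (simp add: sum.distrib sum.delta k_def)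
    also have "\<dots> \<le> 1" using \<epsilon> k by auto
    finally show ?thesis by (simp add: ennreal_leI)
  qed
  have \<kappa>pos: "0 < \<kappa> (Z z)" for z using \<epsilon> k by (simp add: \<kappa>Z)
  have i\<kappa>: "integrable \<mu> (\<lambda>z. ln (\<kappa> (Z z)))"
    by (rule plane.integrable_finite_label[OF Z finZ, of "\<lambda>c. ln (\<kappa> c)"])
  let ?D = "{z \<in> space \<mu>. A z \<noteq> B z}"
  have D: "?D \<in> sets \<mu>"
    using measurable_sets[OF Z, of "{(a, b). a \<noteq> b}"] by (simp add: Z_def vimage_def Int_def conj_commute)
  have iD: "integrable \<mu> (\<lambda>z. ln (k / \<epsilon>) * indicator ?D z :: real)"
    by (intro integrable_mult_right integrable_real_indicator D) (simp add: plane.emeasure_eq_measure)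
  have "- plane.expectation (\<lambda>z. ln (\<kappa> (Z z))) \<le> plane.expectation (\<lambda>z. - ln (1 - \<epsilon>) + ln (k / \<epsilon>) * indicator ?D z)"
    unfolding Bochner_Integration.integral_minus[symmetric]
  proof (rule integral_mono)
    fix z assume "z \<in> space \<mu>"
    show "- ln (\<kappa> (Z z)) \<le> - ln (1 - \<epsilon>) + ln (k / \<epsilon>) * indicator ?D z"
      using \<epsilon> k by (auto simp: \<kappa>Z indicator_def ln_div)
  qed (intro Bochner_Integration.integrable_minus Bochner_Integration.integrable_add plane.integrable_const i\<kappa> iD)+
  also have "\<dots> = - ln (1 - \<epsilon>) + ln (k / \<epsilon>) * plane.prob ?D"
    using iD D plane.prob_space by (subst Bochner_Integration.integral_add) auto
  also have "\<dots> \<le> - ln (1 - \<epsilon>) + ln (k / \<epsilon>) * \<epsilon>"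
  proof -
    have "0 \<le> ln (k / \<epsilon>)" using \<epsilon> k by simp
    moreover have "plane.prob ?D \<le> \<epsilon>" using approx by (simp add: A_def B_def)
    ultimately show ?thesis by (simp add: mult_left_mono)
  qed
  finally have E\<kappa>: "- plane.expectation (\<lambda>z. ln (\<kappa> (Z z))) \<le> \<epsilon> * ln (k / \<epsilon>) - ln (1 - \<epsilon>)" by (simp add: mult.commute)
  show thesis
  proof (rule that[of m])
    fix n
    have WA[measurable]: "word \<Phi> A n \<in> \<mu> \<rightarrow>\<^sub>M count_space UNIV" by measurable
    have "word \<Phi> A n = (\<lambda>z. word \<Phi> X n ((\<Phi> ^^ m) z))"
    proof
      fix z show "word \<Phi> A n z = word \<Phi> X n ((\<Phi> ^^ m) z)"
        by (induction n arbitrary: z) (simp_all add: A_def funpow_swap1)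
    qed
    then have "plane.label_entropy (word \<Phi> X n) = plane.label_entropy (word \<Phi> A n)"
      by (simp only:) (rule plane.label_entropy_funpow[symmetric], measurable)
    also have "\<dots> = - plane.expectation (\<lambda>z. ln (plane.cell_prob (word \<Phi> A n) z))"
      by (simp add: plane.label_entropy_def)
    also have "\<dots> \<le> plane.label_entropy (word \<Phi> (\<lambda>z. snd (Z z)) n) - real n * plane.expectation (\<lambda>z. ln (\<kappa> (Z z)))"
    proof (rule plane.label_entropy_word_code[OF Z _ \<kappa>0 \<kappa>1 _ i\<kappa>])
      show "finite ((\<lambda>x. snd (Z x)) ` space \<mu>)" using finB by (simp add: Z_def)
      show "AE z in \<mu>. 0 < \<kappa> (Z z)" using \<kappa>pos by simp
      show "AE z in \<mu>. plane.cell_prob (word \<Phi> Z n) z \<le> plane.cell_prob (word \<Phi> A n) z"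
      proof (rule AE_I2)
        fix z
        have "plane.prob {y \<in> space \<mu>. word \<Phi> Z n y = word \<Phi> Z n z} \<le> plane.prob {y \<in> space \<mu>. word \<Phi> A n y = word \<Phi> A n z}"
          by (rule plane.finite_measure_mono) (auto simp: word_eq_iff Z_def)
        then show "plane.cell_prob (word \<Phi> Z n) z \<le> plane.cell_prob (word \<Phi> A n) z"
          by (simp add: plane.cell_prob_def)
      qed
      show "integrable \<mu> (\<lambda>z. ln (plane.cell_prob (word \<Phi> A n) z))"
        by (rule plane.integrable_ln_cell_prob[OF WA plane.finite_word[OF finA]])
    qed
    also have "plane.label_entropy (word \<Phi> (\<lambda>z. snd (Z z)) n) \<le> real (n + 2 * m) * entropy_value
      + 2 * ln (4 * real (n + 2 * m) + 2) + ln (20000 * \<nu>_max / \<nu>_min)"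
    proof -
      define F where "F = word \<phi> (\<lambda>x. R (digits (2 * m) x)) n"
      have Rm: "(\<lambda>x. R (digits (2 * m) x)) \<in> \<nu> \<rightarrow>\<^sub>M count_space UNIV" by measurable
      have "F \<in> \<nu> \<rightarrow>\<^sub>M count_space UNIV"
        unfolding F_def by (rule line.word_measurable[OF Rm])
      then have F[measurable]: "F \<in> borel \<rightarrow>\<^sub>M count_space UNIV"
        by (simp only: measurable_cong_sets[OF sets_\<nu> refl])
      have "word \<Phi> (\<lambda>z. snd (Z z)) n = (\<lambda>z. F (fst z))"
        unfolding F_def Z_def B_def snd_conv by (intro ext word_Phi_fst)
      then have "plane.label_entropy (word \<Phi> (\<lambda>z. snd (Z z)) n) = line.label_entropy F"
        by (simp add: plane_label_entropy_fst)
      also have "\<dots> \<le> real (n + 2 * m) * entropy_value + 2 * ln (4 * real (n + 2 * m) + 2) + ln (20000 * \<nu>_max / \<nu>_min)"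
      proof (rule label_entropy_digits_le[OF F])
        have "finite ((\<lambda>x. R (digits (2 * m) x)) ` space \<nu>)"
          by (rule finite_subset[OF _ finR]) auto
        from line.finite_word[OF this, of n] show "finite (range F)" by (simp add: F_def)
        fix x y assume eq: "digits (n + 2 * m) x = digits (n + 2 * m) y"
        show "F x = F y"
          unfolding F_def word_eq_iff
        proof (intro allI impI)
          fix i assume "i < n"
          have "digits (2 * m) ((\<phi> ^^ i) x) = digits (2 * m) ((\<phi> ^^ i) y)"
            unfolding word_eq_iff
          proof (intro allI impI)
            fix j assume "j < 2 * m"
            then have "digit ((\<phi> ^^ (j + i)) x) = digit ((\<phi> ^^ (j + i)) y)"
              using eq \<open>i < n\<close> unfolding word_eq_iff by auto
            then show "digit ((\<phi> ^^ j) ((\<phi> ^^ i) x)) = digit ((\<phi> ^^ j) ((\<phi> ^^ i) y))"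
              by (simp add: funpow_add)
          qed
          then show "R (digits (2 * m) ((\<phi> ^^ i) x)) = R (digits (2 * m) ((\<phi> ^^ i) y))" by simp
        qed
      qed
      finally show ?thesis .
    qed
    finally have "plane.label_entropy (word \<Phi> X n) \<le> real (n + 2 * m) * entropy_value
      + 2 * ln (4 * real (n + 2 * m) + 2) + ln (20000 * \<nu>_max / \<nu>_min)
      - real n * plane.expectation (\<lambda>z. ln (\<kappa> (Z z)))" by simp
    moreover have "- (real n * plane.expectation (\<lambda>z. ln (\<kappa> (Z z)))) \<le> real n * (\<epsilon> * ln (k / \<epsilon>) - ln (1 - \<epsilon>))"
      using mult_left_mono[OF E\<kappa>, of "real n"] by simp
    ultimately show "plane.label_entropy (word \<Phi> X n) \<le> real (n + 2 * m) * entropy_value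
      + 2 * ln (4 * real (n + 2 * m) + 2) + ln (20000 * \<nu>_max / \<nu>_min)
      + real n * (\<epsilon> * ln (card (range X) / \<epsilon>) - ln (1 - \<epsilon>))"
      unfolding k_def by linarith
  qed
qed

text \<open>The order of limits matters: m depends on \<epsilon>, so n tends to infinity first and
  \<epsilon> to 0 afterwards.\<close>

lemma plane_entropy_rate_le:
  fixes X :: "real \<times> real \<Rightarrow> nat"
  assumes X[measurable]: "X \<in> borel \<rightarrow>\<^sub>M count_space UNIV" and fin: "finite (range X)"
  shows "lim (\<lambda>n. plane.label_entropy (word \<Phi> X n) / real n) \<le> entropy_value"
proof -
  define k where "k = real (card (range X))"
  have "1 \<le> card (range X)" using fin by (simp add: Suc_le_eq card_gt_0_iff)
  then have k: "1 \<le> k" by (simp add: k_def)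
  have X\<mu>: "X \<in> \<mu> \<rightarrow>\<^sub>M count_space UNIV" by measurable
  have conv: "(\<lambda>n. plane.label_entropy (word \<Phi> X n) / real n) \<longlonglongrightarrow> lim (\<lambda>n. plane.label_entropy (word \<Phi> X n) / real n)"
    using plane.word_entropy_rate_convergent[OF X\<mu>] fin by (simp add: convergent_LIMSEQ_iff)
  have le: "lim (\<lambda>n. plane.label_entropy (word \<Phi> X n) / real n) \<le> entropy_value + (\<epsilon> * ln (k / \<epsilon>) - ln (1 - \<epsilon>))"
    if \<epsilon>: "0 < \<epsilon>" "\<epsilon> < 1" for \<epsilon>
  proof -
    define c where "c = ln (20000 * \<nu>_max / \<nu>_min)"
    define \<delta> where "\<delta> = \<epsilon> * ln (k / \<epsilon>) - ln (1 - \<epsilon>)"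
    obtain m where m: "\<And>n. plane.label_entropy (word \<Phi> X n) \<le> real (n + 2 * m) * entropy_value
      + 2 * ln (4 * real (n + 2 * m) + 2) + c + real n * \<delta>"
      unfolding c_def \<delta>_def k_def by (rule word_entropy_le[OF X fin \<epsilon>]) blast
    let ?u = "\<lambda>n. (real (n + 2 * m) * entropy_value + 2 * ln (4 * real (n + 2 * m) + 2) + c + real n * \<delta>) / real n"
    have "?u \<longlonglongrightarrow> entropy_value + \<delta>" by real_asymp
    moreover have "plane.label_entropy (word \<Phi> X n) / real n \<le> ?u n" for n
      by (intro divide_right_mono m) simp
    ultimately show ?thesis
      unfolding \<delta>_def by (intro LIMSEQ_le[OF conv]) auto
  qed
  have "((\<lambda>\<epsilon>. entropy_value + (\<epsilon> * ln (k / \<epsilon>) - ln (1 - \<epsilon>))) \<longlongrightarrow> entropy_value) (at_right 0)"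
    using k by real_asymp
  then show ?thesis
  proof (rule tendsto_lowerbound)
    have "\<forall>\<^sub>F \<epsilon> in at_right 0. \<epsilon> \<in> {0<..<1::real}"
      by (rule eventually_at_right_less[THEN eventually_mono, rotated] eventually_at_rightI[of 0 1])+ auto
    then show "\<forall>\<^sub>F \<epsilon> in at_right 0. lim (\<lambda>n. plane.label_entropy (word \<Phi> X n) / real n) \<le> entropy_value + (\<epsilon> * ln (k / \<epsilon>) - ln (1 - \<epsilon>))"
      by eventually_elim (use le in auto)
  qed simp
qed

section \<open>The lower bound\<close>

text \<open>Digit 0 has probability 0, so it can serve as the common name of all digits larger than
  k.\<close>

definition cut :: "nat \<Rightarrow> int \<Rightarrow> int" where
  "cut k c = (if \<bar>c\<bar> \<le> int k then c else 0)"

definition cut_label :: "nat \<Rightarrow> real \<Rightarrow> nat" where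
  "cut_label k x = int_encode (cut k (digit x))"

lemma cut_label_measurable[measurable]: "cut_label k \<in> borel \<rightarrow>\<^sub>M count_space UNIV"
  unfolding cut_label_def by measurable

lemma finite_range_cut_label: "finite (range (cut_label k))"
proof (rule finite_subset)
  show "range (cut_label k) \<subseteq> int_encode ` {- int k..int k}"
    unfolding cut_label_def by (intro image_subsetI imageI) (auto simp: cut_def)
qed simp

text \<open>For k >= 3 this dominates the cost - ln p of naming a digit larger than k, by
  \<open>digit_prob_ge\<close>. It is integrable because ln |x| is, so its expectation tends to
  0.\<close>

definition tail_cost :: "nat \<Rightarrow> real \<Rightarrow> real" where
  "tail_cost k x = indicator {x. int k < \<bar>digit x\<bar>} x * \<bar>ln (\<nu>_min / 10000) + 2 * ln \<bar>x\<bar>\<bar>"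

lemma tail_cost_measurable[measurable]: "tail_cost k \<in> borel_measurable borel"
proof -
  have [measurable]: "{x. int k < \<bar>digit x\<bar>} \<in> sets borel"
    using measurable_sets[OF digit_measurable, of "{c. int k < \<bar>c\<bar>}"] by (simp add: vimage_def)
  show ?thesis unfolding tail_cost_def by measurable
qed

lemma integrable_tail_cost: "integrable \<nu> (tail_cost k)"
proof (rule Bochner_Integration.integrable_bound)
  show "integrable \<nu> (\<lambda>x. \<bar>ln (\<nu>_min / 10000) + 2 * ln \<bar>x\<bar>\<bar>)"
    using integrable_ln_abs by (intro integrable_abs Bochner_Integration.integrable_add) auto
qed (auto simp: tail_cost_def indicator_def)

lemma tail_cost_tendsto: "(\<lambda>k. line.expectation (tail_cost k)) \<longlonglongrightarrow> 0"
proof -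
  have "(\<lambda>k. line.expectation (tail_cost k)) \<longlonglongrightarrow> line.expectation (\<lambda>_. 0)"
  proof (rule integral_dominated_convergence)
    show "integrable \<nu> (\<lambda>x. \<bar>ln (\<nu>_min / 10000) + 2 * ln \<bar>x\<bar>\<bar>)"
      using integrable_ln_abs by (intro integrable_abs Bochner_Integration.integrable_add) auto
    show "AE x in \<nu>. (\<lambda>k. tail_cost k x) \<longlonglongrightarrow> 0"
    proof (rule AE_I2)
      fix x
      have "eventually (\<lambda>k. tail_cost k x = 0) sequentially"
        using eventually_ge_at_top[of "nat \<bar>digit x\<bar>"]
        by eventually_elim (simp add: tail_cost_def nat_le_iff)
      then show "(\<lambda>k. tail_cost k x) \<longlonglongrightarrow> 0" by (rule tendsto_eventually)
    qed
  qed (auto simp: tail_cost_def indicator_def)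
  then show ?thesis by simp
qed

text \<open>The branch of such a digit is full, so \<open>cell_prob_digits_ge\<close> applies with
  an image of length 2, and 2 / 20000 = 1 / 10000.\<close>

lemma digit_prob_ge:
  assumes x: "x \<in> I" and k: "3 \<le> \<bar>digit x\<bar>"
  shows "\<nu>_min / 10000 * x\<^sup>2 \<le> line.prob {y \<in> space \<nu>. digit y = digit x}"
proof -
  have "digit x \<noteq> 0" using k by auto
  note b = branch_phi[OF x refl this]
  have low: "branch_low (digit x) = \<alpha> - 2" using k by (auto simp: branch_low_def)
  have "{\<alpha> - 2<..<\<alpha>} \<subseteq> (\<phi> ^^ 1) ` cylinder (digits 1 x)"
  proof
    fix t assume "t \<in> {\<alpha> - 2<..<\<alpha>}"
    then show "t \<in> (\<phi> ^^ 1) ` cylinder (digits 1 x)"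
      using branch_inverse[OF b(4), of t] low by (intro image_eqI[of _ _ "branch (digit x) t"]) (auto simp: cylinder_def)
  qed
  from cell_prob_digits_ge[OF x, of 1, OF _ _ this]
  have "\<nu>_min * 2 * (xprod 1 x)\<^sup>2 / 20000 \<le> line.cell_prob (digits 1) x"
    using \<open>digit x \<noteq> 0\<close> by simp
  then show ?thesis by (simp add: line.cell_prob_def xprod_Suc)
qed

text \<open>Recovering the digits from the cut digits costs at most the expected
  \<open>tail_cost k\<close> per letter, and the cells of the full words are bounded by a constant
  times \<open>xprod\<close> squared. Large k guarantees that the hidden digits belong to full
  branches.\<close>

lemma cut_entropy_ge:
  assumes k: "3 \<le> k"
  shows "real n * (entropy_value - line.expectation (tail_cost k)) - ln (800 * \<nu>_max)
    \<le> line.label_entropy (word \<phi> (cut_label k) n)"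
proof -
  let ?p = "\<lambda>c. line.prob {y \<in> space \<nu>. digit y = c}"
  \<comment> \<open>A nonzero digit of size at most k is known from its cut and costs nothing. A
    larger one is guessed with its own probability; all of these share the cut 0, so their weights
    add up to at most 1.\<close>
  define \<kappa> where "\<kappa> = (\<lambda>c :: int. if c = 0 then 0 else if \<bar>c\<bar> \<le> int k then 1 else ?p c)"
  have Z[measurable]: "digit \<in> \<nu> \<rightarrow>\<^sub>M count_space UNIV" by measurable
  have \<kappa>0: "0 \<le> \<kappa> c" for c by (simp add: \<kappa>_def)
  have \<kappa>1: "(\<integral>\<^sup>+c. ennreal (\<kappa> c) * indicator {c. cut k c = b} c \<partial>count_space UNIV) \<le> 1" for b
  proof (cases "b = 0")
    case True
    have "(\<integral>\<^sup>+c. ennreal (\<kappa> c) * indicator {c. cut k c = b} c \<partial>count_space UNIV) \<le> (\<integral>\<^sup>+c. ennreal (?p c) \<partial>count_space UNIV)"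
      by (rule nn_integral_mono) (auto simp: \<kappa>_def cut_def True indicator_def)
    also have "\<dots> = 1" by (rule line.sum_cell_prob[OF Z])
    finally show ?thesis .
  next
    case False
    have "(\<integral>\<^sup>+c. ennreal (\<kappa> c) * indicator {c. cut k c = b} c \<partial>count_space UNIV) \<le> (\<integral>\<^sup>+c. 1 * indicator {b} c \<partial>count_space UNIV)"
      by (rule nn_integral_mono) (use False in \<open>auto simp: \<kappa>_def cut_def indicator_def split: if_splits\<close>)
    also have "\<dots> = 1" by (subst nn_integral_indicator_singleton) auto
    finally show ?thesis .
  qed
  have ln\<kappa>: "AE x in \<nu>. 0 < \<kappa> (digit x) \<and> - ln (\<kappa> (digit x)) \<le> tail_cost k x \<and> ln (\<kappa> (digit x)) \<le> 0"
    using AE_regular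
  proof eventually_elim
    case (elim x)
    then have x: "x \<in> I" and d0: "digit x \<noteq> 0" by (auto dest: spec[of _ 1])
    have x0: "x \<noteq> 0" using d0 by (auto simp: digit_def)
    show ?case
    proof (cases "\<bar>digit x\<bar> \<le> int k")
      case True
      then show ?thesis using d0 by (simp add: \<kappa>_def tail_cost_def)
    next
      case False
      have pos: "0 < \<nu>_min / 10000 * x\<^sup>2" using \<nu>_min_pos x0 by simp
      have ge: "\<nu>_min / 10000 * x\<^sup>2 \<le> ?p (digit x)" by (rule digit_prob_ge[OF x]) (use k False in linarith)
      have "ln (\<nu>_min / 10000) + 2 * ln \<bar>x\<bar> = ln (\<nu>_min / 10000 * \<bar>x\<bar>\<^sup>2)"
        using x0 \<nu>_min_pos by (simp only: ln_mult ln_realpow) (simp add: ln_mult ln_realpow)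
      also have "\<dots> \<le> ln (?p (digit x))"
        using ge pos by (subst ln_le_cancel_iff) auto
      finally have "- ln (?p (digit x)) \<le> tail_cost k x" using False by (auto simp: tail_cost_def)
      moreover have "ln (?p (digit x)) \<le> 0" using ge pos by simp
      ultimately show ?thesis using False d0 ge pos by (simp add: \<kappa>_def)
    qed
  qed
  have m\<kappa>: "(\<lambda>x. ln (\<kappa> (digit x))) \<in> borel_measurable \<nu>"
    using measurable_compose[OF Z, of "\<lambda>c. ln (\<kappa> c)" borel] by simp
  have i\<kappa>: "integrable \<nu> (\<lambda>x. ln (\<kappa> (digit x)))"
  proof (rule Bochner_Integration.integrable_bound[OF integrable_tail_cost[of k] m\<kappa>])
    show "AE x in \<nu>. norm (ln (\<kappa> (digit x))) \<le> norm (tail_cost k x)"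
      using ln\<kappa> by eventually_elim auto
  qed
  have E\<kappa>: "- line.expectation (\<lambda>x. ln (\<kappa> (digit x))) \<le> line.expectation (tail_cost k)"
    unfolding Bochner_Integration.integral_minus[symmetric]
  proof (rule integral_mono_AE)
    show "AE x in \<nu>. - ln (\<kappa> (digit x)) \<le> tail_cost k x" using ln\<kappa> by eventually_elim auto
  qed (use i\<kappa> integrable_tail_cost in auto)
  let ?s = "\<lambda>x. 800 * \<nu>_max * (xprod n x)\<^sup>2"
  have s_ln: "AE x in \<nu>. ln (?s x) = ln (800 * \<nu>_max) + 2 * ln (xprod n x)"
    using AE_regular
  proof eventually_elim
    case (elim x)
    then have "0 < xprod n x" by (intro xprod_pos) auto
    then show ?case using \<nu>_max_pos by (simp add: ln_mult ln_realpow)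
  qed
  have is_ln: "integrable \<nu> (\<lambda>x. ln (800 * \<nu>_max) + 2 * ln (xprod n x))"
    using integrable_ln_xprod by simp
  have is_s: "integrable \<nu> (\<lambda>x. ln (?s x))"
    by (rule iffD2[OF integrable_cong_AE is_ln]) (use s_ln is_ln in auto)
  have "line.expectation (\<lambda>x. ln (?s x)) = line.expectation (\<lambda>x. ln (800 * \<nu>_max) + 2 * ln (xprod n x))"
    by (rule integral_cong_AE) (use s_ln is_ln is_s in auto)
  also have "\<dots> = ln (800 * \<nu>_max) - real n * entropy_value"
    using integrable_ln_xprod[of n] expectation_ln_xprod[of n] line.prob_space by simp
  finally have Es: "line.expectation (\<lambda>x. ln (?s x)) = ln (800 * \<nu>_max) - real n * entropy_value" .
  have "- line.expectation (\<lambda>x. ln (?s x)) \<le> line.label_entropy (word \<phi> (\<lambda>x. cut k (digit x)) n)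
     - real n * line.expectation (\<lambda>x. ln (\<kappa> (digit x)))"
  proof (rule line.label_entropy_word_code[OF Z _ \<kappa>0 \<kappa>1 _ i\<kappa> _ is_s])
    show "finite ((\<lambda>x. cut k (digit x)) ` space \<nu>)"
      by (rule finite_subset[of _ "{- int k..int k}"]) (auto simp: cut_def)
    show "AE x in \<nu>. 0 < \<kappa> (digit x)" using ln\<kappa> by eventually_elim auto
    show "AE x in \<nu>. line.cell_prob (digits n) x \<le> ?s x"
      using AE_regular by eventually_elim (auto intro: cell_prob_digits_le)
  qed
  also have "line.label_entropy (word \<phi> (\<lambda>x. cut k (digit x)) n) = line.label_entropy (word \<phi> (cut_label k) n)"
    by (rule line.label_entropy_cong) (simp add: word_eq_iff cut_label_def int_encode_eq)
  finally have "real n * entropy_value - ln (800 * \<nu>_max)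
     \<le> line.label_entropy (word \<phi> (cut_label k) n) - real n * line.expectation (\<lambda>x. ln (\<kappa> (digit x)))"
    by (simp add: Es)
  moreover have "- (real n * line.expectation (\<lambda>x. ln (\<kappa> (digit x)))) \<le> real n * line.expectation (tail_cost k)"
    using mult_left_mono[OF E\<kappa>, of "real n"] by simp
  ultimately show ?thesis by (simp add: right_diff_distrib)
qed

lemma cut_entropy_rate_ge:
  assumes k: "3 \<le> k"
  shows "entropy_value - line.expectation (tail_cost k) \<le> lim (\<lambda>n. line.label_entropy (word \<phi> (cut_label k) n) / real n)"
proof -
  define h c where "h = entropy_value - line.expectation (tail_cost k)" and "c = ln (800 * \<nu>_max)"
  have M: "cut_label k \<in> \<nu> \<rightarrow>\<^sub>M count_space UNIV" by measurable
  have conv: "(\<lambda>n. line.label_entropy (word \<phi> (cut_label k) n) / real n) \<longlonglongrightarrow> lim (\<lambda>n. line.label_entropy (word \<phi> (cut_label k) n) / real n)"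
    using line.word_entropy_rate_convergent[OF M] finite_range_cut_label by (simp add: convergent_LIMSEQ_iff)
  have "(\<lambda>n. (real n * h - c) / real n) \<longlonglongrightarrow> h" by real_asymp
  moreover have "(real n * h - c) / real n \<le> line.label_entropy (word \<phi> (cut_label k) n) / real n" for n
    unfolding h_def c_def by (intro divide_right_mono cut_entropy_ge[OF k]) simp
  ultimately show ?thesis
    unfolding h_def[symmetric] by (intro LIMSEQ_le[OF _ conv]) auto
qed

section \<open>The entropies on the domain and on the interval\<close>

text \<open>The inequalities are strict because l1 = \<alpha> for \<alpha> = g and l2 = \<alpha> for
  \<alpha> = G, and \<alpha> itself lies outside \<open>I\<close>.\<close>

lemma phi_ends:
  assumes "gold_g < \<alpha>" "\<alpha> < gold_G"
  shows "\<phi> \<alpha> = l1" "\<phi> (\<alpha> - 2) = l2"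
proof -
  have "gold_g * gold_g + gold_g = 1" "gold_G * gold_G = gold_G + 1"
    using gold_G_square by (simp_all add: gold_g_eq algebra_simps)
  then have "0 < (\<alpha> - gold_g) * (\<alpha> + gold_G)" "0 < (gold_G - \<alpha>) * (\<alpha> + gold_g)"
    using assms \<alpha>_bounds gold_G_bounds by (auto intro!: mult_pos_pos simp: gold_g_eq)
  then have "1 < \<alpha> * (\<alpha> + 1)" "1 < (2 - \<alpha>) * (\<alpha> + 1)"
    using gold_G_square by (simp_all add: gold_g_eq algebra_simps)
  then have "l1 < \<alpha>" "l2 < \<alpha>"
    using \<alpha>_bounds by (simp_all add: l1_def l2_def field_simps)
  then have "l1 \<in> I" "l2 \<in> I" using l_bounds by (auto simp: mem_I)
  moreover have "\<bar>\<alpha>\<bar> = 1 / (real_of_int 1 + l1)" "\<bar>\<alpha> - 2\<bar> = 1 / (real_of_int 1 + l2)"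
    using \<alpha>_bounds by (auto simp: l1_def l2_def)
  ultimately show "\<phi> \<alpha> = l1" "\<phi> (\<alpha> - 2) = l2"
    using ocf_d_eqI(2)[of 1 l1 \<alpha>] ocf_d_eqI(2)[of 1 l2 "\<alpha> - 2"] l_pos by auto
qed

lemma ocf_Omega_eq:
  "\<exists>B \<in> null_sets lborel. \<forall>z. z \<notin> B \<longrightarrow> z \<in> ocf_Omega \<alpha> \<longleftrightarrow> z \<in> open_dom"
proof -
  let ?B = "{z :: real \<times> real. fst z = l1} \<union> ({z. snd z = 2 - G} \<union> ({z. snd z = 1} \<union> ({z. snd z = G} \<union> {z. snd z = 0})))"
  have "?B \<in> null_sets lborel"
    by (intro null_sets.Un null_vertical_line null_horizontal_line)
  moreover have "(x, y) \<in> ocf_Omega \<alpha> \<longleftrightarrow> (x, y) \<in> open_dom" if "(x, y) \<notin> ?B" for x y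
  proof -
    have ne: "x \<noteq> l1" "y \<noteq> 2 - G" "y \<noteq> 1" "y \<noteq> G" "y \<noteq> 0" using that by auto
    consider "\<alpha> = gold_g" | "\<alpha> = gold_G" | "gold_g < \<alpha>" "\<alpha> < gold_G"
      using \<alpha>_ge \<alpha>_le by linarith
    then show ?thesis
    proof cases
      case 1
      have g: "gold_g * gold_g + gold_g = 1" "0 < gold_g" "gold_g < 1"
        using gold_G_square gold_G_bounds by (simp_all add: gold_g_eq algebra_simps)
      \<comment> \<open>At g the middle strip is empty.\<close>
      have l1: "l1 = \<alpha>" unfolding l1_def unfolding 1 using g by (simp add: field_simps)
      have "l2 = (gold_g - 1) / (2 - gold_g)" unfolding l2_def unfolding 1 using g by (simp add: field_simps)
      moreover have "{0..<1 - gold_g} = {0..<2 - G}" by (simp add: gold_g_eq)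
      ultimately have \<Omega>: "ocf_Omega \<alpha> = I \<times> {0..<2 - G} \<union> {l2..<\<alpha>} \<times> {1..<G}"
        using 1 by (simp add: ocf_Omega_def ocf_I_def)
      show ?thesis
        unfolding \<Omega> open_dom_def using ne l1 l_bounds gold_G_bounds by (auto simp: mem_I)
    next
      case 2
      \<comment> \<open>At G the middle strip extends over the whole interval and the top strip is
        empty.\<close>
      have "l1 = \<alpha> - 2" "l2 = \<alpha>"
        unfolding l1_def l2_def unfolding 2 using gold_G_square gold_G_bounds by (simp_all add: field_simps)
      moreover have \<Omega>: "ocf_Omega \<alpha> = I \<times> {0..<1}"
        using 2 by (simp add: ocf_Omega_def ocf_I_def gold_g_eq)
      ultimately show ?thesis
        unfolding \<Omega> open_dom_def using ne gold_G_bounds by (auto simp: mem_I)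
    next
      case 3
      then have \<Omega>: "ocf_Omega \<alpha> = I \<times> {0..<2 - G} \<union> {l1<..<\<alpha>} \<times> {2 - G<..1} \<union> {l2..<\<alpha>} \<times> {1..<G}"
        by (auto simp: ocf_Omega_def phi_ends)
      show ?thesis
        unfolding \<Omega> open_dom_def using ne l_bounds gold_G_bounds by (auto simp: mem_I)
    qed
  qed
  ultimately show ?thesis by (intro bexI[of _ ?B]) (auto simp del: Un_iff)
qed

lemma AE_ocf_Omega: "AE z in lborel. z \<in> ocf_Omega \<alpha> \<longleftrightarrow> z \<in> open_dom"
proof -
  obtain B where B: "B \<in> null_sets lborel" "\<And>z. z \<notin> B \<Longrightarrow> z \<in> ocf_Omega \<alpha> \<longleftrightarrow> z \<in> open_dom"
    using ocf_Omega_eq by blast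
  from AE_not_in[OF B(1)] show ?thesis by eventually_elim (rule B(2))
qed

lemma ocf_Omega_borel[measurable]: "ocf_Omega \<alpha> \<in> sets borel"
  unfolding ocf_Omega_def borel_prod[symmetric] ocf_I_def by auto

abbreviation "\<mu>\<^sub>0 \<equiv> ocf_mu_normalized \<alpha>"
abbreviation "\<nu>\<^sub>0 \<equiv> ocf_nu \<alpha>"

lemma space_mu: "space \<mu>\<^sub>0 = ocf_Omega \<alpha>"
  and sets_mu: "sets \<mu>\<^sub>0 = sets (restrict_space lborel (ocf_Omega \<alpha>))"
  by (simp_all add: ocf_mu_normalized_def ocf_mu_def space_scale_measure space_restrict_space)

lemma mem_sets_mu: "A \<in> sets \<mu>\<^sub>0 \<longleftrightarrow> A \<in> sets borel \<and> A \<subseteq> ocf_Omega \<alpha>"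
  unfolding sets_mu by (subst sets_restrict_space_iff) (auto simp: ocf_Omega_borel)

lemma emeasure_mu:
  assumes "A \<in> sets \<mu>\<^sub>0"
  shows "emeasure \<mu>\<^sub>0 A = emeasure \<mu> A"
proof -
  have A[measurable]: "A \<in> sets borel" and sub: "A \<subseteq> ocf_Omega \<alpha>" using assms by (auto simp: mem_sets_mu)
  let ?f = "\<lambda>z :: real \<times> real. ennreal (1 / (1 + fst z * snd z)\<^sup>2)"
  have f: "(\<lambda>(x, y). ennreal (1 / (1 + x * y)\<^sup>2)) = ?f" by (auto simp: case_prod_unfold)
  have [measurable]: "?f \<in> borel_measurable borel" by measurable
  have "emeasure (ocf_mu \<alpha>) A = (\<integral>\<^sup>+z. ?f z * indicator A z \<partial>restrict_space lborel (ocf_Omega \<alpha>))"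
    unfolding ocf_mu_def f
    by (rule emeasure_density) (use assms in \<open>auto simp: sets_mu intro!: measurable_restrict_space1\<close>)
  also have "\<dots> = (\<integral>\<^sup>+z. ?f z * indicator A z * indicator (ocf_Omega \<alpha>) z \<partial>lborel)"
    by (rule nn_integral_restrict_space) simp
  also have "\<dots> = (\<integral>\<^sup>+z. ?f z * indicator open_dom z * indicator A z \<partial>lborel)"
    by (rule nn_integral_cong_AE)
       (use AE_ocf_Omega in eventually_elim, use sub in \<open>auto simp: indicator_def\<close>)
  finally have mu: "emeasure (ocf_mu \<alpha>) A = (\<integral>\<^sup>+z. ?f z * indicator open_dom z * indicator A z \<partial>lborel)" .
  have "emeasure \<mu> A = (\<integral>\<^sup>+z. ennreal (1 / mass) * (?f z * indicator open_dom z * indicator A z) \<partial>lborel)"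
    unfolding \<mu>_def
    by (subst emeasure_density, measurable)
       (use mass_pos in \<open>auto intro!: nn_integral_cong simp: dens_def ennreal_mult[symmetric] mult_ac indicator_def\<close>)
  also have "\<dots> = ennreal (1 / mass) * emeasure (ocf_mu \<alpha>) A"
    unfolding mu by (rule nn_integral_cmult) measurable
  also have "\<dots> = emeasure \<mu>\<^sub>0 A"
    by (simp add: ocf_mu_normalized_def mass_def)
  finally show ?thesis by simp
qed

lemma AE_\<mu>_Omega: "AE z in \<mu>. z \<in> ocf_Omega \<alpha>"
proof -
  have "AE z in lborel. 0 < ennreal (dens z) * indicator open_dom z \<longrightarrow> z \<in> ocf_Omega \<alpha>"
    using AE_ocf_Omega by eventually_elim (auto simp: indicator_def)
  then show ?thesis
    unfolding \<mu>_def by (subst AE_density) auto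
qed

sublocale plane_trace: conull_restriction \<mu> \<Phi> \<mu>\<^sub>0
proof
  show "A \<in> sets \<mu>\<^sub>0 \<longleftrightarrow> A \<in> sets \<mu> \<and> A \<subseteq> space \<mu>\<^sub>0" for A
    by (simp add: mem_sets_mu space_mu)
  show "space \<mu>\<^sub>0 \<in> sets \<mu>" by (simp add: space_mu)
  show "measure \<mu>\<^sub>0 A = plane.prob A" if "A \<in> sets \<mu>\<^sub>0" for A
    using emeasure_mu[OF that] by (simp add: measure_def)
  show "AE z in \<mu>. z \<in> space \<mu>\<^sub>0" unfolding space_mu by (rule AE_\<mu>_Omega)
qed

lemma Omega_fst: "z \<in> ocf_Omega \<alpha> \<Longrightarrow> fst z \<in> I"
proof -
  assume z: "z \<in> ocf_Omega \<alpha>"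
  consider "\<alpha> = gold_g" | "\<alpha> = gold_G" | "gold_g < \<alpha>" "\<alpha> < gold_G"
    using \<alpha>_ge \<alpha>_le by linarith
  then show "fst z \<in> I"
  proof cases
    case 1
    have "l2 = (gold_g - 1) / (2 - gold_g)"
      using 1 gold_G_bounds by (simp add: l2_def gold_g_eq field_simps)
    then show ?thesis using z 1 l_bounds by (auto simp: ocf_Omega_def ocf_I_def)
  next
    case 2
    moreover have "gold_G \<noteq> gold_g" by (simp add: gold_g_eq)
    ultimately show ?thesis using z by (auto simp: ocf_Omega_def ocf_I_def)
  next
    case 3
    then show ?thesis using z l_bounds by (auto simp: ocf_Omega_def phi_ends mem_I)
  qed
qed

lemma I_borel[measurable]: "I \<in> sets borel"
  by (simp add: ocf_I_def)

lemma mem_sets_nu: "A \<in> sets \<nu>\<^sub>0 \<longleftrightarrow> A \<in> sets borel \<and> A \<subseteq> I"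
  unfolding ocf_nu_def sets_distr by (subst sets_restrict_space_iff) (auto simp: I_borel)

lemma space_nu: "space \<nu>\<^sub>0 = I"
  by (simp add: ocf_nu_def space_restrict_space)

lemma measure_nu:
  assumes "A \<in> sets \<nu>\<^sub>0"
  shows "measure \<nu>\<^sub>0 A = line.prob A"
proof -
  have A[measurable]: "A \<in> sets borel" and sub: "A \<subseteq> I" using assms by (auto simp: mem_sets_nu)
  have vim: "fst -` A \<in> sets (borel :: (real \<times> real) measure)"
    using measurable_sets[OF fst_borel_measurable A] by simp
  have m: "fst \<in> \<mu>\<^sub>0 \<rightarrow>\<^sub>M restrict_space borel I"
  proof (rule measurable_restrict_space2)
    show "fst \<in> space \<mu>\<^sub>0 \<rightarrow> I" using Omega_fst by (auto simp: space_mu)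
    have "fst \<in> restrict_space lborel (ocf_Omega \<alpha>) \<rightarrow>\<^sub>M borel"
      by (rule measurable_restrict_space1) simp
    then show "fst \<in> \<mu>\<^sub>0 \<rightarrow>\<^sub>M borel" by (simp only: measurable_cong_sets[OF sets_mu refl])
  qed
  have "measure \<nu>\<^sub>0 A = measure \<mu>\<^sub>0 (fst -` A \<inter> ocf_Omega \<alpha>)"
    unfolding ocf_nu_def space_mu[symmetric]
    by (rule measure_distr[OF m]) (use sub in \<open>auto simp: sets_restrict_space_iff I_borel\<close>)
  also have "\<dots> = plane.prob (fst -` A \<inter> ocf_Omega \<alpha>)"
    by (rule plane_trace.measure_N) (use vim in \<open>auto simp: mem_sets_mu\<close>)
  also have "\<dots> = plane.prob (fst -` A)"
    by (rule measure_eq_AE) (use AE_\<mu>_Omega vim in \<open>auto elim!: eventually_mono\<close>)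
  also have "\<dots> = line.prob A"
    unfolding \<nu>_def by (subst measure_distr) auto
  finally show ?thesis .
qed

sublocale line_trace: conull_restriction \<nu> \<phi> \<nu>\<^sub>0
proof
  show "A \<in> sets \<nu>\<^sub>0 \<longleftrightarrow> A \<in> sets \<nu> \<and> A \<subseteq> space \<nu>\<^sub>0" for A
    by (simp add: mem_sets_nu space_nu)
  show "space \<nu>\<^sub>0 \<in> sets \<nu>" by (simp add: space_nu)
  show "measure \<nu>\<^sub>0 A = line.prob A" if "A \<in> sets \<nu>\<^sub>0" for A
    by (rule measure_nu[OF that])
  show "AE x in \<nu>. x \<in> space \<nu>\<^sub>0" unfolding space_nu by (rule AE_\<nu>_I)
qed

lemma plane_word_entropy_fst:
  fixes F :: "real \<Rightarrow> nat"
  assumes F: "F \<in> borel \<rightarrow>\<^sub>M count_space UNIV"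
  shows "plane.label_entropy (word \<Phi> (\<lambda>z. F (fst z)) n) = line.label_entropy (word \<phi> F n)"
proof -
  have "F \<in> \<nu> \<rightarrow>\<^sub>M count_space UNIV" using F by (simp only: measurable_cong_sets[OF sets_\<nu> refl])
  then have "word \<phi> F n \<in> \<nu> \<rightarrow>\<^sub>M count_space UNIV" by (rule line.word_measurable)
  then have "word \<phi> F n \<in> borel \<rightarrow>\<^sub>M count_space UNIV" by (simp only: measurable_cong_sets[OF sets_\<nu> refl])
  from plane_label_entropy_fst[OF this] show ?thesis
    by (simp add: word_Phi_fst[abs_def] cong: plane.label_entropy_cong)
qed

lemma ks_entropy_plane_le: "ks_entropy \<mu>\<^sub>0 \<Phi> \<le> ereal entropy_value"
proof (rule plane_trace.ks_entropy_le)
  fix F :: "real \<times> real \<Rightarrow> nat"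
  assume "F \<in> \<mu> \<rightarrow>\<^sub>M count_space UNIV" "finite (F ` space \<mu>)"
  then show "lim (\<lambda>n. plane.label_entropy (word \<Phi> F n) / real n) \<le> entropy_value"
    by (intro plane_entropy_rate_le) (simp_all only: measurable_cong_sets[OF sets_\<mu> refl] space_\<mu>)
qed

text \<open>A label of the interval, composed with \<open>fst\<close>, is a label of the plane with
  the same word entropies.\<close>

lemma ks_entropy_line_le: "ks_entropy \<nu>\<^sub>0 \<phi> \<le> ereal entropy_value"
proof (rule line_trace.ks_entropy_le)
  fix F :: "real \<Rightarrow> nat"
  assume "F \<in> \<nu> \<rightarrow>\<^sub>M count_space UNIV" and fin: "finite (F ` space \<nu>)"
  then have F[measurable]: "F \<in> borel \<rightarrow>\<^sub>M count_space UNIV" by (simp only: measurable_cong_sets[OF sets_\<nu> refl])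
  have "lim (\<lambda>n. plane.label_entropy (word \<Phi> (\<lambda>z. F (fst z)) n) / real n) \<le> entropy_value"
  proof (rule plane_entropy_rate_le)
    show "finite (range (\<lambda>z :: real \<times> real. F (fst z)))"
      by (rule finite_subset[of _ "range F"]) (use fin in auto)
  qed measurable
  then show "lim (\<lambda>n. line.label_entropy (word \<phi> F n) / real n) \<le> entropy_value"
    by (simp only: plane_word_entropy_fst[OF F])
qed

text \<open>Each cut loses only its expected \<open>tail_cost\<close>, which vanishes as the cut
  grows; the supremum over finite partitions absorbs the limit.\<close>

lemma entropy_value_le_cut:
  assumes "\<And>k. 3 \<le> k \<Longrightarrow> ereal (lim (\<lambda>n. line.label_entropy (word \<phi> (cut_label k) n) / real n)) \<le> h"
  shows "ereal entropy_value \<le> h"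
proof -
  have "(\<lambda>k. ereal (entropy_value - line.expectation (tail_cost k))) \<longlonglongrightarrow> ereal entropy_value"
    using tendsto_diff[OF tendsto_const tail_cost_tendsto, of entropy_value] by simp
  then show ?thesis
  proof (rule LIMSEQ_le_const2)
    show "\<exists>N. \<forall>k\<ge>N. ereal (entropy_value - line.expectation (tail_cost k)) \<le> h"
    proof (intro exI allI impI)
      fix k :: nat assume k: "3 \<le> k"
      have "ereal (entropy_value - line.expectation (tail_cost k)) \<le> ereal (lim (\<lambda>n. line.label_entropy (word \<phi> (cut_label k) n) / real n))"
        using cut_entropy_rate_ge[OF k] by simp
      also have "\<dots> \<le> h" by (rule assms[OF k])
      finally show "ereal (entropy_value - line.expectation (tail_cost k)) \<le> h" .
    qed
  qed
qed

lemma ks_entropy_line_ge: "ereal entropy_value \<le> ks_entropy \<nu>\<^sub>0 \<phi>"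
proof (rule entropy_value_le_cut, rule line_trace.ks_entropy_ge_any_label)
  fix k
  show "cut_label k \<in> \<nu> \<rightarrow>\<^sub>M count_space UNIV" by measurable
  show "finite (cut_label k ` space \<nu>)" using finite_range_cut_label by simp
qed

lemma ks_entropy_plane_ge: "ereal entropy_value \<le> ks_entropy \<mu>\<^sub>0 \<Phi>"
proof (rule entropy_value_le_cut)
  fix k
  have "ereal (lim (\<lambda>n. plane.label_entropy (word \<Phi> (\<lambda>z. cut_label k (fst z)) n) / real n)) \<le> ks_entropy \<mu>\<^sub>0 \<Phi>"
  proof (rule plane_trace.ks_entropy_ge_any_label)
    show "(\<lambda>z. cut_label k (fst z)) \<in> \<mu> \<rightarrow>\<^sub>M count_space UNIV" by measurable
    show "finite ((\<lambda>z. cut_label k (fst z)) ` space \<mu>)"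
      by (rule finite_subset[OF _ finite_range_cut_label[of k]]) auto
  qed
  then show "ereal (lim (\<lambda>n. line.label_entropy (word \<phi> (cut_label k) n) / real n)) \<le> ks_entropy \<mu>\<^sub>0 \<Phi>"
    by (simp only: plane_word_entropy_fst[OF cut_label_measurable])
qed

end

theorem theorem20:
  fixes \<alpha> :: real
  assumes "gold_g \<le> \<alpha>" and "\<alpha> \<le> gold_G"
  shows "ks_entropy (ocf_mu_normalized \<alpha>) (ocf_Phi \<alpha>) = ks_entropy (ocf_nu \<alpha>) (ocf_phi \<alpha>)
       \<and> ks_entropy (ocf_nu \<alpha>) (ocf_phi \<alpha>) = ereal (pi\<^sup>2 / (9 * ln gold_G))"
proof -
  interpret odd_cf \<alpha> using assms by unfold_locales
  have "ks_entropy (ocf_mu_normalized \<alpha>) (ocf_Phi \<alpha>) = ereal entropy_value"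
    by (rule antisym[OF ks_entropy_plane_le ks_entropy_plane_ge])
  moreover have "ks_entropy (ocf_nu \<alpha>) (ocf_phi \<alpha>) = ereal entropy_value"
    by (rule antisym[OF ks_entropy_line_le ks_entropy_line_ge])
  ultimately show ?thesis by (simp add: entropy_value_def)
qed

end
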